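(* Let $\mathcal X$ be an étale proper groupoid with corners. The maps $$J:A_{cl}^*(\mathcal X)\to A^*(\mathcal X),\quad J([\alpha])=t_*s^*\alpha,\qquad K:A^*(\mathcal X)\to A_{cl}^*(\mathcal X),\quad K(\alpha)=[\rho\alpha],$$ where $\rho$ is a partition of unity for $\mathcal X$, are inverse to one another. In particular, $K$ does not depend on the choice of the partition of unity.
   Context: An étale proper groupoid with corners $\mathcal X$ is a groupoid whose object set $X_0$ and morphism set $X_1$ are manifolds with corners of the same dimension, with source and target maps $s,t:X_1\to X_0$ local diffeomorphisms (hence so are the composition, inverse and identity maps), and with $s\times t:X_1\to X_0\times X_0$ proper. $A^*(M)$ denotes smooth differential forms on a manifold with corners $M$. A subset $C\subset X_0$ is clean if $t|_{s^{-1}(C)}$ is proper, equivalently $s|_{t^{-1}(C)}$ is proper. A subset $C\subset X_1$ is clean if it is closed and $s(C),t(C)$ are clean. $A_{cl}^*(X_i)\subset A^*(X_i)$ is the space of forms with clean support. Push-forward of forms along a local diffeomorphism (always with respect to the canonical relative orientation $[\det d(\cdot)]$) is summation over fibers, defined for forms on whose support the map is proper: $(t_*\beta)_y=\sum_{z\in t^{-1}(y)}((dt_z)^{-1})^*\beta_z$. $A^*(\mathcal X)=\ker(s^*-t^*:A^*(X_0)\to A^*(X_1))$ and $A_{cl}^*(\mathcal X)=\mathrm{coker}(s_*-t_*:A_{cl}^*(X_1)\to A_{cl}^*(X_0))$; the map $J$ is well defined. A partition of unity for $\mathcal X$ is a smooth function $\rho:X_0\to[0,1]$ with clean support such that $t_*s^*\rho=1$;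 one always exists. *)

theory Defs
  imports "HOL-Analysis.Analysis"
begin

primrec Ck_on :: "nat \<Rightarrow> 'e::real_normed_vector set \<Rightarrow> ('e \<Rightarrow> 'f::real_normed_vector) \<Rightarrow> bool" where
  "Ck_on 0 W f \<longleftrightarrow> continuous_on W f"
| "Ck_on (Suc k) W f \<longleftrightarrow>
     (\<exists>f'. (\<forall>x\<in>W. (f has_derivative f' x) (at x)) \<and> (\<forall>v. Ck_on k W (\<lambda>x. f' x v)))"

text \<open>Smoothness on an arbitrary subset, e.g. a relatively open subset of a quadrant,
  means that there are smooth local extensions to open subsets of the ambient space.\<close>

definition smooth_on :: "'e::real_normed_vector set \<Rightarrow> ('e \<Rightarrow> 'f::real_normed_vector) \<Rightarrow> bool" where
  "smooth_on A f \<longleftrightarrow>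
     (\<forall>x\<in>A. \<exists>W g. open W \<and> x \<in> W \<and> (\<forall>k. Ck_on k W g) \<and> (\<forall>y\<in>A \<inter> W. g y = f y))"

text \<open>The model of an \<open>n\<close>-manifold is a real inner product space \<open>'e\<close> of finite dimension \<open>n\<close>.
  The class \<open>real_inner\<close> is used in place of \<open>euclidean_space\<close> because the latter excludes
  \<open>n = 0\<close>. An orthonormal set of \<open>k\<close> vectors extends to an orthonormal basis, and in the
  resulting coordinates \<open>quadrant S\<close> is \<open>[0,\<infinity>)\<^sup>k \<times> \<real>\<^sup>n\<^sup>-\<^sup>k\<close>.\<close>

definition quadrant :: "'e::real_inner set \<Rightarrow> 'e set" where
  "quadrant S = {x. \<forall>b\<in>S. 0 \<le> x \<bullet> b}"

definition orthonormal :: "'e::real_inner set \<Rightarrow> bool" where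
  "orthonormal S \<longleftrightarrow> pairwise orthogonal S \<and> (\<forall>b\<in>S. norm b = 1)"

type_synonym ('a, 'e) chart = "'a set \<times> ('a \<Rightarrow> 'e)"

record ('a, 'e) manifold =
  mtop :: "'a topology"
  charts :: "('a, 'e) chart set"

definition is_chart :: "'a topology \<Rightarrow> ('a, 'e::real_inner) chart \<Rightarrow> bool" where
  "is_chart T c \<longleftrightarrow>
     openin T (fst c) \<and>
     homeomorphic_map (subtopology T (fst c)) (top_of_set (snd c ` fst c)) (snd c) \<and>
     (\<exists>S. finite S \<and> orthonormal S \<and> openin (top_of_set (quadrant S)) (snd c ` fst c))"

text \<open>The representation \<open>d \<circ> f \<circ> c\<inverse>\<close> of a map \<open>f\<close> in charts \<open>c\<close>, \<open>d\<close>, and its domain.\<close>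

definition chart_rep :: "('a, 'e) chart \<Rightarrow> ('b, 'e) chart \<Rightarrow> ('a \<Rightarrow> 'b) \<Rightarrow> 'e \<Rightarrow> 'e" where
  "chart_rep c d f = snd d \<circ> f \<circ> inv_into (fst c) (snd c)"

definition chart_dom :: "('a, 'e) chart \<Rightarrow> ('b, 'e) chart \<Rightarrow> ('a \<Rightarrow> 'b) \<Rightarrow> 'e set" where
  "chart_dom c d f = snd c ` {x \<in> fst c. f x \<in> fst d}"

text \<open>The atlas is not required to be maximal.\<close>

definition manifold_with_corners :: "('a, 'e::real_inner) manifold \<Rightarrow> bool" where
  "manifold_with_corners M \<longleftrightarrow>
     (\<exists>B :: 'e set. finite B \<and> span B = UNIV) \<and>
     Hausdorff_space (mtop M) \<and> second_countable (mtop M) \<and>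
     (\<forall>c\<in>charts M. is_chart (mtop M) c) \<and>
     (\<Union>c\<in>charts M. fst c) = topspace (mtop M) \<and>
     (\<forall>c\<in>charts M. \<forall>d\<in>charts M. smooth_on (chart_dom c d id) (chart_rep c d id))"

definition smooth_map ::
    "('a, 'e::real_inner) manifold \<Rightarrow> ('b, 'e) manifold \<Rightarrow> ('a \<Rightarrow> 'b) \<Rightarrow> bool" where
  "smooth_map M N f \<longleftrightarrow>
     continuous_map (mtop M) (mtop N) f \<and>
     (\<forall>c\<in>charts M. \<forall>d\<in>charts N. smooth_on (chart_dom c d f) (chart_rep c d f))"

definition smooth_fun :: "('a, 'e::real_inner) manifold \<Rightarrow> ('a \<Rightarrow> real) \<Rightarrow> bool" where
  "smooth_fun M f \<longleftrightarrow>
     (\<forall>c\<in>charts M. smooth_on (snd c ` fst c) (f \<circ> inv_into (fst c) (snd c)))"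

definition diffeomorphism ::
    "('a, 'e::real_inner) manifold \<Rightarrow> ('b, 'e) manifold \<Rightarrow> ('a \<Rightarrow> 'b) \<Rightarrow> bool" where
  "diffeomorphism M N f \<longleftrightarrow>
     bij_betw f (topspace (mtop M)) (topspace (mtop N)) \<and>
     smooth_map M N f \<and> smooth_map N M (inv_into (topspace (mtop M)) f)"

definition open_submanifold :: "('a, 'e) manifold \<Rightarrow> 'a set \<Rightarrow> ('a, 'e) manifold" where
  "open_submanifold M U =
     \<lparr>mtop = subtopology (mtop M) U, charts = (\<lambda>c. (fst c \<inter> U, snd c)) ` charts M\<rparr>"

definition local_diffeomorphism ::
    "('a, 'e::real_inner) manifold \<Rightarrow> ('b, 'e) manifold \<Rightarrow> ('a \<Rightarrow> 'b) \<Rightarrow> bool" where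
  "local_diffeomorphism M N f \<longleftrightarrow>
     f \<in> topspace (mtop M) \<rightarrow> topspace (mtop N) \<and>
     (\<forall>p\<in>topspace (mtop M). \<exists>U. openin (mtop M) U \<and> p \<in> U \<and> openin (mtop N) (f ` U) \<and>
        diffeomorphism (open_submanifold M U) (open_submanifold N (f ` U)) f)"

text \<open>A tangent vector at \<open>p\<close> is the family of its coordinate vectors in all charts around \<open>p\<close>
  (extended by zero to the remaining charts), related by the derivatives of the transition
  maps. At boundary points these are derivatives within the domain of the transition map,
  which are unique because the directions pointing into a quadrant span the whole space.\<close>

type_synonym ('a, 'e) tvec = "('a, 'e) chart \<Rightarrow> 'e"

definition charts_at :: "('a, 'e) manifold \<Rightarrow> 'a \<Rightarrow> ('a, 'e) chart set" where
  "charts_at M p = {c \<in> charts M. p \<in> fst c}"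

definition chart_deriv ::
    "('a, 'e::real_inner) chart \<Rightarrow> ('b, 'e) chart \<Rightarrow> ('a \<Rightarrow> 'b) \<Rightarrow> 'a \<Rightarrow> 'e \<Rightarrow> 'e" where
  "chart_deriv c d f p =
     frechet_derivative (chart_rep c d f) (at (snd c p) within chart_dom c d f)"

definition tangent_space :: "('a, 'e::real_inner) manifold \<Rightarrow> 'a \<Rightarrow> ('a, 'e) tvec set" where
  "tangent_space M p =
     {\<xi>. (\<forall>c\<in>charts_at M p. \<forall>d\<in>charts_at M p. \<xi> d = chart_deriv c d id p (\<xi> c)) \<and>
         (\<forall>c. c \<notin> charts_at M p \<longrightarrow> \<xi> c = 0)}"

text \<open>The tangent vector at \<open>p\<close> with coordinate vector \<open>v\<close> in the chart \<open>c\<close>.\<close>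

definition coord_tvec ::
    "('a, 'e::real_inner) manifold \<Rightarrow> 'a \<Rightarrow> ('a, 'e) chart \<Rightarrow> 'e \<Rightarrow> ('a, 'e) tvec" where
  "coord_tvec M p c v = (\<lambda>d. if d \<in> charts_at M p then chart_deriv c d id p v else 0)"

text \<open>By the chain rule, the differential does not depend on the chosen chart around \<open>p\<close>.\<close>

definition differential ::
    "('a, 'e::real_inner) manifold \<Rightarrow> ('b, 'e) manifold \<Rightarrow> ('a \<Rightarrow> 'b) \<Rightarrow> 'a \<Rightarrow>
      ('a, 'e) tvec \<Rightarrow> ('b, 'e) tvec" where
  "differential M N f p \<xi> =
     (let c = SOME c. c \<in> charts_at M p
      in (\<lambda>d. if d \<in> charts_at N (f p) then chart_deriv c d f p (\<xi> c) else 0))"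

text \<open>An element of the total space \<open>A\<^sup>*(M)\<close>, possibly of mixed degree, is evaluated on lists of
  tangent vectors; its component of degree \<open>k\<close> is its restriction to lists of length \<open>k\<close>.
  Alternating maps vanish on lists longer than the dimension, so only finitely many
  components are nonzero. For uniqueness of representation, a form is zero off the manifold
  and on lists which are not contained in the tangent space.\<close>

type_synonym ('a, 'e) form = "'a \<Rightarrow> ('a, 'e) tvec list \<Rightarrow> real"

definition alternating_on :: "('a, 'e::real_inner) tvec set \<Rightarrow> (('a, 'e) tvec list \<Rightarrow> real) \<Rightarrow> bool" where
  "alternating_on V w \<longleftrightarrow>
     (\<forall>\<xi>s i a b. \<forall>\<xi>\<in>V. \<forall>\<eta>\<in>V. set \<xi>s \<subseteq> V \<and> i < length \<xi>s \<longrightarrow>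
        w (\<xi>s[i := (\<lambda>c. a *\<^sub>R \<xi> c + b *\<^sub>R \<eta> c)]) = a * w (\<xi>s[i := \<xi>]) + b * w (\<xi>s[i := \<eta>])) \<and>
     (\<forall>\<xi>s. set \<xi>s \<subseteq> V \<and> \<not> distinct \<xi>s \<longrightarrow> w \<xi>s = 0) \<and>
     (\<forall>\<xi>s. \<not> set \<xi>s \<subseteq> V \<longrightarrow> w \<xi>s = 0)"

definition forms :: "('a, 'e::real_inner) manifold \<Rightarrow> ('a, 'e) form set" where
  "forms M =
     {\<omega>. (\<forall>p\<in>topspace (mtop M). alternating_on (tangent_space M p) (\<omega> p)) \<and>
         (\<forall>p. p \<notin> topspace (mtop M) \<longrightarrow> \<omega> p = (\<lambda>_. 0)) \<and>
         (\<forall>c\<in>charts M. \<forall>vs. smooth_on (snd c ` fst c)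
            (\<lambda>x. let p = inv_into (fst c) (snd c) x in \<omega> p (map (coord_tvec M p c) vs)))}"

definition support :: "('a, 'e) manifold \<Rightarrow> ('a, 'e) form \<Rightarrow> 'a set" where
  "support M \<omega> = mtop M closure_of {p \<in> topspace (mtop M). \<omega> p \<noteq> (\<lambda>_. 0)}"

definition pullback ::
    "('a, 'e::real_inner) manifold \<Rightarrow> ('b, 'e) manifold \<Rightarrow> ('a \<Rightarrow> 'b) \<Rightarrow> ('b, 'e) form \<Rightarrow> ('a, 'e) form" where
  "pullback M N f \<omega> =
     (\<lambda>p \<xi>s. if p \<in> topspace (mtop M) \<and> set \<xi>s \<subseteq> tangent_space M p
             then \<omega> (f p) (map (differential M N f p) \<xi>s) else 0)"

text \<open>Only the points of the fiber where the form is nonzero contribute. The restriction to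
  these is needed because a fiber of a local diffeomorphism may be infinite, whereas it
  contains only finitely many such points if the map is proper on the support.\<close>

definition pushforward ::
    "('a, 'e::real_inner) manifold \<Rightarrow> ('b, 'e) manifold \<Rightarrow> ('a \<Rightarrow> 'b) \<Rightarrow> ('a, 'e) form \<Rightarrow> ('b, 'e) form" where
  "pushforward M N f \<beta> =
     (\<lambda>y \<eta>s. if y \<in> topspace (mtop N) \<and> set \<eta>s \<subseteq> tangent_space N y
             then \<Sum>z \<in> {z \<in> topspace (mtop M). f z = y \<and> \<beta> z \<noteq> (\<lambda>_. 0)}.
                    \<beta> z (map (inv_into (tangent_space M z) (differential M N f z)) \<eta>s)
             else 0)"

definition fun_form :: "('a, 'e) manifold \<Rightarrow> ('a \<Rightarrow> real) \<Rightarrow> ('a, 'e) form" where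
  "fun_form M f = (\<lambda>p \<xi>s. if p \<in> topspace (mtop M) \<and> \<xi>s = [] then f p else 0)"

definition fun_times :: "('a \<Rightarrow> real) \<Rightarrow> ('a, 'e) form \<Rightarrow> ('a, 'e) form" where
  "fun_times f \<omega> = (\<lambda>p \<xi>s. f p * \<omega> p \<xi>s)"

text \<open>\<open>gcomp X g h\<close> is the composition \<open>g \<circ> h\<close>, defined if \<open>gsrc X g = gtgt X h\<close>.\<close>

record ('a, 'b, 'e) groupoid =
  gobj :: "('a, 'e) manifold"
  gmor :: "('b, 'e) manifold"
  gsrc :: "'b \<Rightarrow> 'a"
  gtgt :: "'b \<Rightarrow> 'a"
  gcomp :: "'b \<Rightarrow> 'b \<Rightarrow> 'b"
  gid :: "'a \<Rightarrow> 'b"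
  ginv :: "'b \<Rightarrow> 'b"

abbreviation Obj :: "('a, 'b, 'e) groupoid \<Rightarrow> 'a set" where
  "Obj X \<equiv> topspace (mtop (gobj X))"

abbreviation Mor :: "('a, 'b, 'e) groupoid \<Rightarrow> 'b set" where
  "Mor X \<equiv> topspace (mtop (gmor X))"

definition groupoid_laws :: "('a, 'b, 'e) groupoid \<Rightarrow> bool" where
  "groupoid_laws X \<longleftrightarrow>
     gsrc X \<in> Mor X \<rightarrow> Obj X \<and> gtgt X \<in> Mor X \<rightarrow> Obj X \<and>
     (\<forall>g\<in>Mor X. \<forall>h\<in>Mor X. gsrc X g = gtgt X h \<longrightarrow>
        gcomp X g h \<in> Mor X \<and>
        gsrc X (gcomp X g h) = gsrc X h \<and> gtgt X (gcomp X g h) = gtgt X g) \<and>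
     (\<forall>g\<in>Mor X. \<forall>h\<in>Mor X. \<forall>k\<in>Mor X. gsrc X g = gtgt X h \<and> gsrc X h = gtgt X k \<longrightarrow>
        gcomp X (gcomp X g h) k = gcomp X g (gcomp X h k)) \<and>
     (\<forall>x\<in>Obj X. gid X x \<in> Mor X \<and> gsrc X (gid X x) = x \<and> gtgt X (gid X x) = x) \<and>
     (\<forall>g\<in>Mor X. gcomp X g (gid X (gsrc X g)) = g \<and> gcomp X (gid X (gtgt X g)) g = g) \<and>
     (\<forall>g\<in>Mor X. ginv X g \<in> Mor X \<and>
        gsrc X (ginv X g) = gtgt X g \<and> gtgt X (ginv X g) = gsrc X g \<and>
        gcomp X g (ginv X g) = gid X (gtgt X g) \<and> gcomp X (ginv X g) g = gid X (gsrc X g))"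

text \<open>The manifold of composable pairs: since the target map is a local diffeomorphism,
  the first projection is a local homeomorphism, and the charts are the pullbacks of
  charts of the morphism manifold along its local inverses. Charts obtained from the
  second projection are compatible with these, as the source map is a local diffeomorphism too.\<close>

definition composable :: "('a, 'b, 'e) groupoid \<Rightarrow> ('b \<times> 'b, 'e) manifold" where
  "composable X =
     (let P = subtopology (prod_topology (mtop (gmor X)) (mtop (gmor X)))
                {(g, h). gsrc X g = gtgt X h}
      in \<lparr>mtop = P,
          charts = {(W, snd c \<circ> fst) | W c.
             c \<in> charts (gmor X) \<and> openin P W \<and>
             openin (mtop (gmor X)) (fst ` W) \<and> fst ` W \<subseteq> fst c \<and>
             homeomorphic_map (subtopology P W) (subtopology (mtop (gmor X)) (fst ` W)) fst}\<rparr>)"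

definition etale_proper_groupoid :: "('a, 'b, 'e::real_inner) groupoid \<Rightarrow> bool" where
  "etale_proper_groupoid X \<longleftrightarrow>
     manifold_with_corners (gobj X) \<and> manifold_with_corners (gmor X) \<and>
     groupoid_laws X \<and>
     local_diffeomorphism (gmor X) (gobj X) (gsrc X) \<and>
     local_diffeomorphism (gmor X) (gobj X) (gtgt X) \<and>
     smooth_map (composable X) (gmor X) (\<lambda>(g, h). gcomp X g h) \<and>
     smooth_map (gobj X) (gmor X) (gid X) \<and>
     smooth_map (gmor X) (gmor X) (ginv X) \<and>
     proper_map (mtop (gmor X)) (prod_topology (mtop (gobj X)) (mtop (gobj X)))
       (\<lambda>g. (gsrc X g, gtgt X g))"

definition clean_obj :: "('a, 'b, 'e) groupoid \<Rightarrow> 'a set \<Rightarrow> bool" where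
  "clean_obj X C \<longleftrightarrow> C \<subseteq> Obj X \<and>
     proper_map (subtopology (mtop (gmor X)) {g \<in> Mor X. gsrc X g \<in> C}) (mtop (gobj X)) (gtgt X)"

definition clean_mor :: "('a, 'b, 'e) groupoid \<Rightarrow> 'b set \<Rightarrow> bool" where
  "clean_mor X C \<longleftrightarrow>
     closedin (mtop (gmor X)) C \<and> clean_obj X (gsrc X ` C) \<and> clean_obj X (gtgt X ` C)"

definition clean_forms_obj :: "('a, 'b, 'e::real_inner) groupoid \<Rightarrow> ('a, 'e) form set" where
  "clean_forms_obj X = {\<alpha> \<in> forms (gobj X). clean_obj X (support (gobj X) \<alpha>)}"

definition clean_forms_mor :: "('a, 'b, 'e::real_inner) groupoid \<Rightarrow> ('b, 'e) form set" where
  "clean_forms_mor X = {\<beta> \<in> forms (gmor X). clean_mor X (support (gmor X) \<beta>)}"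

abbreviation src_pull :: "('a, 'b, 'e::real_inner) groupoid \<Rightarrow> ('a, 'e) form \<Rightarrow> ('b, 'e) form" where
  "src_pull X \<equiv> pullback (gmor X) (gobj X) (gsrc X)"

abbreviation tgt_pull :: "('a, 'b, 'e::real_inner) groupoid \<Rightarrow> ('a, 'e) form \<Rightarrow> ('b, 'e) form" where
  "tgt_pull X \<equiv> pullback (gmor X) (gobj X) (gtgt X)"

abbreviation src_push :: "('a, 'b, 'e::real_inner) groupoid \<Rightarrow> ('b, 'e) form \<Rightarrow> ('a, 'e) form" where
  "src_push X \<equiv> pushforward (gmor X) (gobj X) (gsrc X)"

abbreviation tgt_push :: "('a, 'b, 'e::real_inner) groupoid \<Rightarrow> ('b, 'e) form \<Rightarrow> ('a, 'e) form" where
  "tgt_push X \<equiv> pushforward (gmor X) (gobj X) (gtgt X)"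

definition groupoid_forms :: "('a, 'b, 'e::real_inner) groupoid \<Rightarrow> ('a, 'e) form set" where
  "groupoid_forms X = {\<alpha> \<in> forms (gobj X). src_pull X \<alpha> = tgt_pull X \<alpha>}"

text \<open>Congruence modulo the image of \<open>s\<^sub>* - t\<^sub>*\<close> on forms with clean support.\<close>

definition clean_rel :: "('a, 'b, 'e::real_inner) groupoid \<Rightarrow> (('a, 'e) form \<times> ('a, 'e) form) set" where
  "clean_rel X =
     {(\<alpha>, \<alpha>'). \<alpha> \<in> clean_forms_obj X \<and> \<alpha>' \<in> clean_forms_obj X \<and>
        (\<exists>\<beta>\<in>clean_forms_mor X. \<forall>p \<xi>s.
           \<alpha> p \<xi>s - \<alpha>' p \<xi>s = src_push X \<beta> p \<xi>s - tgt_push X \<beta> p \<xi>s)}"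

definition clean_class :: "('a, 'b, 'e::real_inner) groupoid \<Rightarrow> ('a, 'e) form \<Rightarrow> ('a, 'e) form set" where
  "clean_class X \<alpha> = clean_rel X `` {\<alpha>}"

definition groupoid_clean_forms :: "('a, 'b, 'e::real_inner) groupoid \<Rightarrow> ('a, 'e) form set set" where
  "groupoid_clean_forms X = clean_forms_obj X // clean_rel X"

definition partition_of_unity :: "('a, 'b, 'e::real_inner) groupoid \<Rightarrow> ('a \<Rightarrow> real) \<Rightarrow> bool" where
  "partition_of_unity X \<rho> \<longleftrightarrow>
     smooth_fun (gobj X) \<rho> \<and> \<rho> \<in> Obj X \<rightarrow> {0..1} \<and>
     clean_obj X (support (gobj X) (fun_form (gobj X) \<rho>)) \<and>
     tgt_push X (src_pull X (fun_form (gobj X) \<rho>)) = fun_form (gobj X) (\<lambda>_. 1)"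

text \<open>The value of \<open>t\<^sub>* s\<^sup>*\<close> on any representative of the class.\<close>

definition J_map :: "('a, 'b, 'e::real_inner) groupoid \<Rightarrow> ('a, 'e) form set \<Rightarrow> ('a, 'e) form" where
  "J_map X A = the_elem ((\<lambda>\<alpha>. tgt_push X (src_pull X \<alpha>)) ` A)"

definition K_map ::
    "('a, 'b, 'e::real_inner) groupoid \<Rightarrow> ('a \<Rightarrow> real) \<Rightarrow> ('a, 'e) form \<Rightarrow> ('a, 'e) form set" where
  "K_map X \<rho> \<alpha> = clean_class X (fun_times \<rho> \<alpha>)"

end

theory Submission
  imports Defs
begin

text \<open>Since \<open>t\<close> is a local diffeomorphism, every morphism \<open>z\<close> carries the germ of \<open>s \<circ> t\<inverse>\<close>, whose
  differential \<open>transport z\<close> satisfies \<open>t\<^sub>*s\<^sup>*\<alpha> = \<Sum> \<alpha> \<circ> transport z\<close> (sum over the target fiber) and is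
  contravariantly functorial in \<open>z\<close>. Hence \<open>t\<^sub>*s\<^sup>*\<alpha>\<close> is invariant, and \<open>t\<^sub>*s\<^sup>*(s\<^sub>*\<beta> - t\<^sub>*\<beta>) = 0\<close> by
  the bijection \<open>(z, w) \<mapsto> (z \<circ> w, w)\<close> of the index sets. An invariant \<open>\<alpha>\<close> satisfies
  \<open>t\<^sub>*s\<^sup>*(\<rho>\<alpha>) = (t\<^sub>*s\<^sup>*\<rho>) \<alpha> = \<alpha>\<close>, and for clean \<open>\<alpha>\<close> the form \<open>\<beta> = t\<^sup>*\<rho> \<cdot> s\<^sup>*\<alpha>\<close> has clean support
  and satisfies \<open>s\<^sub>*\<beta> = \<alpha>\<close> and \<open>t\<^sub>*\<beta> = \<rho> \<cdot> t\<^sub>*s\<^sup>*\<alpha>\<close>.\<close>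

section \<open>Calculus of smooth functions\<close>

text \<open>Push-forward sums only over fiber points at which the form is nonzero, so the index set
  depends on the form and jumps with the base point. Cleanness repairs both: fibers of t over which
  the source stays in a clean set are finite and serve as a common index set for several forms, and
  closedness of t on the preimage of a clean set lets finitely many branches of the inverse of t
  catch all contributions over a whole neighborhood, which is why \<open>t_*s^*\<alpha>\<close> is
  smooth. At corners, differentials are computed from ambient smooth extensions, and uniqueness
  within a quadrant makes them independent of the extension. The form \<open>\<beta>\<close> spreads
  \<alpha> over the morphisms leaving a point, with weight \<rho> taken at their targets: summing
  over the source fiber adds up weights of total 1, while on a target fiber the weight is constant.
  Its support has closed images because each of them is controlled by the cleanness of the other.
  Independence of \<rho> is then formal, since \<open>J\<close> does not mention \<rho>.\<close>

lemma Ck_on_SucI: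
  assumes "\<And>x. x \<in> W \<Longrightarrow> (f has_derivative f' x) (at x)" "\<And>v. Ck_on k W (\<lambda>x. f' x v)"
  shows "Ck_on (Suc k) W f"
  unfolding Ck_on.simps by (rule exI[of _ f'], intro conjI ballI allI assms)

lemma Ck_on_SucE:
  assumes "Ck_on (Suc k) W f"
  obtains f' where "\<forall>x\<in>W. (f has_derivative f' x) (at x)" "\<forall>v. Ck_on k W (\<lambda>x. f' x v)"
proof -
  from assms obtain f' where *: "(\<forall>x\<in>W. (f has_derivative f' x) (at x)) \<and> (\<forall>v. Ck_on k W (\<lambda>x. f' x v))"
    unfolding Ck_on.simps by (rule exE)
  show thesis by (rule that[of f']) (use * in simp_all)
qed

lemma Ck_on_subset: "Ck_on k W f \<Longrightarrow> V \<subseteq> W \<Longrightarrow> Ck_on k V f"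
proof (induction k arbitrary: f)
  case 0
  then show ?case by (auto intro: continuous_on_subset)
next
  case (Suc k)
  obtain f' where "\<forall>x\<in>W. (f has_derivative f' x) (at x)" "\<forall>v. Ck_on k W (\<lambda>x. f' x v)"
    using Ck_on_SucE[OF Suc.prems(1)] .
  note f' = this(1)[rule_format] this(2)[rule_format]
  show ?case
    by (rule Ck_on_SucI[of V f f']) (use f' Suc.prems(2) Suc.IH in auto)
qed

lemma Ck_on_cong:
  assumes "open W" "Ck_on k W f" "\<And>x. x \<in> W \<Longrightarrow> f x = g x"
  shows "Ck_on k W g"
proof (cases k)
  case 0
  then show ?thesis using assms by (simp cong: continuous_on_cong)
next
  case (Suc j)
  obtain f' where "\<forall>x\<in>W. (f has_derivative f' x) (at x)" "\<forall>v. Ck_on j W (\<lambda>x. f' x v)"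
    using Ck_on_SucE[OF assms(2)[unfolded Suc]] .
  note f' = this(1)[rule_format] this(2)[rule_format]
  show ?thesis unfolding Suc
    by (rule Ck_on_SucI[OF has_derivative_transform_within_open[OF f'(1) assms(1)]])
      (simp_all add: assms f')
qed

lemma Ck_on_Suc_imp: "Ck_on (Suc k) W f \<Longrightarrow> Ck_on k W f"
proof (induction k arbitrary: f)
  case 0
  obtain f' where "\<forall>x\<in>W. (f has_derivative f' x) (at x)" by (rule Ck_on_SucE[OF 0])
  then have "isCont f x" if "x \<in> W" for x using that has_derivative_continuous by blast
  then show ?case by (simp add: continuous_at_imp_continuous_on)
next
  case (Suc k)
  obtain f' where "\<forall>x\<in>W. (f has_derivative f' x) (at x)" "\<forall>v. Ck_on (Suc k) W (\<lambda>x. f' x v)"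
    using Ck_on_SucE[OF Suc.prems] .
  note f' = this(1)[rule_format] this(2)[rule_format]
  show ?case by (rule Ck_on_SucI[OF f'(1) Suc.IH[OF f'(2)]])
qed

lemma Ck_on_const: "Ck_on k W (\<lambda>_. c)"
proof (induction k arbitrary: c)
  case (Suc k)
  show ?case by (rule Ck_on_SucI[OF has_derivative_const Suc.IH])
qed simp

lemma Ck_on_bounded_linear:
  assumes "bounded_linear L" "Ck_on k W f"
  shows "Ck_on k W (\<lambda>x. L (f x))"
  using assms(2)
proof (induction k arbitrary: f)
  case 0
  then show ?case using assms(1) by (simp add: bounded_linear.continuous_on)
next
  case (Suc k)
  obtain f' where "\<forall>x\<in>W. (f has_derivative f' x) (at x)" "\<forall>v. Ck_on k W (\<lambda>x. f' x v)"
    using Ck_on_SucE[OF Suc.prems] .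
  note f' = this(1)[rule_format] this(2)[rule_format]
  show ?case
    by (rule Ck_on_SucI[OF bounded_linear.has_derivative[OF assms(1) f'(1)] Suc.IH[OF f'(2)]])
qed

lemma Ck_on_add:
  assumes "Ck_on k W f" "Ck_on k W g"
  shows "Ck_on k W (\<lambda>x. f x + g x)"
  using assms
proof (induction k arbitrary: f g)
  case 0
  then show ?case by (simp add: continuous_on_add)
next
  case (Suc k)
  obtain f' where "\<forall>x\<in>W. (f has_derivative f' x) (at x)" "\<forall>v. Ck_on k W (\<lambda>x. f' x v)"
    using Ck_on_SucE[OF Suc.prems(1)] .
  note f' = this(1)[rule_format] this(2)[rule_format]
  obtain g' where "\<forall>x\<in>W. (g has_derivative g' x) (at x)" "\<forall>v. Ck_on k W (\<lambda>x. g' x v)"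
    using Ck_on_SucE[OF Suc.prems(2)] .
  note g' = this(1)[rule_format] this(2)[rule_format]
  show ?case
    by (rule Ck_on_SucI[OF has_derivative_add[OF f'(1) g'(1)] Suc.IH[OF f'(2) g'(2)]])
qed

lemma Ck_on_sum:
  assumes "\<And>i. i \<in> I \<Longrightarrow> Ck_on k W (f i)"
  shows "Ck_on k W (\<lambda>x. \<Sum>i\<in>I. f i x)"
  using assms
proof (induction I rule: infinite_finite_induct)
  case (insert i I)
  then have "Ck_on k W (\<lambda>x. f i x + (\<Sum>i\<in>I. f i x))" by (intro Ck_on_add) simp_all
  then show ?case using insert.hyps by simp
qed (simp_all add: Ck_on_const)

text \<open>The product rule pairs each factor with the derivative of the other, so the induction
  must vary both functions and needs the undifferentiated factors one order lower as well.\<close>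

lemma Ck_on_scaleR:
  assumes "Ck_on k W a" "Ck_on k W f"
  shows "Ck_on k W (\<lambda>x. a x *\<^sub>R f x)"
  using assms
proof (induction k arbitrary: a f)
  case 0
  then show ?case by (simp add: continuous_on_scaleR)
next
  case (Suc k)
  obtain f' where "\<forall>x\<in>W. (f has_derivative f' x) (at x)" "\<forall>v. Ck_on k W (\<lambda>x. f' x v)"
    using Ck_on_SucE[OF Suc.prems(2)] .
  note f' = this(1)[rule_format] this(2)[rule_format]
  obtain a' where "\<forall>x\<in>W. (a has_derivative a' x) (at x)" "\<forall>v. Ck_on k W (\<lambda>x. a' x v)"
    using Ck_on_SucE[OF Suc.prems(1)] .
  note a' = this(1)[rule_format] this(2)[rule_format]
  show ?case
    by (rule Ck_on_SucI[OF has_derivative_scaleR[OF a'(1) f'(1)] Ck_on_add[OF Suc.IH Suc.IH]])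
      (simp_all add: f' a' Suc.prems[THEN Ck_on_Suc_imp])
qed

section \<open>Orthogonal bases and the chain rule of order k\<close>

text \<open>The residual lies in the span of \<open>C\<close> and is orthogonal to every element of
  \<open>C\<close>, hence to itself. The vectors are not normalized, whence the quotients; should 0
  belong to \<open>C\<close>, its term vanishes because division by zero yields 0.\<close>

lemma orthogonal_expansion:
  fixes C :: "'e::real_inner set"
  assumes "finite C" "pairwise orthogonal C" "span C = UNIV"
  shows "v = (\<Sum>b\<in>C. ((v \<bullet> b) / (b \<bullet> b)) *\<^sub>R b)"
proof -
  let ?r = "v - (\<Sum>b\<in>C. ((v \<bullet> b) / (b \<bullet> b)) *\<^sub>R b)"
  have *: "orthogonal ?r x" if "x \<in> C" for x
  proof -
    have "(\<Sum>b\<in>C. ((v \<bullet> b) / (b \<bullet> b)) * (b \<bullet> x)) = (\<Sum>b\<in>{x}. ((v \<bullet> b) / (b \<bullet> b)) * (b \<bullet> x))"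
    proof (rule sum.mono_neutral_right)
      show "\<forall>b\<in>C - {x}. ((v \<bullet> b) / (b \<bullet> b)) * (b \<bullet> x) = 0"
        using pairwiseD[OF assms(2) _ that] by (auto simp: orthogonal_def)
    qed (use assms(1) that in auto)
    then show ?thesis
      by (simp add: orthogonal_def inner_diff_left inner_sum_left)
  qed
  have "?r \<in> span C" using assms(3) by (simp only: UNIV_I)
  then have "orthogonal ?r ?r" using * by (rule orthogonal_to_span)
  then show ?thesis unfolding orthogonal_self by (simp only: right_minus_eq)
qed

lemma orthogonal_basis_exists:
  fixes B :: "'e::real_inner set"
  assumes "finite B" "span B = UNIV"
  obtains C :: "'e set" where "finite C" "pairwise orthogonal C" "span C = UNIV"
proof -
  obtain C where "finite C" "span C = span B" "pairwise orthogonal C"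
    using basis_orthogonal[OF assms(1)] by blast
  then show thesis using that[of C] assms(2) by simp
qed

text \<open>The derivative of the composite applies \<open>f' (g x)\<close> to the direction
  \<open>g' x v\<close>, which moves with \<open>x\<close>, whereas \<open>Ck_on\<close> controls
  derivatives only in fixed directions. Expanding the moving direction in an orthogonal basis leaves
  a finite sum of products, to which the induction hypothesis applies. This is where finite
  dimension enters.\<close>

lemma Ck_on_compose:
  fixes f :: "'e::real_inner \<Rightarrow> 'f::real_normed_vector" and g :: "'d::real_normed_vector \<Rightarrow> 'e"
  assumes fd: "\<exists>B :: 'e set. finite B \<and> span B = UNIV" and "open W" "open V" "g ` W \<subseteq> V"
    and "Ck_on k V f" "Ck_on k W g"
  shows "Ck_on k W (\<lambda>x. f (g x))"
proof -
  obtain C :: "'e set" where C: "finite C" "pairwise orthogonal C" "span C = UNIV"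
  proof -
    from fd obtain B :: "'e set" where "finite B" "span B = UNIV" by (elim exE conjE)
    from orthogonal_basis_exists[OF this] that show thesis .
  qed
  show ?thesis using assms(4-)
  proof (induction k arbitrary: f)
    case 0
    then show ?case using continuous_on_compose2[of V f W g] \<open>g ` W \<subseteq> V\<close> by simp
  next
    case (Suc k)
    obtain f' where "\<forall>x\<in>V. (f has_derivative f' x) (at x)" "\<forall>v. Ck_on k V (\<lambda>x. f' x v)"
      using Ck_on_SucE[OF Suc.prems(2)] .
    note f' = this(1)[rule_format] this(2)[rule_format]
    obtain g' where "\<forall>x\<in>W. (g has_derivative g' x) (at x)" "\<forall>v. Ck_on k W (\<lambda>x. g' x v)"
      using Ck_on_SucE[OF Suc.prems(3)] .
    note g' = this(1)[rule_format] this(2)[rule_format]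
    have gk: "Ck_on k W g" by (rule Ck_on_Suc_imp[OF Suc.prems(3)])
    have gV: "g x \<in> V" if "x \<in> W" for x using Suc.prems(1) that by blast
    have d: "((\<lambda>x. f (g x)) has_derivative (\<lambda>v. f' (g x) (g' x v))) (at x)" if "x \<in> W" for x
      by (rule has_derivative_compose[OF g'(1)[OF that] f'(1)[OF gV[OF that]]])
    have "Ck_on k W (\<lambda>x. f' (g x) (g' x v))" for v
    proof -
      have c: "Ck_on k W (\<lambda>x. \<Sum>b\<in>C. ((g' x v \<bullet> b) / (b \<bullet> b)) *\<^sub>R f' (g x) b)"
      proof (rule Ck_on_sum, rule Ck_on_scaleR)
        fix b assume "b \<in> C"
        have "bounded_linear (\<lambda>y. (y \<bullet> b) / (b \<bullet> b))"
          using bounded_linear_divide bounded_linear_inner_left bounded_linear_compose by blast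
        from Ck_on_bounded_linear[OF this g'(2)]
        show "Ck_on k W (\<lambda>x. (g' x v \<bullet> b) / (b \<bullet> b))" .
        show "Ck_on k W (\<lambda>x. f' (g x) b)"
          by (rule Suc.IH[OF Suc.prems(1) f'(2) gk])
      qed
      show ?thesis
      proof (rule Ck_on_cong[OF \<open>open W\<close> c])
        fix x assume "x \<in> W"
        then have "linear (f' (g x))"
          using f'(1)[OF gV] has_derivative_linear by blast
        then show "(\<Sum>b\<in>C. ((g' x v \<bullet> b) / (b \<bullet> b)) *\<^sub>R f' (g x) b) = f' (g x) (g' x v)"
          using arg_cong[OF orthogonal_expansion[OF C, of "g' x v"], of "f' (g x)"]
          by (simp add: linear_sum linear_scale)
      qed
    qed
    then show ?case by (intro Ck_on_SucI[OF d])
  qed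
qed

section \<open>Smooth functions and uniqueness of derivatives at corners\<close>

definition Cinf_on :: "'e::real_normed_vector set \<Rightarrow> ('e \<Rightarrow> 'f::real_normed_vector) \<Rightarrow> bool" where
  "Cinf_on W f \<longleftrightarrow> (\<forall>k. Ck_on k W f)"

lemma Cinf_on_has_derivative:
  assumes "Cinf_on W f" "x \<in> W"
  shows "(f has_derivative frechet_derivative f (at x)) (at x)"
proof -
  have "Ck_on (Suc 0) W f" using assms(1) unfolding Cinf_on_def by blast
  then obtain f' where "\<forall>x\<in>W. (f has_derivative f' x) (at x)" by (rule Ck_on_SucE)
  note f' = this[rule_format]
  show ?thesis using f'[OF assms(2)] frechet_derivative_at[OF f'[OF assms(2)]] by simp
qed

text \<open>Each order \<open>k\<close> supplies its own witness \<open>f'\<close>. On the open set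
  all of them agree with the Frechet derivative, so a single function has every order of
  differentiability.\<close>

lemma Cinf_on_derivative:
  assumes "Cinf_on W f" "open W"
  shows "Cinf_on W (\<lambda>x. frechet_derivative f (at x) v)"
  unfolding Cinf_on_def
proof
  fix k
  have "Ck_on (Suc k) W f" using assms(1) unfolding Cinf_on_def by blast
  then obtain f' where "\<forall>x\<in>W. (f has_derivative f' x) (at x)" "\<forall>v. Ck_on k W (\<lambda>x. f' x v)"
    by (rule Ck_on_SucE)
  note f' = this(1)[rule_format] this(2)[rule_format]
  show "Ck_on k W (\<lambda>x. frechet_derivative f (at x) v)"
    by (rule Ck_on_cong[OF assms(2) f'(2)]) (simp add: frechet_derivative_at[OF f'(1)])
qed

text \<open>The directions pointing into a quadrant span the space: adding a multiple of the sum
  of \<open>S\<close> to any vector brings it into the quadrant.\<close>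

lemma quadrant_derivative_unique:
  fixes f :: "'e::real_inner \<Rightarrow> 'f::real_normed_vector"
  assumes S: "finite S" "orthonormal S" and A: "openin (top_of_set (quadrant S)) A" and x: "x \<in> A"
    and f: "(f has_derivative D) (at x within A)" "(f has_derivative D') (at x within A)"
  shows "D = D'"
proof -
  obtain T where T: "open T" "A = quadrant S \<inter> T" using A by (auto simp: openin_open)
  have inward: "D v = D' v" if v: "v \<in> quadrant S" for v
  proof -
    \<comment> \<open>These are the parameters for which the ray from \<open>x\<close> in direction
      \<open>v\<close> stays in \<open>A\<close>. The derivative of \<open>f\<close> along the ray
      is both \<open>D v\<close> and \<open>D' v\<close>, provided that 0 is a limit point of
      \<open>I\<close>; small nonnegative parameters ensure this.\<close>
    define I where "I = {t::real. 0 \<le> t \<and> x + t *\<^sub>R v \<in> T}"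
    have IA: "(\<lambda>t. x + t *\<^sub>R v) ` I \<subseteq> A"
      using v x by (auto simp: I_def T quadrant_def inner_add_left)
    have *: "((\<lambda>t. f (x + t *\<^sub>R v)) has_vector_derivative L v) (at 0 within I)"
      if L: "(f has_derivative L) (at x within A)" for L
    proof -
      have "((\<lambda>t. x + t *\<^sub>R v) has_derivative (\<lambda>t. t *\<^sub>R v)) (at 0 within I)"
        by (auto intro!: derivative_eq_intros)
      moreover have "(f has_derivative L) (at (x + 0 *\<^sub>R v) within (\<lambda>t. x + t *\<^sub>R v) ` I)"
        using has_derivative_subset[OF L IA] by simp
      ultimately have "((\<lambda>t. f (x + t *\<^sub>R v)) has_derivative (\<lambda>t. L (t *\<^sub>R v))) (at 0 within I)"
        by (rule has_derivative_in_compose)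
      moreover have "(\<lambda>t. L (t *\<^sub>R v)) = (\<lambda>t. t *\<^sub>R L v)"
        using L has_derivative_linear linear_scale by blast
      ultimately show ?thesis by (simp add: has_vector_derivative_def)
    qed
    have "open ((\<lambda>t::real. x + t *\<^sub>R v) -` T)"
      by (intro open_vimage T continuous_intros)
    moreover have "0 \<in> (\<lambda>t::real. x + t *\<^sub>R v) -` T" using x T by simp
    ultimately obtain e where e: "e > 0" "ball 0 e \<subseteq> (\<lambda>t::real. x + t *\<^sub>R v) -` T"
      using openE by blast
    then have "{0..<e} \<subseteq> I" by (auto simp: I_def dist_real_def subset_iff)
    moreover have "(0::real) islimpt {0..<e}"
      unfolding islimpt_approachable
    proof (intro allI impI)
      fix r :: real assume "0 < r"
      then show "\<exists>t\<in>{0..<e}. t \<noteq> 0 \<and> dist t 0 < r"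
        using e by (intro bexI[of _ "min (e/2) (r/2)"]) (auto simp: min_def)
    qed
    ultimately have "at (0::real) within I \<noteq> bot"
      using trivial_limit_within islimpt_subset by blast
    from vector_derivative_unique_within[OF this *[OF f(1)] *[OF f(2)]] show ?thesis .
  qed
  show ?thesis
  proof
    fix v
    \<comment> \<open>The vector \<open>?w\<close> has inner product 1 with every element of
      \<open>S\<close>, and Cauchy-Schwarz bounds the inner products of \<open>v\<close> by
      \<open>norm v\<close>; hence the multiple \<open>norm v\<close> suffices to reach the
      quadrant.\<close>
    let ?w = "\<Sum>b\<in>S. b"
    have w: "?w \<bullet> b = 1" if "b \<in> S" for b
    proof -
      have "?w \<bullet> b = (\<Sum>a\<in>{b}. a \<bullet> b)"
        unfolding inner_sum_left using S that
        by (intro sum.mono_neutral_right) (auto simp: orthonormal_def pairwise_def orthogonal_def)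
      then show ?thesis using S that by (simp add: orthonormal_def norm_eq_1)
    qed
    have "\<bar>v \<bullet> b\<bar> \<le> norm v" if "b \<in> S" for b
      using Cauchy_Schwarz_ineq2[of v b] S that by (simp add: orthonormal_def)
    then have "0 \<le> v \<bullet> b + norm v" if "b \<in> S" for b using that by fastforce
    then have 1: "v + norm v *\<^sub>R ?w \<in> quadrant S"
      using w by (simp add: quadrant_def inner_add_left)
    have 2: "?w \<in> quadrant S" using w by (simp add: quadrant_def)
    have "linear D" "linear D'" using f has_derivative_linear by blast+
    then have "D (v + norm v *\<^sub>R ?w) = D v + norm v *\<^sub>R D ?w"
      "D' (v + norm v *\<^sub>R ?w) = D' v + norm v *\<^sub>R D' ?w"
      by (simp_all only: linear_add linear_scale)
    then show "D v = D' v" using inward[OF 1] inward[OF 2] by simp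
  qed
qed

section \<open>Smoothness in charts\<close>

lemma
  assumes "is_chart T c"
  shows is_chart_openin: "openin T (fst c)"
    and is_chart_homeomorphic:
      "homeomorphic_map (subtopology T (fst c)) (top_of_set (snd c ` fst c)) (snd c)"
    and is_chart_quadrant:
      "\<exists>S. finite S \<and> orthonormal S \<and> openin (top_of_set (quadrant S)) (snd c ` fst c)"
  using assms unfolding is_chart_def by blast+

lemma topspace_subtopology_openin: "openin T U \<Longrightarrow> topspace (subtopology T U) = U"
  using openin_subset by (auto simp: topspace_subtopology)

lemma is_chart_inj_on: "is_chart T c \<Longrightarrow> inj_on (snd c) (fst c)"
  using homeomorphic_imp_injective_map[OF is_chart_homeomorphic]
  by (metis is_chart_openin topspace_subtopology_openin)

lemma is_chart_inv: "is_chart T c \<Longrightarrow> U \<subseteq> fst c \<Longrightarrow> q \<in> U \<Longrightarrow> inv_into U (snd c) (snd c q) = q"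
  using is_chart_inj_on inj_on_subset inv_into_f_f by metis

lemma is_chart_open_image:
  assumes "is_chart T c" "openin T U" "U \<subseteq> fst c"
  shows "openin (top_of_set (snd c ` fst c)) (snd c ` U)"
proof -
  have "openin (subtopology T (fst c)) U"
    using assms is_chart_openin openin_open_subtopology by blast
  then show ?thesis
    using homeomorphic_map_openness_eq[OF is_chart_homeomorphic[OF assms(1)]] by blast
qed

lemma openin_local_vimage:
  assumes "openin T V" "continuous_map (subtopology T V) T' f" "openin T' U"
  shows "openin T {q \<in> V. f q \<in> U}"
proof -
  have "openin (subtopology T V) {q \<in> topspace (subtopology T V). f q \<in> U}"
    by (rule openin_continuous_map_preimage[OF assms(2,3)])
  then show ?thesis
    unfolding topspace_subtopology_openin[OF assms(1)]
    using assms(1) openin_open_subtopology by blast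
qed

lemma is_chart_open_vimage:
  assumes "is_chart T c" "openin T U" "U \<subseteq> fst c" "open W"
  shows "openin T {q \<in> U. snd c q \<in> W}"
proof -
  have "continuous_map (subtopology T (fst c)) euclidean (snd c)"
    using is_chart_homeomorphic[OF assms(1)] homeomorphic_imp_continuous_map
      continuous_map_in_subtopology by blast
  then have "continuous_map (subtopology T U) euclidean (snd c)"
    using continuous_map_from_subtopology_mono assms(3) by blast
  from openin_local_vimage[OF assms(2) this] assms(4) show ?thesis by simp
qed

text \<open>Smoothness at \<open>p\<close> of a function on the manifold, read in the chart \<open>c\<close> around \<open>p\<close>
  without reference to the inverse of \<open>snd c\<close>.\<close>

definition smooth_near ::
    "'a topology \<Rightarrow> ('a, 'e::real_normed_vector) chart \<Rightarrow> 'a \<Rightarrow> ('a \<Rightarrow> 'f::real_normed_vector) \<Rightarrow> bool" where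
  "smooth_near T c p F \<longleftrightarrow>
     (\<exists>U W g. openin T U \<and> p \<in> U \<and> U \<subseteq> fst c \<and> open W \<and> snd c ` U \<subseteq> W \<and> Cinf_on W g \<and>
        (\<forall>q\<in>U. F q = g (snd c q)))"

lemma smooth_nearI:
  assumes "openin T U" "p \<in> U" "U \<subseteq> fst c" "open W" "snd c ` U \<subseteq> W" "Cinf_on W g"
    "\<And>q. q \<in> U \<Longrightarrow> F q = g (snd c q)"
  shows "smooth_near T c p F"
  unfolding smooth_near_def using assms by blast

lemma smooth_nearE:
  assumes "smooth_near T c p F"
  obtains U W g where "openin T U" "p \<in> U" "U \<subseteq> fst c" "open W" "snd c ` U \<subseteq> W" "Cinf_on W g"
    "\<forall>q\<in>U. F q = g (snd c q)"
  using assms unfolding smooth_near_def by blast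

lemma smooth_near_cong:
  assumes "smooth_near T c p F" "openin T V" "p \<in> V" "\<And>q. q \<in> V \<Longrightarrow> F q = G q"
  shows "smooth_near T c p G"
proof -
  obtain U W g where *: "openin T U" "p \<in> U" "U \<subseteq> fst c" "open W" "snd c ` U \<subseteq> W" "Cinf_on W g"
    "\<forall>q\<in>U. F q = g (snd c q)" using assms(1) by (rule smooth_nearE)
  show ?thesis
    by (rule smooth_nearI[of T "U \<inter> V" _ _ W g])
      (use *(1-6) *(7)[rule_format] assms(2-3) assms(4)[symmetric] in auto)
qed

text \<open>Bridge between extension-based smoothness on the image of a chart and
  \<open>smooth_near\<close>. Towards \<open>smooth_on\<close>, the extension \<open>g\<close> is
  known to agree with \<open>h\<close> only on the image of \<open>U\<close>; so \<open>W\<close> is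
  cut down by an ambient open set \<open>V\<close> whose trace on the chart image is exactly that
  image.\<close>

lemma smooth_on_chart_iff:
  assumes c: "is_chart T c" and D: "openin T D" "D \<subseteq> fst c"
  shows "smooth_on (snd c ` D) h \<longleftrightarrow> (\<forall>p\<in>D. smooth_near T c p (h \<circ> snd c))"
proof (intro iffI ballI)
  fix p assume h: "smooth_on (snd c ` D) h" and p: "p \<in> D"
  then obtain W g where W: "open W" "snd c p \<in> W" "\<forall>k. Ck_on k W g" "\<forall>y\<in>snd c ` D \<inter> W. g y = h y"
    unfolding smooth_on_def by blast
  show "smooth_near T c p (h \<circ> snd c)"
    by (rule smooth_nearI[of T "{q \<in> D. snd c q \<in> W}" _ _ W g])
      (use is_chart_open_vimage[OF c D W(1)] W p D in \<open>auto simp: Cinf_on_def\<close>)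
next
  assume h: "\<forall>p\<in>D. smooth_near T c p (h \<circ> snd c)"
  show "smooth_on (snd c ` D) h"
    unfolding smooth_on_def
  proof
    fix x assume "x \<in> snd c ` D"
    then obtain p where p: "p \<in> D" "x = snd c p" by blast
    obtain U W g where *: "openin T U" "p \<in> U" "U \<subseteq> fst c" "open W" "snd c ` U \<subseteq> W" "Cinf_on W g"
      "\<forall>q\<in>U. (h \<circ> snd c) q = g (snd c q)"
      using h p by (meson smooth_nearE)
    obtain V where V: "open V" "snd c ` U = snd c ` fst c \<inter> V"
      using is_chart_open_image[OF c *(1,3)] by (auto simp: openin_open)
    show "\<exists>W g. open W \<and> x \<in> W \<and> (\<forall>k. Ck_on k W g) \<and> (\<forall>y\<in>snd c ` D \<inter> W. g y = h y)"
    proof (intro exI conjI ballI allI)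
      show "open (W \<inter> V)" using V * by blast
      show "x \<in> W \<inter> V" using V * p by blast
      show "Ck_on k (W \<inter> V) g" for k
        using *(6) unfolding Cinf_on_def by (blast intro: Ck_on_subset)
      fix y assume "y \<in> snd c ` D \<inter> (W \<inter> V)"
      then have "y \<in> snd c ` U" using V D by blast
      then show "g y = h y" using * by auto
    qed
  qed
qed

lemma smooth_near_const: 
  assumes "is_chart T c" "p \<in> fst c"
  shows "smooth_near T c p (\<lambda>_. a)"
  by (rule smooth_nearI[of T "fst c" _ _ UNIV "\<lambda>_. a"])
    (use assms(2) is_chart_openin[OF assms(1)] in \<open>auto simp: Cinf_on_def Ck_on_const\<close>)

text \<open>The two functions come with different extension domains. The closure property of
  \<open>H\<close> is therefore assumed for all open sets, so that it can be applied on the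
  intersection.\<close>

lemma smooth_near_join:
  fixes c :: "('a, 'e::real_normed_vector) chart"
  assumes "smooth_near T c p F" "smooth_near T c p G"
    and "\<And>(W :: 'e set) f g. open W \<Longrightarrow> Cinf_on W f \<Longrightarrow> Cinf_on W g \<Longrightarrow> Cinf_on W (\<lambda>x. H (f x) (g x))"
  shows "smooth_near T c p (\<lambda>q. H (F q) (G q))"
proof -
  obtain U W f where 1: "openin T U" "p \<in> U" "U \<subseteq> fst c" "open W" "snd c ` U \<subseteq> W" "Cinf_on W f"
    "\<forall>q\<in>U. F q = f (snd c q)" using assms(1) by (rule smooth_nearE)
  obtain U' W' g where 2: "openin T U'" "p \<in> U'" "U' \<subseteq> fst c" "open W'" "snd c ` U' \<subseteq> W'" "Cinf_on W' g"
    "\<forall>q\<in>U'. G q = g (snd c q)" using assms(2) by (rule smooth_nearE)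
  have "Cinf_on (W \<inter> W') f" "Cinf_on (W \<inter> W') g"
    using 1(6) 2(6) unfolding Cinf_on_def by (blast intro: Ck_on_subset)+
  then have H: "Cinf_on (W \<inter> W') (\<lambda>x. H (f x) (g x))" using assms(3) 1(4) 2(4) by blast
  show ?thesis
  proof (rule smooth_nearI[OF _ _ _ _ _ H])
    show "openin T (U \<inter> U')" using 1(1) 2(1) by blast
    show "open (W \<inter> W')" using 1(4) 2(4) by blast
    show "snd c ` (U \<inter> U') \<subseteq> W \<inter> W'" using 1(5) 2(5) by blast
    show "H (F q) (G q) = H (f (snd c q)) (g (snd c q))" if "q \<in> U \<inter> U'" for q
      using 1(7) 2(7) that by simp
  qed (use 1(2,3) 2(2) in auto)
qed

lemma smooth_near_add:
  "smooth_near T c p F \<Longrightarrow> smooth_near T c p G \<Longrightarrow> smooth_near T c p (\<lambda>q. F q + G q)"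
  by (erule smooth_near_join, assumption) (simp add: Cinf_on_def Ck_on_add)

lemma smooth_near_scaleR:
  "smooth_near T c p F \<Longrightarrow> smooth_near T c p G \<Longrightarrow> smooth_near T c p (\<lambda>q. F q *\<^sub>R G q)"
  by (erule smooth_near_join, assumption) (simp add: Cinf_on_def Ck_on_scaleR)

lemma smooth_near_bounded_linear:
  assumes "bounded_linear L" "smooth_near T c p F"
  shows "smooth_near T c p (\<lambda>q. L (F q))"
  by (rule smooth_near_join[OF assms(2) assms(2), where H = "\<lambda>x _. L x"])
    (simp add: Cinf_on_def Ck_on_bounded_linear[OF assms(1)])

lemma smooth_near_sum:
  assumes "is_chart T c" "p \<in> fst c" "\<And>i. i \<in> I \<Longrightarrow> smooth_near T c p (F i)"
  shows "smooth_near T c p (\<lambda>q. \<Sum>i\<in>I. F i q)"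
  using assms(3) by (induction I rule: infinite_finite_induct)
    (simp_all add: smooth_near_const smooth_near_add assms)

text \<open>The extension \<open>g\<close> of \<open>f\<close> in charts may leave the domain
  \<open>W'\<close> of the extension of \<open>F\<close> even though \<open>f\<close> itself does
  not; the composite extension lives on the part of \<open>W\<close> that \<open>g\<close> sends
  into \<open>W'\<close>, which is open by continuity of \<open>g\<close>. Continuity of
  \<open>f\<close> near \<open>p\<close> is a separate hypothesis because \<open>smooth_near\<close>
  only sees coordinates.\<close>

lemma smooth_near_compose:
  fixes d :: "('b, 'e::real_inner) chart" and c :: "('a, 'd::real_normed_vector) chart"
  assumes fd: "\<exists>B :: 'e set. finite B \<and> span B = UNIV"
    and f: "smooth_near T c p (snd d \<circ> f)" and F: "smooth_near T' d (f p) F"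
    and V: "openin T V" "p \<in> V" "continuous_map (subtopology T V) T' f"
  shows "smooth_near T c p (F \<circ> f)"
proof -
  obtain U W g where 1: "openin T U" "p \<in> U" "U \<subseteq> fst c" "open W" "snd c ` U \<subseteq> W" "Cinf_on W g"
    "\<forall>q\<in>U. (snd d \<circ> f) q = g (snd c q)" using f by (rule smooth_nearE)
  obtain U' W' h where 2: "openin T' U'" "f p \<in> U'" "U' \<subseteq> fst d" "open W'" "snd d ` U' \<subseteq> W'" "Cinf_on W' h"
    "\<forall>q\<in>U'. F q = h (snd d q)" using F by (rule smooth_nearE)
  have o1: "openin T {q \<in> V. f q \<in> U'}" by (rule openin_local_vimage[OF V(1,3) 2(1)])
  have "continuous_on W g" using 1(6) unfolding Cinf_on_def by (metis Ck_on.simps(1))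
  then have o2: "open (W \<inter> g -` W')"
    using 1(4) 2(4) by (simp add: continuous_on_open_vimage Int_commute)
  have "Cinf_on (W \<inter> g -` W') (\<lambda>x. h (g x))"
    unfolding Cinf_on_def
  proof
    fix k
    show "Ck_on k (W \<inter> g -` W') (\<lambda>x. h (g x))"
      by (rule Ck_on_compose[OF fd o2 2(4)])
        (use 1(6) 2(6) in \<open>auto simp: Cinf_on_def intro: Ck_on_subset\<close>)
  qed
  then show ?thesis
  proof (rule smooth_nearI[of T "U \<inter> {q \<in> V. f q \<in> U'}", rotated 5])
    show "openin T (U \<inter> {q \<in> V. f q \<in> U'})" using 1 o1 by blast
    show "snd c ` (U \<inter> {q \<in> V. f q \<in> U'}) \<subseteq> W \<inter> g -` W'"
      using 1(5,7) 2(5) by fastforce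
    fix q assume "q \<in> U \<inter> {q \<in> V. f q \<in> U'}"
    then show "(F \<circ> f) q = h (g (snd c q))" using 1(7) 2(7) by fastforce
  qed (use 1 2 V o2 in auto)
qed

section \<open>Derivatives in charts and maps smooth at a point\<close>

text \<open>Any local ambient extension computes \<open>chart_deriv\<close>. The sets
  \<open>chart_dom c d f\<close> and the image of \<open>U\<close> agree near the point, so they
  give the same limit filter, and the image of \<open>U\<close> is open in a quadrant, where
  derivatives are unique.\<close>

lemma chart_deriv_eqI:
  fixes c :: "('a, 'e::real_inner) chart" and d :: "('b, 'e) chart"
  assumes c: "is_chart T c" and U: "openin T U" "p \<in> U" "U \<subseteq> fst c" "f ` U \<subseteq> fst d"
    and g: "\<forall>q\<in>U. snd d (f q) = g (snd c q)" "(g has_derivative D) (at (snd c p))"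
  shows "chart_deriv c d f p = D"
proof -
  obtain S where S: "finite S" "orthonormal S" "openin (top_of_set (quadrant S)) (snd c ` fst c)"
    using is_chart_quadrant[OF c] by blast
  obtain V where V: "open V" "snd c ` U = snd c ` fst c \<inter> V"
    using is_chart_open_image[OF c U(1,3)] by (auto simp: openin_open)
  have oU: "openin (top_of_set (quadrant S)) (snd c ` U)"
    using openin_trans[OF is_chart_open_image[OF c U(1,3)] S(3)] .
  let ?A = "chart_dom c d f"
  have A: "snd c ` U \<subseteq> ?A" "?A \<inter> V \<subseteq> snd c ` U"
    using U V unfolding chart_dom_def by blast+
  have x: "snd c p \<in> snd c ` U" "snd c p \<in> V" using U V by auto
  have at_eq: "at (snd c p) within ?A = at (snd c p) within snd c ` U"
    using x V A by (intro at_within_nhd[of _ V]) auto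
  have "(chart_rep c d f has_derivative D) (at (snd c p) within snd c ` U)"
  proof (rule has_derivative_transform[OF x(1) _ has_derivative_at_withinI[OF g(2)]])
    fix y assume "y \<in> snd c ` U"
    then obtain q where q: "q \<in> U" "y = snd c q" by blast
    then show "chart_rep c d f y = g y"
      using is_chart_inv[OF c order_refl, of q] U g by (auto simp: chart_rep_def)
  qed
  moreover from this
  have "(chart_rep c d f has_derivative chart_deriv c d f p) (at (snd c p) within snd c ` U)"
    unfolding chart_deriv_def at_eq using differentiableI frechet_derivative_works by blast
  ultimately show ?thesis
    using quadrant_derivative_unique[OF S(1,2) oU x(1)] by blast
qed

lemma manifold_chart: "manifold_with_corners M \<Longrightarrow> c \<in> charts M \<Longrightarrow> is_chart (mtop M) c"
  unfolding manifold_with_corners_def by blast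

lemma charts_atD: 
  assumes "manifold_with_corners M" "c \<in> charts_at M p"
  shows "is_chart (mtop M) c" "p \<in> fst c" "c \<in> charts M" "openin (mtop M) (fst c)"
  using assms manifold_chart is_chart_openin unfolding charts_at_def by blast+

lemma charts_at_nonempty:
  assumes "manifold_with_corners M" "p \<in> topspace (mtop M)"
  obtains c where "c \<in> charts_at M p"
  using assms unfolding manifold_with_corners_def charts_at_def by blast

lemma manifold_findim: "manifold_with_corners (M :: ('a, 'e::real_inner) manifold) \<Longrightarrow>
    \<exists>B :: 'e set. finite B \<and> span B = UNIV"
  unfolding manifold_with_corners_def by blast

text \<open>A pointwise notion that asks for continuity only near \<open>p\<close>: it applies to
  local inverses and to branches such as source after a local section of the target, which are total
  functions but meaningful only on an open set.\<close>

definition smooth_at ::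
    "('a, 'e::real_inner) manifold \<Rightarrow> ('b, 'e) manifold \<Rightarrow> ('a \<Rightarrow> 'b) \<Rightarrow> 'a \<Rightarrow> bool" where
  "smooth_at M N f p \<longleftrightarrow>
     p \<in> topspace (mtop M) \<and> f p \<in> topspace (mtop N) \<and>
     (\<exists>U. openin (mtop M) U \<and> p \<in> U \<and> continuous_map (subtopology (mtop M) U) (mtop N) f) \<and>
     (\<forall>c\<in>charts_at M p. \<forall>d\<in>charts_at N (f p). smooth_near (mtop M) c p (snd d \<circ> f))"

lemma smooth_at_rep:
  assumes M: "manifold_with_corners M" and N: "manifold_with_corners N" and f: "smooth_at M N f p"
    and c: "c \<in> charts_at M p" and d: "d \<in> charts_at N (f p)"
  obtains U W g where "openin (mtop M) U" "p \<in> U" "U \<subseteq> fst c" "f ` U \<subseteq> fst d" "open W"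
    "snd c ` U \<subseteq> W" "Cinf_on W g" "\<forall>q\<in>U. snd d (f q) = g (snd c q)"
    "continuous_map (subtopology (mtop M) U) (mtop N) f"
proof -
  obtain V where V: "openin (mtop M) V" "p \<in> V" "continuous_map (subtopology (mtop M) V) (mtop N) f"
    using f unfolding smooth_at_def by blast
  have "smooth_near (mtop M) c p (snd d \<circ> f)" using f c d unfolding smooth_at_def by blast
  then obtain U W g where 1: "openin (mtop M) U" "p \<in> U" "U \<subseteq> fst c" "open W" "snd c ` U \<subseteq> W" "Cinf_on W g"
    "\<forall>q\<in>U. (snd d \<circ> f) q = g (snd c q)" by (rule smooth_nearE)
  have o1: "openin (mtop M) {q \<in> V. f q \<in> fst d}"
    by (rule openin_local_vimage[OF V(1,3) charts_atD(4)[OF N d]])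
  have *: "continuous_map (subtopology (mtop M) (U \<inter> {q \<in> V. f q \<in> fst d})) (mtop N) f"
    by (rule continuous_map_from_subtopology_mono[OF V(3)]) blast
  show ?thesis
  proof (rule that[OF _ _ _ _ 1(4) _ 1(6) _ *])
    show "openin (mtop M) (U \<inter> {q \<in> V. f q \<in> fst d})" using 1(1) o1 by blast
    show "p \<in> U \<inter> {q \<in> V. f q \<in> fst d}" using 1(2) V(2) charts_atD(2)[OF N d] by blast
    show "snd c ` (U \<inter> {q \<in> V. f q \<in> fst d}) \<subseteq> W" using 1(5) by blast
  qed (use 1(3,7) in auto)
qed

lemma chart_deriv_has_derivative:
  assumes M: "manifold_with_corners M" and N: "manifold_with_corners N" and f: "smooth_at M N f p"
    and c: "c \<in> charts_at M p" and d: "d \<in> charts_at N (f p)"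
  obtains U W g where "openin (mtop M) U" "p \<in> U" "U \<subseteq> fst c" "f ` U \<subseteq> fst d"
    "\<forall>q\<in>U. snd d (f q) = g (snd c q)"
    "(g has_derivative chart_deriv c d f p) (at (snd c p))"
proof -
  obtain U W g where 1: "openin (mtop M) U" "p \<in> U" "U \<subseteq> fst c" "f ` U \<subseteq> fst d" "open W"
    "snd c ` U \<subseteq> W" "Cinf_on W g" "\<forall>q\<in>U. snd d (f q) = g (snd c q)"
    by (rule smooth_at_rep[OF assms])
  have "snd c p \<in> W" using 1 by blast
  from Cinf_on_has_derivative[OF 1(7) this]
  have D: "(g has_derivative frechet_derivative g (at (snd c p))) (at (snd c p))" .
  from chart_deriv_eqI[OF charts_atD(1)[OF M c] 1(1-4) 1(8) D]
  show ?thesis using that[OF 1(1-4) 1(8)] D by simp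
qed

lemma linear_chart_deriv:
  assumes "manifold_with_corners M" "manifold_with_corners N" "smooth_at M N f p"
    "c \<in> charts_at M p" "d \<in> charts_at N (f p)"
  shows "linear (chart_deriv c d f p)"
  using chart_deriv_has_derivative[OF assms] has_derivative_linear by metis

lemma chart_deriv_comp:
  assumes M: "manifold_with_corners M" and N: "manifold_with_corners N" and P: "manifold_with_corners P"
    and f: "smooth_at M N f p" and h: "smooth_at N P h (f p)"
    and c: "c \<in> charts_at M p" and d: "d \<in> charts_at N (f p)" and e: "e \<in> charts_at P (h (f p))"
  shows "chart_deriv c e (h \<circ> f) p = chart_deriv d e h (f p) \<circ> chart_deriv c d f p"
proof -
  obtain U g where 1: "openin (mtop M) U" "p \<in> U" "U \<subseteq> fst c" "f ` U \<subseteq> fst d"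
    "\<forall>q\<in>U. snd d (f q) = g (snd c q)"
    "(g has_derivative chart_deriv c d f p) (at (snd c p))"
    using chart_deriv_has_derivative[OF M N f c d] .
  obtain U' g' where 2: "openin (mtop N) U'" "f p \<in> U'" "U' \<subseteq> fst d" "h ` U' \<subseteq> fst e"
    "\<forall>q\<in>U'. snd e (h q) = g' (snd d q)"
    "(g' has_derivative chart_deriv d e h (f p)) (at (snd d (f p)))"
    using chart_deriv_has_derivative[OF N P h d e] .
  obtain V where V: "openin (mtop M) V" "p \<in> V" "continuous_map (subtopology (mtop M) V) (mtop N) f"
    using f unfolding smooth_at_def by blast
  have o1: "openin (mtop M) {q \<in> V. f q \<in> U'}" by (rule openin_local_vimage[OF V(1,3) 2(1)])
  show ?thesis
  proof (rule chart_deriv_eqI[OF charts_atD(1)[OF M c], of "U \<inter> {q \<in> V. f q \<in> U'}" _ _ _ "g' \<circ> g"])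
    show "((g' \<circ> g) has_derivative chart_deriv d e h (f p) \<circ> chart_deriv c d f p) (at (snd c p))"
      using diff_chain_at[OF 1(6)] 2(6) 1(2,5) by metis
  qed (use 1 2 o1 V in auto)
qed

lemma smooth_at_comp:
  assumes M: "manifold_with_corners M" and N: "manifold_with_corners N" and P: "manifold_with_corners P"
    and f: "smooth_at M N f p" and h: "smooth_at N P h (f p)"
  shows "smooth_at M P (h \<circ> f) p"
proof -
  obtain V where V: "openin (mtop M) V" "p \<in> V" "continuous_map (subtopology (mtop M) V) (mtop N) f"
    using f unfolding smooth_at_def by blast
  obtain V' where V': "openin (mtop N) V'" "f p \<in> V'" "continuous_map (subtopology (mtop N) V') (mtop P) h"
    using h unfolding smooth_at_def by blast
  let ?V = "{q \<in> V. f q \<in> V'}"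
  have o1: "openin (mtop M) ?V" by (rule openin_local_vimage[OF V(1,3) V'(1)])
  have "continuous_map (subtopology (mtop M) ?V) (subtopology (mtop N) V') f"
    using continuous_map_from_subtopology_mono[OF V(3)]
    by (auto simp: continuous_map_in_subtopology)
  then have "continuous_map (subtopology (mtop M) ?V) (mtop P) (h \<circ> f)"
    using V'(3) continuous_map_compose by blast
  then have cont: "\<exists>U. openin (mtop M) U \<and> p \<in> U \<and> continuous_map (subtopology (mtop M) U) (mtop P) (h \<circ> f)"
    using o1 V V' by (intro exI[of _ ?V]) auto
  have fp: "f p \<in> topspace (mtop N)" using f unfolding smooth_at_def by blast
  obtain d where d: "d \<in> charts_at N (f p)" using charts_at_nonempty[OF N fp] .
  have "smooth_near (mtop M) c p (snd e \<circ> (h \<circ> f))"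
    if c: "c \<in> charts_at M p" and e: "e \<in> charts_at P (h (f p))" for c e
  proof -
    have "smooth_near (mtop M) c p (snd d \<circ> f)" using f c d unfolding smooth_at_def by blast
    moreover have "smooth_near (mtop N) d (f p) (snd e \<circ> h)" using h d e unfolding smooth_at_def by blast
    ultimately have "smooth_near (mtop M) c p ((snd e \<circ> h) \<circ> f)"
      using smooth_near_compose[OF manifold_findim[OF N] _ _ V] by blast
    then show ?thesis by (simp add: comp_assoc)
  qed
  then show ?thesis using cont f h unfolding smooth_at_def by auto
qed

text \<open>Compatibility of the atlas, read as smoothness of the identity. Every statement about
  transition maps, such as the coordinate change of a tangent vector, thereby becomes the case
  \<open>f = id\<close> of a statement about smooth maps.\<close>

lemma smooth_at_id:
  assumes M: "manifold_with_corners M" and p: "p \<in> topspace (mtop M)"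
  shows "smooth_at M M id p"
proof -
  have "smooth_near (mtop M) c p (snd d \<circ> id)" if c: "c \<in> charts_at M p" and d: "d \<in> charts_at M p" for c d
  proof -
    let ?D = "fst c \<inter> fst d"
    have o: "openin (mtop M) ?D" using charts_atD(4)[OF M c] charts_atD(4)[OF M d] by blast
    have "smooth_on (snd c ` ?D) (chart_rep c d id)"
      using M charts_atD(3)[OF M c] charts_atD(3)[OF M d]
      unfolding manifold_with_corners_def chart_dom_def by (simp add: Int_def)
    then have "smooth_near (mtop M) c p (chart_rep c d id \<circ> snd c)"
      using smooth_on_chart_iff[OF charts_atD(1)[OF M c] o] charts_atD(2)[OF M c] charts_atD(2)[OF M d]
      by auto
    then show ?thesis
      by (rule smooth_near_cong[OF _ charts_atD(4)[OF M c] charts_atD(2)[OF M c]])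
        (simp add: chart_rep_def is_chart_inv[OF charts_atD(1)[OF M c] order_refl])
  qed
  moreover have "\<exists>U. openin (mtop M) U \<and> p \<in> U \<and> continuous_map (subtopology (mtop M) U) (mtop M) id"
    using p by (intro exI[of _ "topspace (mtop M)"]) auto
  ultimately show ?thesis using p unfolding smooth_at_def by auto
qed

lemma chart_deriv_id:
  assumes M: "manifold_with_corners M" and c: "c \<in> charts_at M p"
  shows "chart_deriv c c id p = id"
  by (rule chart_deriv_eqI[OF charts_atD(1)[OF M c] charts_atD(4)[OF M c] charts_atD(2)[OF M c],
        where g = id]) (simp_all add: id_def)

lemma chart_deriv_cong:
  assumes M: "manifold_with_corners M" and N: "manifold_with_corners N" and f: "smooth_at M N f p"
    and U: "openin (mtop M) U" "p \<in> U" "\<And>q. q \<in> U \<Longrightarrow> f q = h q"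
    and c: "c \<in> charts_at M p" and d: "d \<in> charts_at N (f p)"
  shows "chart_deriv c d h p = chart_deriv c d f p"
proof -
  obtain V g where 1: "openin (mtop M) V" "p \<in> V" "V \<subseteq> fst c" "f ` V \<subseteq> fst d"
    "\<forall>q\<in>V. snd d (f q) = g (snd c q)"
    "(g has_derivative chart_deriv c d f p) (at (snd c p))"
    using chart_deriv_has_derivative[OF M N f c d] .
  show ?thesis
    by (rule chart_deriv_eqI[OF charts_atD(1)[OF M c], of "U \<inter> V", OF _ _ _ _ _ 1(6)])
      (use U 1 in auto)
qed

section \<open>Differentials and pullbacks of forms\<close>

lemma tangent_spaceD:
  assumes "\<xi> \<in> tangent_space M p" "c \<in> charts_at M p" "d \<in> charts_at M p"
  shows "\<xi> d = chart_deriv c d id p (\<xi> c)"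
  using assms unfolding tangent_space_def by blast

lemma tangent_space_outside: "\<xi> \<in> tangent_space M p \<Longrightarrow> c \<notin> charts_at M p \<Longrightarrow> \<xi> c = 0"
  unfolding tangent_space_def by blast

lemma tangent_spaceI:
  assumes "\<And>c d. c \<in> charts_at M p \<Longrightarrow> d \<in> charts_at M p \<Longrightarrow> \<xi> d = chart_deriv c d id p (\<xi> c)"
    "\<And>c. c \<notin> charts_at M p \<Longrightarrow> \<xi> c = 0"
  shows "\<xi> \<in> tangent_space M p"
  using assms unfolding tangent_space_def by blast

lemma differential_outside: "d \<notin> charts_at N (f p) \<Longrightarrow> differential M N f p \<xi> d = 0"
  by (simp add: differential_def Let_def)

text \<open>Replaces the chart picked by \<open>SOME\<close> with an arbitrary one: the chain rule
  for \<open>f = f \<circ> id\<close> absorbs the change of chart into the coordinates of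
  \<open>\<xi>\<close>.\<close>

lemma differential_eq:
  assumes M: "manifold_with_corners M" and N: "manifold_with_corners N" and f: "smooth_at M N f p"
    and \<xi>: "\<xi> \<in> tangent_space M p" and c: "c \<in> charts_at M p" and d: "d \<in> charts_at N (f p)"
  shows "differential M N f p \<xi> d = chart_deriv c d f p (\<xi> c)"
proof -
  define c0 where "c0 = (SOME c. c \<in> charts_at M p)"
  have c0: "c0 \<in> charts_at M p" unfolding c0_def using c by (rule someI)
  have p: "p \<in> topspace (mtop M)" using f unfolding smooth_at_def by blast
  have "chart_deriv c0 d (f \<circ> id) p = chart_deriv c d f (id p) \<circ> chart_deriv c0 c id p"
    by (rule chart_deriv_comp[OF M M N smooth_at_id[OF M p] _ c0]) (simp_all add: f c d)
  then have "chart_deriv c0 d f p (\<xi> c0) = chart_deriv c d f p (\<xi> c)"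
    by (simp add: tangent_spaceD[OF \<xi> c0 c])
  then show ?thesis using d by (simp add: differential_def Let_def flip: c0_def)
qed

lemma differential_in_tangent_space:
  assumes M: "manifold_with_corners M" and N: "manifold_with_corners N" and f: "smooth_at M N f p"
    and \<xi>: "\<xi> \<in> tangent_space M p"
  shows "differential M N f p \<xi> \<in> tangent_space N (f p)"
proof -
  have p: "p \<in> topspace (mtop M)" "f p \<in> topspace (mtop N)" using f unfolding smooth_at_def by blast+
  obtain c where c: "c \<in> charts_at M p" using charts_at_nonempty[OF M p(1)] .
  have *: "differential M N f p \<xi> e = chart_deriv d e id (f p) (differential M N f p \<xi> d)"
    if d: "d \<in> charts_at N (f p)" and e: "e \<in> charts_at N (f p)" for d e
  proof -
    have "chart_deriv c e (id \<circ> f) p = chart_deriv d e id (f p) \<circ> chart_deriv c d f p"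
      by (rule chart_deriv_comp[OF M N N f smooth_at_id[OF N p(2)] c d]) (simp add: e)
    then show ?thesis
      by (simp add: differential_eq[OF M N f \<xi> c] d e)
  qed
  show ?thesis by (rule tangent_spaceI) (erule *, assumption, erule differential_outside)
qed

lemma differential_comp:
  assumes M: "manifold_with_corners M" and N: "manifold_with_corners N" and P: "manifold_with_corners P"
    and f: "smooth_at M N f p" and h: "smooth_at N P h (f p)" and \<xi>: "\<xi> \<in> tangent_space M p"
  shows "differential M P (h \<circ> f) p \<xi> = differential N P h (f p) (differential M N f p \<xi>)"
proof
  fix e
  have p: "p \<in> topspace (mtop M)" "f p \<in> topspace (mtop N)" using f unfolding smooth_at_def by blast+
  obtain c where c: "c \<in> charts_at M p" using charts_at_nonempty[OF M p(1)] .
  obtain d where d: "d \<in> charts_at N (f p)" using charts_at_nonempty[OF N p(2)] .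
  note hf = smooth_at_comp[OF M N P f h]
  note D = differential_in_tangent_space[OF M N f \<xi>]
  show "differential M P (h \<circ> f) p \<xi> e = differential N P h (f p) (differential M N f p \<xi>) e"
  proof (cases "e \<in> charts_at P (h (f p))")
    case True
    then have "differential M P (h \<circ> f) p \<xi> e = chart_deriv c e (h \<circ> f) p (\<xi> c)"
      using differential_eq[OF M P hf \<xi> c] by simp
    also have "\<dots> = chart_deriv d e h (f p) (chart_deriv c d f p (\<xi> c))"
      using chart_deriv_comp[OF M N P f h c d True] by simp
    also have "\<dots> = differential N P h (f p) (differential M N f p \<xi>) e"
      by (simp add: differential_eq[OF N P h D d True] differential_eq[OF M N f \<xi> c d])
    finally show ?thesis .
  qed (simp add: differential_outside)
qed

lemma differential_id:
  assumes M: "manifold_with_corners M" and p: "p \<in> topspace (mtop M)" and \<xi>: "\<xi> \<in> tangent_space M p"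
  shows "differential M M id p \<xi> = \<xi>"
proof
  fix d
  show "differential M M id p \<xi> d = \<xi> d"
  proof (cases "d \<in> charts_at M p")
    case True
    then show ?thesis
      using differential_eq[OF M M smooth_at_id[OF M p] \<xi> True] chart_deriv_id[OF M True] by simp
  next
    case False
    then show ?thesis by (simp add: differential_outside tangent_space_outside[OF \<xi>])
  qed
qed

lemma differential_cong:
  assumes M: "manifold_with_corners M" and N: "manifold_with_corners N" and f: "smooth_at M N f p"
    and U: "openin (mtop M) U" "p \<in> U" "\<And>q. q \<in> U \<Longrightarrow> f q = h q"
  shows "differential M N h p = differential M N f p"
proof -
  have "\<exists>c. c \<in> charts_at M p"
    using f charts_at_nonempty[OF M] unfolding smooth_at_def by metis
  then have "(SOME c. c \<in> charts_at M p) \<in> charts_at M p" by (rule someI_ex)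
  from chart_deriv_cong[OF M N f U this] show ?thesis
    using U by (simp add: differential_def Let_def fun_eq_iff)
qed

lemma tangent_space_lincomb:
  assumes M: "manifold_with_corners M" and p: "p \<in> topspace (mtop M)"
    and \<xi>: "\<xi> \<in> tangent_space M p" "\<eta> \<in> tangent_space M p"
  shows "(\<lambda>c. a *\<^sub>R \<xi> c + b *\<^sub>R \<eta> c) \<in> tangent_space M p"
proof -
  have "linear (chart_deriv c d id p)" if "c \<in> charts_at M p" "d \<in> charts_at M p" for c d
    using linear_chart_deriv[OF M M smooth_at_id[OF M p]] that by simp
  note l = linear_add[OF this] linear_scale[OF this]
  show ?thesis
  proof (rule tangent_spaceI)
    fix c d assume cd: "c \<in> charts_at M p" "d \<in> charts_at M p"
    show "a *\<^sub>R \<xi> d + b *\<^sub>R \<eta> d = chart_deriv c d id p (a *\<^sub>R \<xi> c + b *\<^sub>R \<eta> c)"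
      unfolding l[OF cd] using tangent_spaceD[OF \<xi>(1) cd] tangent_spaceD[OF \<xi>(2) cd] by simp
  qed (simp add: tangent_space_outside[OF \<xi>(1)] tangent_space_outside[OF \<xi>(2)])
qed

lemma differential_lincomb:
  assumes M: "manifold_with_corners M" and N: "manifold_with_corners N" and f: "smooth_at M N f p"
    and \<xi>: "\<xi> \<in> tangent_space M p" "\<eta> \<in> tangent_space M p"
  shows "differential M N f p (\<lambda>c. a *\<^sub>R \<xi> c + b *\<^sub>R \<eta> c) =
    (\<lambda>d. a *\<^sub>R differential M N f p \<xi> d + b *\<^sub>R differential M N f p \<eta> d)"
proof
  fix d
  have p: "p \<in> topspace (mtop M)" using f unfolding smooth_at_def by blast
  obtain c where c: "c \<in> charts_at M p" using charts_at_nonempty[OF M p] .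
  show "differential M N f p (\<lambda>c. a *\<^sub>R \<xi> c + b *\<^sub>R \<eta> c) d =
    a *\<^sub>R differential M N f p \<xi> d + b *\<^sub>R differential M N f p \<eta> d"
  proof (cases "d \<in> charts_at N (f p)")
    case True
    note l = linear_chart_deriv[OF M N f c True]
    show ?thesis
      by (simp add: differential_eq[OF M N f _ c True] \<xi> tangent_space_lincomb[OF M p]
          linear_add[OF l] linear_scale[OF l])
  qed (simp add: differential_outside)
qed

text \<open>The compatibility required of a tangent vector is the chain rule for
  \<open>id = id \<circ> id\<close> across three charts.\<close>

lemma coord_tvec_in_tangent_space:
  assumes M: "manifold_with_corners M" and c: "c \<in> charts_at M p"
  shows "coord_tvec M p c v \<in> tangent_space M p"
proof -
  have p: "p \<in> topspace (mtop M)" using charts_atD(2,4)[OF M c] openin_subset by blast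
  note i = smooth_at_id[OF M p]
  have *: "chart_deriv c e id p v = chart_deriv d e id p (chart_deriv c d id p v)"
    if "d \<in> charts_at M p" "e \<in> charts_at M p" for d e
  proof -
    have "chart_deriv c e (id \<circ> id) p = chart_deriv d e id (id p) \<circ> chart_deriv c d id p"
      by (rule chart_deriv_comp[OF M M M i _ c]) (simp_all add: i that)
    from fun_cong[OF this, of v] show ?thesis by simp
  qed
  show ?thesis
  proof (rule tangent_spaceI)
    fix d e assume de: "d \<in> charts_at M p" "e \<in> charts_at M p"
    have "coord_tvec M p c v x = chart_deriv c x id p v" if "x \<in> charts_at M p" for x
      using that by (simp add: coord_tvec_def)
    note eq = this[OF de(1)] this[OF de(2)]
    show "coord_tvec M p c v e = chart_deriv d e id p (coord_tvec M p c v d)"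
      unfolding eq by (rule *[OF de])
  qed (simp add: coord_tvec_def)
qed

lemma coord_tvec_self: "manifold_with_corners M \<Longrightarrow> c \<in> charts_at M p \<Longrightarrow> coord_tvec M p c v c = v"
  by (simp add: coord_tvec_def chart_deriv_id)

lemma coord_tvec_lincomb:
  assumes M: "manifold_with_corners M" and c: "c \<in> charts_at M p"
  shows "coord_tvec M p c (a *\<^sub>R v + b *\<^sub>R w) = (\<lambda>d. a *\<^sub>R coord_tvec M p c v d + b *\<^sub>R coord_tvec M p c w d)"
proof -
  have p: "p \<in> topspace (mtop M)" using charts_atD(2,4)[OF M c] openin_subset by blast
  have "linear (chart_deriv c d id p)" if "d \<in> charts_at M p" for d
    using linear_chart_deriv[OF M M smooth_at_id[OF M p] c] that by simp
  then show ?thesis by (simp add: coord_tvec_def fun_eq_iff linear_add linear_scale)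
qed

lemma differential_coord_tvec:
  assumes M: "manifold_with_corners M" and N: "manifold_with_corners N" and f: "smooth_at M N f p"
    and c: "c \<in> charts_at M p" and d: "d \<in> charts_at N (f p)"
  shows "differential M N f p (coord_tvec M p c v) = coord_tvec N (f p) d (chart_deriv c d f p v)"
proof
  fix e
  note t = coord_tvec_in_tangent_space[OF M c, of v]
  have q: "f p \<in> topspace (mtop N)" using f unfolding smooth_at_def by blast
  show "differential M N f p (coord_tvec M p c v) e = coord_tvec N (f p) d (chart_deriv c d f p v) e"
  proof (cases "e \<in> charts_at N (f p)")
    case True
    then have "chart_deriv c e (id \<circ> f) p = chart_deriv d e id (f p) \<circ> chart_deriv c d f p"
      by (intro chart_deriv_comp[OF M N N f smooth_at_id[OF N q] c d]) simp
    moreover have "coord_tvec N (f p) d w e = chart_deriv d e id (f p) w" for w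
      by (simp add: coord_tvec_def True)
    ultimately show ?thesis
      by (simp add: differential_eq[OF M N f t c True] coord_tvec_self[OF M c])
  qed (simp add: differential_outside coord_tvec_def)
qed

section \<open>Multilinear expressions and alternating maps\<close>

lemma multilinear_sum:
  fixes \<Phi> :: "'e::real_vector list \<Rightarrow> real"
  assumes lin: "\<And>a b x y. \<Phi> (us @ (a *\<^sub>R x + b *\<^sub>R y) # r) = a * \<Phi> (us @ x # r) + b * \<Phi> (us @ y # r)"
  shows "\<Phi> (us @ (\<Sum>i\<in>I. t i *\<^sub>R w i) # r) = (\<Sum>i\<in>I. t i * \<Phi> (us @ w i # r))"
proof -
  have zero: "\<Phi> (us @ 0 # r) = 0" using lin[of 0 0 0 0] by simp
  show ?thesis
  proof (induction I rule: infinite_finite_induct)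
    case (insert i I)
    then show ?case using lin[of "t i" "w i" 1 "\<Sum>i\<in>I. t i *\<^sub>R w i"] by simp
  qed (simp_all add: zero)
qed

text \<open>Expanding the vectors in a basis reduces smoothness of a multilinear expression to
  smoothness of its finitely many coefficients.\<close>

lemma smooth_near_multilinear:
  fixes \<Phi> :: "'a \<Rightarrow> 'e::real_inner list \<Rightarrow> real" and c :: "('a, 'd::real_inner) chart"
  assumes fd: "\<exists>B :: 'e set. finite B \<and> span B = UNIV"
    and chart: "is_chart T c" "p \<in> fst c"
    and V: "openin T V" "p \<in> V"
    and lin: "\<And>q us r x y a b. q \<in> V \<Longrightarrow>
      \<Phi> q (us @ (a *\<^sub>R x + b *\<^sub>R y) # r) = a * \<Phi> q (us @ x # r) + b * \<Phi> q (us @ y # r)"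
    and const: "\<And>ws. smooth_near T c p (\<lambda>q. \<Phi> q ws)"
    and As: "\<And>A. A \<in> set As \<Longrightarrow> smooth_near T c p A"
  shows "smooth_near T c p (\<lambda>q. \<Phi> q (us @ map (\<lambda>A. A q) As))"
proof -
  obtain C :: "'e set" where C: "finite C" "pairwise orthogonal C" "span C = UNIV"
  proof -
    from fd obtain B :: "'e set" where "finite B" "span B = UNIV" by (elim exE conjE)
    from orthogonal_basis_exists[OF this] that show thesis .
  qed
  show ?thesis using As
  \<comment> \<open>The prefix \<open>us\<close> holds the constant vectors already substituted.
    Each step expands the first moving entry and appends a basis vector to the prefix, until all
    entries are constant.\<close>
  proof (induction As arbitrary: us)
    case Nil
    then show ?case by (simp add: const)
  next
    case (Cons A As)
    have "smooth_near T c p (\<lambda>q. \<Sum>b\<in>C. ((A q \<bullet> b) / (b \<bullet> b)) *\<^sub>R \<Phi> q ((us @ [b]) @ map (\<lambda>A. A q) As))"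
    proof (rule smooth_near_sum[OF chart], rule smooth_near_scaleR)
      fix b :: 'e
      have "bounded_linear (\<lambda>y. (y \<bullet> b) / (b \<bullet> b))"
        using bounded_linear_divide bounded_linear_inner_left bounded_linear_compose by blast
      then show "smooth_near T c p (\<lambda>q. (A q \<bullet> b) / (b \<bullet> b))"
        by (rule smooth_near_bounded_linear) (simp add: Cons.prems)
      show "smooth_near T c p (\<lambda>q. \<Phi> q ((us @ [b]) @ map (\<lambda>A. A q) As))"
        by (rule Cons.IH) (simp add: Cons.prems)
    qed
    then show ?case
    proof (rule smooth_near_cong[OF _ V])
      fix q assume q: "q \<in> V"
      have "\<Phi> q (us @ map (\<lambda>A. A q) (A # As)) =
          \<Phi> q (us @ (\<Sum>b\<in>C. ((A q \<bullet> b) / (b \<bullet> b)) *\<^sub>R b) # map (\<lambda>A. A q) As)"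
        using orthogonal_expansion[OF C, of "A q"] by simp
      also have "\<dots> = (\<Sum>b\<in>C. ((A q \<bullet> b) / (b \<bullet> b)) * \<Phi> q (us @ b # map (\<lambda>A. A q) As))"
        by (rule multilinear_sum) (rule lin[OF q])
      finally show "(\<Sum>b\<in>C. ((A q \<bullet> b) / (b \<bullet> b)) *\<^sub>R \<Phi> q ((us @ [b]) @ map (\<lambda>A. A q) As)) =
          \<Phi> q (us @ map (\<lambda>A. A q) (A # As))" by simp
    qed
  qed
qed

text \<open>Serves both differentials of smooth maps and \<open>transport\<close>, whose linearity
  is only known on the tangent space; hence all conditions on \<open>L\<close> are restricted to
  \<open>V'\<close>. The value 0 off \<open>V'\<close> matches the convention for forms.\<close>

lemma alternating_on_compose:
  assumes w: "alternating_on V w" and L: "\<And>\<xi>. \<xi> \<in> V' \<Longrightarrow> L \<xi> \<in> V"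
    and closed: "\<And>\<xi> \<eta> a b. \<xi> \<in> V' \<Longrightarrow> \<eta> \<in> V' \<Longrightarrow> (\<lambda>c. a *\<^sub>R \<xi> c + b *\<^sub>R \<eta> c) \<in> V'"
    and lin: "\<And>\<xi> \<eta> a b. \<xi> \<in> V' \<Longrightarrow> \<eta> \<in> V' \<Longrightarrow>
      L (\<lambda>c. a *\<^sub>R \<xi> c + b *\<^sub>R \<eta> c) = (\<lambda>c. a *\<^sub>R L \<xi> c + b *\<^sub>R L \<eta> c)"
  shows "alternating_on V' (\<lambda>\<xi>s. if set \<xi>s \<subseteq> V' then w (map L \<xi>s) else 0)"
  unfolding alternating_on_def
proof (intro conjI allI ballI impI)
  fix \<xi>s i a b \<xi> \<eta> assume *: "\<xi> \<in> V'" "\<eta> \<in> V'" "set \<xi>s \<subseteq> V' \<and> i < length \<xi>s"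
  have s: "set (\<xi>s[i := \<zeta>]) \<subseteq> V'" if "\<zeta> \<in> V'" for \<zeta> using * that set_update_subset_insert[of \<xi>s i \<zeta>] by blast
  have "set (map L \<xi>s) \<subseteq> V" "i < length (map L \<xi>s)" using * L by auto
  then have "w ((map L \<xi>s)[i := \<lambda>c. a *\<^sub>R L \<xi> c + b *\<^sub>R L \<eta> c]) =
      a * w ((map L \<xi>s)[i := L \<xi>]) + b * w ((map L \<xi>s)[i := L \<eta>])"
    using w L * unfolding alternating_on_def by blast
  then show "(if set (\<xi>s[i := \<lambda>c. a *\<^sub>R \<xi> c + b *\<^sub>R \<eta> c]) \<subseteq> V' then w (map L (\<xi>s[i := \<lambda>c. a *\<^sub>R \<xi> c + b *\<^sub>R \<eta> c])) else 0) =
      a * (if set (\<xi>s[i := \<xi>]) \<subseteq> V' then w (map L (\<xi>s[i := \<xi>])) else 0) +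
      b * (if set (\<xi>s[i := \<eta>]) \<subseteq> V' then w (map L (\<xi>s[i := \<eta>])) else 0)"
    using s *(1,2) closed[OF *(1,2)] by (simp add: map_update lin)
next
  fix \<xi>s assume *: "set \<xi>s \<subseteq> V' \<and> \<not> distinct \<xi>s"
  then have "set (map L \<xi>s) \<subseteq> V" "\<not> distinct (map L \<xi>s)" using L by (auto simp: distinct_map)
  then have "w (map L \<xi>s) = 0" using w unfolding alternating_on_def by blast
  then show "(if set \<xi>s \<subseteq> V' then w (map L \<xi>s) else 0) = 0" by simp
qed simp

lemma alternating_on_sum:
  assumes "\<And>i. i \<in> I \<Longrightarrow> alternating_on V (w i)"
  shows "alternating_on V (\<lambda>\<xi>s. \<Sum>i\<in>I. w i \<xi>s)"
  unfolding alternating_on_def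
proof (intro conjI allI ballI impI)
  fix \<xi>s i a b \<xi> \<eta> assume *: "\<xi> \<in> V" "\<eta> \<in> V" "set \<xi>s \<subseteq> V \<and> i < length \<xi>s"
  have "w j (\<xi>s[i := \<lambda>c. a *\<^sub>R \<xi> c + b *\<^sub>R \<eta> c]) = a * w j (\<xi>s[i := \<xi>]) + b * w j (\<xi>s[i := \<eta>])"
    if "j \<in> I" for j
    using assms[OF that] * unfolding alternating_on_def by blast
  then show "(\<Sum>j\<in>I. w j (\<xi>s[i := \<lambda>c. a *\<^sub>R \<xi> c + b *\<^sub>R \<eta> c])) =
      a * (\<Sum>j\<in>I. w j (\<xi>s[i := \<xi>])) + b * (\<Sum>j\<in>I. w j (\<xi>s[i := \<eta>]))"
    by (simp add: sum.distrib sum_distrib_left)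
next
  fix \<xi>s assume "set \<xi>s \<subseteq> V \<and> \<not> distinct \<xi>s"
  then show "(\<Sum>j\<in>I. w j \<xi>s) = 0" using assms unfolding alternating_on_def by (intro sum.neutral) blast
next
  fix \<xi>s assume "\<not> set \<xi>s \<subseteq> V"
  then show "(\<Sum>j\<in>I. w j \<xi>s) = 0" using assms unfolding alternating_on_def by (intro sum.neutral) blast
qed

section \<open>Smoothness of forms and of their pullbacks\<close>

text \<open>Composing with \<open>snd c\<close> cancels the chart inverse in the smoothness clause
  of \<open>forms\<close>. Coefficients of forms can then be combined by the rules for
  \<open>smooth_near\<close>.\<close>

lemma forms_iff:
  assumes M: "manifold_with_corners M"
  shows "\<omega> \<in> forms M \<longleftrightarrow>
     (\<forall>p\<in>topspace (mtop M). alternating_on (tangent_space M p) (\<omega> p)) \<and>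
     (\<forall>p. p \<notin> topspace (mtop M) \<longrightarrow> \<omega> p = (\<lambda>_. 0)) \<and>
     (\<forall>c\<in>charts M. \<forall>p\<in>fst c. \<forall>vs. smooth_near (mtop M) c p (\<lambda>q. \<omega> q (map (coord_tvec M q c) vs)))"
proof -
  have "smooth_on (snd c ` fst c)
          (\<lambda>x. let p = inv_into (fst c) (snd c) x in \<omega> p (map (coord_tvec M p c) vs)) \<longleftrightarrow>
        (\<forall>p\<in>fst c. smooth_near (mtop M) c p (\<lambda>q. \<omega> q (map (coord_tvec M q c) vs)))"
    if "c \<in> charts M" for c vs
  proof -
    note c = manifold_chart[OF M that]
    let ?h = "\<lambda>x. let p = inv_into (fst c) (snd c) x in \<omega> p (map (coord_tvec M p c) vs)"
    have eq: "(?h \<circ> snd c) q = \<omega> q (map (coord_tvec M q c) vs)" if "q \<in> fst c" for q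
      using is_chart_inv[OF c order_refl that] by simp
    show ?thesis
      unfolding smooth_on_chart_iff[OF c is_chart_openin[OF c] order_refl]
      by (intro ball_cong refl iffI; erule smooth_near_cong[OF _ is_chart_openin[OF c]])
        (simp_all add: eq del: comp_apply)
  qed
  then show ?thesis unfolding forms_def by auto
qed

lemma smooth_fun_iff:
  assumes M: "manifold_with_corners M"
  shows "smooth_fun M f \<longleftrightarrow> (\<forall>c\<in>charts M. \<forall>p\<in>fst c. smooth_near (mtop M) c p f)"
  unfolding smooth_fun_def
proof (rule ball_cong[OF refl])
  fix c assume "c \<in> charts M"
  note c = manifold_chart[OF M this]
  have eq: "(f \<circ> inv_into (fst c) (snd c) \<circ> snd c) q = f q" if "q \<in> fst c" for q
    using is_chart_inv[OF c order_refl that] by simp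
  show "smooth_on (snd c ` fst c) (f \<circ> inv_into (fst c) (snd c)) \<longleftrightarrow> (\<forall>p\<in>fst c. smooth_near (mtop M) c p f)"
    unfolding smooth_on_chart_iff[OF c is_chart_openin[OF c] order_refl]
    by (intro ball_cong refl iffI; erule smooth_near_cong[OF _ is_chart_openin[OF c]])
      (simp_all add: eq del: comp_apply)
qed

text \<open>In charts, a coefficient of the pulled-back form is a multilinear expression: its
  entries are derivatives of one extension \<open>g\<close> at \<open>snd c q\<close>, smooth in
  \<open>q\<close>, and for constant entries it is a coefficient of \<open>\<omega>\<close> composed
  with \<open>f\<close>. Smoothness of \<open>f\<close> is assumed only on \<open>V\<close>, so that
  local branches are covered.\<close>

lemma smooth_near_pullback:
  fixes M :: "('a, 'e::real_inner) manifold" and N :: "('b, 'e) manifold"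
  assumes M: "manifold_with_corners M" and N: "manifold_with_corners N"
    and V: "openin (mtop M) V" "p \<in> V" "\<And>q. q \<in> V \<Longrightarrow> smooth_at M N f q"
    and \<omega>: "\<omega> \<in> forms N" and c: "c \<in> charts_at M p"
  shows "smooth_near (mtop M) c p
    (\<lambda>q. \<omega> (f q) (map (differential M N f q) (map (coord_tvec M q c) vs)))"
proof -
  have fp: "f p \<in> topspace (mtop N)" using V unfolding smooth_at_def by blast
  obtain d where d: "d \<in> charts_at N (f p)" using charts_at_nonempty[OF N fp] .
  obtain U W g where U: "openin (mtop M) U" "p \<in> U" "U \<subseteq> fst c" "f ` U \<subseteq> fst d" "open W"
    "snd c ` U \<subseteq> W" "Cinf_on W g" "\<forall>q\<in>U. snd d (f q) = g (snd c q)"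
    "continuous_map (subtopology (mtop M) U) (mtop N) f"
    using smooth_at_rep[OF M N V(3)[OF V(2)] c d] .
  let ?D = "\<lambda>v q. frechet_derivative g (at (snd c q)) v"
  let ?\<Phi> = "\<lambda>q ws. \<omega> (f q) (map (coord_tvec N (f q) d) ws)"
  have at: "c \<in> charts_at M q" "d \<in> charts_at N (f q)" if "q \<in> U" for q
    using that U c d by (auto simp: charts_at_def)
  have UV: "openin (mtop M) (U \<inter> V)" "p \<in> U \<inter> V" using U V by auto
  note chart = charts_atD(1,2)[OF M c]
  have "smooth_near (mtop M) c p (\<lambda>q. ?\<Phi> q ([] @ map (\<lambda>A. A q) (map ?D vs)))"
  proof (rule smooth_near_multilinear[OF manifold_findim[OF M] chart UV])
    show "smooth_near (mtop M) c p (\<lambda>q. ?\<Phi> q ws)" for ws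
    proof -
      have "smooth_near (mtop N) d (f p) (\<lambda>y. \<omega> y (map (coord_tvec N y d) ws))"
        using \<omega> d by (simp add: forms_iff[OF N] charts_at_def)
      moreover have "smooth_near (mtop M) c p (snd d \<circ> f)"
        using V(3)[OF V(2)] c d unfolding smooth_at_def by blast
      ultimately have "smooth_near (mtop M) c p ((\<lambda>y. \<omega> y (map (coord_tvec N y d) ws)) \<circ> f)"
        using smooth_near_compose[OF manifold_findim[OF M] _ _ U(1,2,9)] by blast
      then show ?thesis by (simp add: comp_def)
    qed
    show "smooth_near (mtop M) c p A" if A: "A \<in> set (map ?D vs)" for A
    proof -
      obtain v where "A = ?D v" using A by auto
      then show ?thesis
        by (intro smooth_nearI[OF U(1-3,5,6) Cinf_on_derivative[OF U(7,5), of v]]) simp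
    qed
    fix q us r x y a b assume q: "q \<in> U \<inter> V"
    let ?t = "coord_tvec N (f q) d"
    have dq: "d \<in> charts_at N (f q)" using at q by blast
    have fq: "f q \<in> topspace (mtop N)" using V(3) q unfolding smooth_at_def by blast
    have alt: "alternating_on (tangent_space N (f q)) (\<omega> (f q))"
      using \<omega> fq by (simp add: forms_iff[OF N])
    note tin = coord_tvec_in_tangent_space[OF N dq]
    \<comment> \<open>\<open>alternating_on\<close> expresses linearity through list update; the
      varying slot sits at position \<open>length us\<close>.\<close>
    let ?l = "map ?t (us @ x # r)"
    have "set ?l \<subseteq> tangent_space N (f q)" "length us < length ?l" using tin by auto
    then have "\<omega> (f q) (?l[length us := (\<lambda>e. a *\<^sub>R ?t x e + b *\<^sub>R ?t y e)]) =
        a * \<omega> (f q) (?l[length us := ?t x]) + b * \<omega> (f q) (?l[length us := ?t y])"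
      using alt tin unfolding alternating_on_def by blast
    then show "?\<Phi> q (us @ (a *\<^sub>R x + b *\<^sub>R y) # r) = a * ?\<Phi> q (us @ x # r) + b * ?\<Phi> q (us @ y # r)"
      by (simp add: coord_tvec_lincomb[OF N dq] list_update_append)
  qed
  then show ?thesis
  proof (rule smooth_near_cong[OF _ UV])
    fix q assume q: "q \<in> U \<inter> V"
    have f: "smooth_at M N f q" using V q by blast
    have "snd c q \<in> W" using q U by blast
    from Cinf_on_has_derivative[OF U(7) this]
    have "chart_deriv c d f q = frechet_derivative g (at (snd c q))"
      using q by (intro chart_deriv_eqI[OF chart(1) U(1) _ U(3,4,8)]) auto
    then have "map (differential M N f q) (map (coord_tvec M q c) vs) =
        map (coord_tvec N (f q) d) ([] @ map (\<lambda>A. A q) (map ?D vs))"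
      using differential_coord_tvec[OF M N f at] q by simp
    then show "?\<Phi> q ([] @ map (\<lambda>A. A q) (map ?D vs)) =
        \<omega> (f q) (map (differential M N f q) (map (coord_tvec M q c) vs))"
      by (simp only:)
  qed
qed

lemma pullback_in_forms:
  assumes M: "manifold_with_corners M" and N: "manifold_with_corners N"
    and f: "\<And>q. q \<in> topspace (mtop M) \<Longrightarrow> smooth_at M N f q" and \<omega>: "\<omega> \<in> forms N"
  shows "pullback M N f \<omega> \<in> forms M"
  unfolding forms_iff[OF M]
proof (intro conjI ballI allI impI)
  fix p assume p: "p \<in> topspace (mtop M)"
  have fp: "f p \<in> topspace (mtop N)" using f[OF p] unfolding smooth_at_def by blast
  have "alternating_on (tangent_space N (f p)) (\<omega> (f p))" using \<omega> fp by (simp add: forms_iff[OF N])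
  then have "alternating_on (tangent_space M p) (\<lambda>\<xi>s. if set \<xi>s \<subseteq> tangent_space M p
      then \<omega> (f p) (map (differential M N f p) \<xi>s) else 0)"
  proof (rule alternating_on_compose)
    fix \<xi> \<eta> a b
    assume t: "\<xi> \<in> tangent_space M p" "\<eta> \<in> tangent_space M p"
    show "(\<lambda>c. a *\<^sub>R \<xi> c + b *\<^sub>R \<eta> c) \<in> tangent_space M p"
      by (rule tangent_space_lincomb[OF M p t])
    show "differential M N f p (\<lambda>c. a *\<^sub>R \<xi> c + b *\<^sub>R \<eta> c) =
        (\<lambda>c. a *\<^sub>R differential M N f p \<xi> c + b *\<^sub>R differential M N f p \<eta> c)"
      by (rule differential_lincomb[OF M N f[OF p] t])
  qed (rule differential_in_tangent_space[OF M N f[OF p]])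
  then show "alternating_on (tangent_space M p) (pullback M N f \<omega> p)"
    using p by (simp add: pullback_def)
next
  fix p assume "p \<notin> topspace (mtop M)"
  then show "pullback M N f \<omega> p = (\<lambda>_. 0)" by (simp add: pullback_def)
next
  fix c p vs assume c: "c \<in> charts M" and p: "p \<in> fst c"
  then have cp: "c \<in> charts_at M p" by (simp add: charts_at_def)
  note o = charts_atD(4)[OF M cp]
  show "smooth_near (mtop M) c p (\<lambda>q. pullback M N f \<omega> q (map (coord_tvec M q c) vs))"
  proof (rule smooth_near_cong[OF smooth_near_pullback[OF M N o p f \<omega> cp] o p])
    fix q assume q: "q \<in> fst c"
    then have "q \<in> topspace (mtop M)" and cq: "c \<in> charts_at M q"
      using openin_subset[OF o] c by (auto simp: charts_at_def)
    then show "\<omega> (f q) (map (differential M N f q) (map (coord_tvec M q c) vs)) =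
        pullback M N f \<omega> q (map (coord_tvec M q c) vs)"
      using coord_tvec_in_tangent_space[OF M cq] by (auto simp: pullback_def)
  qed (use openin_subset[OF o] in blast)
qed

lemma fun_times_in_forms:
  assumes M: "manifold_with_corners M" and f: "smooth_fun M f" and \<omega>: "\<omega> \<in> forms M"
  shows "fun_times f \<omega> \<in> forms M"
  unfolding forms_iff[OF M]
proof (intro conjI ballI allI impI)
  fix p assume p: "p \<in> topspace (mtop M)"
  have "alternating_on (tangent_space M p) (\<omega> p)" using \<omega> p by (simp add: forms_iff[OF M])
  then show "alternating_on (tangent_space M p) (fun_times f \<omega> p)"
    unfolding alternating_on_def fun_times_def by (simp add: algebra_simps)
next
  fix p assume "p \<notin> topspace (mtop M)"
  then show "fun_times f \<omega> p = (\<lambda>_. 0)" using \<omega> by (simp add: forms_iff[OF M] fun_times_def)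
next
  fix c p vs assume c: "c \<in> charts M" and p: "p \<in> fst c"
  have "smooth_near (mtop M) c p (\<lambda>q. f q *\<^sub>R \<omega> q (map (coord_tvec M q c) vs))"
    using f \<omega> c p by (intro smooth_near_scaleR) (simp_all add: forms_iff[OF M] smooth_fun_iff[OF M])
  then show "smooth_near (mtop M) c p (\<lambda>q. fun_times f \<omega> q (map (coord_tvec M q c) vs))"
    by (simp add: fun_times_def)
qed

lemma zero_in_forms:
  assumes M: "manifold_with_corners M"
  shows "(\<lambda>_ _. 0) \<in> forms M"
  by (auto simp: forms_iff[OF M] alternating_on_def charts_atD
      intro!: smooth_near_const manifold_chart[OF M])

lemma lincomb_in_forms:
  assumes M: "manifold_with_corners M" and "\<omega> \<in> forms M" "\<omega>' \<in> forms M"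
  shows "(\<lambda>p \<xi>s. a * \<omega> p \<xi>s + b * \<omega>' p \<xi>s) \<in> forms M"
  unfolding forms_iff[OF M]
proof (intro conjI ballI allI impI)
  fix p assume p: "p \<in> topspace (mtop M)"
  then have "alternating_on (tangent_space M p) (\<omega> p)" "alternating_on (tangent_space M p) (\<omega>' p)"
    using assms(2,3) by (simp_all add: forms_iff[OF M])
  then show "alternating_on (tangent_space M p) (\<lambda>\<xi>s. a * \<omega> p \<xi>s + b * \<omega>' p \<xi>s)"
    unfolding alternating_on_def by (simp add: algebra_simps)
next
  fix p assume "p \<notin> topspace (mtop M)"
  then show "(\<lambda>\<xi>s. a * \<omega> p \<xi>s + b * \<omega>' p \<xi>s) = (\<lambda>_. 0)" using assms(2,3) by (simp add: forms_iff[OF M])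
next
  fix c p vs assume c: "c \<in> charts M" and p: "p \<in> fst c"
  have "smooth_near (mtop M) c p (\<lambda>q. a *\<^sub>R \<omega> q (map (coord_tvec M q c) vs) + b *\<^sub>R \<omega>' q (map (coord_tvec M q c) vs))"
    using assms(2,3) c p manifold_chart[OF M c]
    by (intro smooth_near_add smooth_near_scaleR smooth_near_const) (simp_all add: forms_iff[OF M])
  then show "smooth_near (mtop M) c p
      (\<lambda>q. a * \<omega> q (map (coord_tvec M q c) vs) + b * \<omega>' q (map (coord_tvec M q c) vs))"
    by simp
qed

section \<open>Local diffeomorphisms and transport along morphisms\<close>

text \<open>Charts of an open submanifold keep their coordinate map and only shrink their domain.
  The inverse over the smaller domain agrees with the original one there, so the representations in
  charts coincide near \<open>p\<close>.\<close>

lemma smooth_at_open_submanifold: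
  assumes M: "manifold_with_corners M" and N: "manifold_with_corners N"
    and U: "openin (mtop M) U" and V: "openin (mtop N) V" and p: "p \<in> U"
    and f: "smooth_map (open_submanifold M U) (open_submanifold N V) f"
  shows "smooth_at M N f p"
proof -
  have "continuous_map (subtopology (mtop M) U) (subtopology (mtop N) V) f"
    using f by (simp add: smooth_map_def open_submanifold_def)
  then have cont: "continuous_map (subtopology (mtop M) U) (mtop N) f"
    and fU: "f ` U \<subseteq> V"
    using topspace_subtopology_openin[OF U] by (auto simp: continuous_map_in_subtopology)
  have "smooth_near (mtop M) c p (snd d \<circ> f)"
    if c: "c \<in> charts_at M p" and d: "d \<in> charts_at N (f p)" for c d
  proof -
    let ?c = "(fst c \<inter> U, snd c)" and ?d = "(fst d \<inter> V, snd d)"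
    let ?D = "fst c \<inter> {q \<in> U. f q \<in> fst d}"
    have o: "openin (mtop M) ?D"
      using openin_local_vimage[OF U cont charts_atD(4)[OF N d]] charts_atD(4)[OF M c] by blast
    have pD: "p \<in> ?D" using charts_atD(2)[OF M c] charts_atD(2)[OF N d] p by blast
    have dom: "chart_dom ?c ?d f = snd c ` ?D"
      unfolding chart_dom_def using fU by auto
    have "?c \<in> charts (open_submanifold M U)" "?d \<in> charts (open_submanifold N V)"
      using charts_atD(3)[OF M c] charts_atD(3)[OF N d] by (auto simp: open_submanifold_def)
    then have "smooth_on (chart_dom ?c ?d f) (chart_rep ?c ?d f)"
      using f unfolding smooth_map_def by blast
    then have "smooth_on (snd c ` ?D) (chart_rep ?c ?d f)" unfolding dom .
    then have "smooth_near (mtop M) c p (chart_rep ?c ?d f \<circ> snd c)"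
      using smooth_on_chart_iff[OF charts_atD(1)[OF M c] o] pD by blast
    then show ?thesis
    proof (rule smooth_near_cong[OF _ o pD])
      show "(chart_rep ?c ?d f \<circ> snd c) q = (snd d \<circ> f) q" if "q \<in> ?D" for q
        using that is_chart_inv[OF charts_atD(1)[OF M c], of "fst c \<inter> U" q]
        by (simp add: chart_rep_def)
    qed
  qed
  moreover have "p \<in> topspace (mtop M)" "f p \<in> topspace (mtop N)"
    using openin_subset[OF U] openin_subset[OF V] p fU by blast+
  ultimately show ?thesis unfolding smooth_at_def using U p cont by blast
qed

lemma local_diffeomorphism_inverse:
  assumes M: "manifold_with_corners M" and N: "manifold_with_corners N"
    and f: "local_diffeomorphism M N f" and p: "p \<in> topspace (mtop M)"
  obtains U where "openin (mtop M) U" "p \<in> U" "openin (mtop N) (f ` U)" "inj_on f U"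
    "\<forall>q\<in>U. smooth_at M N f q" "\<forall>y\<in>f ` U. smooth_at N M (inv_into U f) y"
    "continuous_map (subtopology (mtop N) (f ` U)) (mtop M) (inv_into U f)"
proof -
  obtain U where U: "openin (mtop M) U" "p \<in> U" "openin (mtop N) (f ` U)"
    "diffeomorphism (open_submanifold M U) (open_submanifold N (f ` U)) f"
    using f p unfolding local_diffeomorphism_def by blast
  have top: "topspace (mtop (open_submanifold M U)) = U"
    using topspace_subtopology_openin[OF U(1)] by (simp add: open_submanifold_def)
  have sm: "smooth_map (open_submanifold M U) (open_submanifold N (f ` U)) f"
    and sm': "smooth_map (open_submanifold N (f ` U)) (open_submanifold M U) (inv_into U f)"
    and inj: "inj_on f U"
    using U(4) unfolding diffeomorphism_def top bij_betw_def by blast+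
  have "continuous_map (subtopology (mtop N) (f ` U)) (mtop M) (inv_into U f)"
    using sm' by (simp add: smooth_map_def open_submanifold_def continuous_map_in_subtopology)
  then show thesis
    using that[OF U(1-3) inj] smooth_at_open_submanifold[OF M N U(1,3) _ sm]
      smooth_at_open_submanifold[OF N M U(3,1) _ sm'] by blast
qed

lemma local_diffeomorphism_smooth_at:
  assumes "manifold_with_corners M" "manifold_with_corners N" "local_diffeomorphism M N f"
    "p \<in> topspace (mtop M)"
  shows "smooth_at M N f p"
  using local_diffeomorphism_inverse[OF assms] by metis

text \<open>The chain rule is applied to both composites of \<open>f\<close> with its local inverse;
  each equals the identity only near the point, which is enough for differentials. The second claim
  turns the set-theoretic inverse occurring in \<open>pushforward\<close> into the differential of a
  smooth map.\<close>

lemma differential_local_inverse: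
  assumes M: "manifold_with_corners M" and N: "manifold_with_corners N"
    and U: "openin (mtop M) U" "openin (mtop N) (f ` U)" "inj_on f U"
    and f: "\<forall>q\<in>U. smooth_at M N f q" and h: "\<forall>y\<in>f ` U. smooth_at N M (inv_into U f) y"
    and p: "p \<in> U"
  shows "bij_betw (differential M N f p) (tangent_space M p) (tangent_space N (f p))"
    and "\<And>\<eta>. \<eta> \<in> tangent_space N (f p) \<Longrightarrow>
      inv_into (tangent_space M p) (differential M N f p) \<eta> = differential N M (inv_into U f) (f p) \<eta>"
proof -
  let ?h = "inv_into U f"
  let ?df = "differential M N f p" and ?dh = "differential N M ?h (f p)"
  have fp: "smooth_at M N f p" using f p by blast
  have hp: "smooth_at N M ?h (f p)" using h p by blast
  have h_f: "?h (f p) = p" using U(3) p by simp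
  have dim: "p \<in> topspace (mtop M)" "f p \<in> topspace (mtop N)" using fp unfolding smooth_at_def by blast+
  have l: "?dh (?df \<xi>) = \<xi>" if \<xi>: "\<xi> \<in> tangent_space M p" for \<xi>
  proof -
    have "differential M M (?h \<circ> f) p = differential M M id p"
      by (rule differential_cong[OF M M smooth_at_id[OF M dim(1)] U(1) p]) (use U(3) in auto)
    then show ?thesis
      using differential_comp[OF M N M fp hp \<xi>] differential_id[OF M dim(1) \<xi>] by simp
  qed
  have r: "?df (?dh \<eta>) = \<eta>" if \<eta>: "\<eta> \<in> tangent_space N (f p)" for \<eta>
  proof -
    have "differential N N (f \<circ> ?h) (f p) = differential N N id (f p)"
      by (rule differential_cong[OF N N smooth_at_id[OF N dim(2)] U(2)])
        (use p in \<open>auto simp: f_inv_into_f\<close>)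
    then show ?thesis
      using differential_comp[OF N M N hp _ \<eta>, of f] differential_id[OF N dim(2) \<eta>] fp h_f by simp
  qed
  have df: "?df \<xi> \<in> tangent_space N (f p)" if "\<xi> \<in> tangent_space M p" for \<xi>
    using differential_in_tangent_space[OF M N fp that] .
  have dh: "?dh \<eta> \<in> tangent_space M p" if "\<eta> \<in> tangent_space N (f p)" for \<eta>
    using differential_in_tangent_space[OF N M hp that] h_f by simp
  show bij: "bij_betw ?df (tangent_space M p) (tangent_space N (f p))"
    by (rule bij_betw_byWitness[of _ ?dh]) (use l r df dh in auto)
  show "inv_into (tangent_space M p) ?df \<eta> = ?dh \<eta>" if "\<eta> \<in> tangent_space N (f p)" for \<eta>
    using inv_into_f_f[OF bij_betw_imp_inj_on[OF bij] dh[OF that]] r[OF that] by simp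
qed

lemma smooth_at_imp_continuous_map:
  assumes "\<And>p. p \<in> topspace (mtop M) \<Longrightarrow> smooth_at M N f p"
  shows "continuous_map (mtop M) (mtop N) f"
  unfolding continuous_map_def
proof (intro conjI allI impI)
  show "f \<in> topspace (mtop M) \<rightarrow> topspace (mtop N)" using assms unfolding smooth_at_def by blast
  fix W assume W: "openin (mtop N) W"
  show "openin (mtop M) {x \<in> topspace (mtop M). f x \<in> W}"
  proof (subst openin_subopen, intro ballI)
    fix p assume p: "p \<in> {x \<in> topspace (mtop M). f x \<in> W}"
    then obtain U where U: "openin (mtop M) U" "p \<in> U" "continuous_map (subtopology (mtop M) U) (mtop N) f"
      using assms unfolding smooth_at_def by blast
    show "\<exists>T. openin (mtop M) T \<and> p \<in> T \<and> T \<subseteq> {x \<in> topspace (mtop M). f x \<in> W}"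
      using openin_local_vimage[OF U(1,3) W] U(2) p openin_subset[OF U(1)]
      by (intro exI[of _ "{q \<in> U. f q \<in> W}"]) auto
  qed
qed

section \<open>Groupoid algebra and the structure maps\<close>

locale etale_groupoid =
  fixes X :: "('a, 'b, 'e::real_inner) groupoid"
  assumes etale: "etale_proper_groupoid X"
begin

abbreviation "src \<equiv> gsrc X"
abbreviation "tgt \<equiv> gtgt X"
abbreviation "OT \<equiv> mtop (gobj X)"
abbreviation "MT \<equiv> mtop (gmor X)"
abbreviation "T0 \<equiv> tangent_space (gobj X)"
abbreviation "T1 \<equiv> tangent_space (gmor X)"
abbreviation "dsrc \<equiv> differential (gmor X) (gobj X) src"
abbreviation "dtgt \<equiv> differential (gmor X) (gobj X) tgt"

lemma obj: "manifold_with_corners (gobj X)" and mor: "manifold_with_corners (gmor X)"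
  and laws: "groupoid_laws X"
  and src_diffeo: "local_diffeomorphism (gmor X) (gobj X) src"
  and tgt_diffeo: "local_diffeomorphism (gmor X) (gobj X) tgt"
  using etale unfolding etale_proper_groupoid_def by blast+

lemma src_in: "z \<in> Mor X \<Longrightarrow> src z \<in> Obj X" and tgt_in: "z \<in> Mor X \<Longrightarrow> tgt z \<in> Obj X"
  using laws unfolding groupoid_laws_def by auto

lemma comp_in:
  assumes "g \<in> Mor X" "h \<in> Mor X" "src g = tgt h"
  shows "gcomp X g h \<in> Mor X" "src (gcomp X g h) = src h" "tgt (gcomp X g h) = tgt g"
  using laws assms unfolding groupoid_laws_def by blast+

lemma inv_in:
  assumes "g \<in> Mor X"
  shows "ginv X g \<in> Mor X" "src (ginv X g) = tgt g" "tgt (ginv X g) = src g"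
    "gcomp X g (ginv X g) = gid X (tgt g)" "gcomp X (ginv X g) g = gid X (src g)"
  using laws assms unfolding groupoid_laws_def by blast+

lemma assoc:
  assumes "g \<in> Mor X" "h \<in> Mor X" "k \<in> Mor X" "src g = tgt h" "src h = tgt k"
  shows "gcomp X (gcomp X g h) k = gcomp X g (gcomp X h k)"
  using laws assms unfolding groupoid_laws_def by blast

lemma unit:
  assumes "g \<in> Mor X"
  shows "gcomp X g (gid X (src g)) = g" "gcomp X (gid X (tgt g)) g = g"
  using laws assms unfolding groupoid_laws_def by blast+

lemma inv_cancel_left:
  assumes g: "g \<in> Mor X" and h: "h \<in> Mor X"
  shows "src g = tgt h \<Longrightarrow> gcomp X (ginv X g) (gcomp X g h) = h"
    and "tgt g = tgt h \<Longrightarrow> gcomp X g (gcomp X (ginv X g) h) = h"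
proof -
  note i = inv_in[OF g]
  show "gcomp X (ginv X g) (gcomp X g h) = h" if "src g = tgt h"
    using assoc[OF i(1) g h i(2) that] unfolding i(5) that unit(2)[OF h] by (rule sym)
  show "gcomp X g (gcomp X (ginv X g) h) = h" if "tgt g = tgt h"
    using assoc[OF g i(1) h i(3)[symmetric] i(2)[unfolded that]]
    unfolding i(4) that unit(2)[OF h] by (rule sym)
qed

lemma inv_cancel_right:
  assumes g: "g \<in> Mor X" and h: "h \<in> Mor X"
  shows "src h = tgt g \<Longrightarrow> gcomp X (gcomp X h g) (ginv X g) = h"
    and "src h = src g \<Longrightarrow> gcomp X (gcomp X h (ginv X g)) g = h"
proof -
  note i = inv_in[OF g]
  show "gcomp X (gcomp X h g) (ginv X g) = h" if "src h = tgt g"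
    using assoc[OF h g i(1) that i(3)[symmetric]] unfolding i(4) that[symmetric] unit(1)[OF h] .
  show "gcomp X (gcomp X h (ginv X g)) g = h" if "src h = src g"
    using assoc[OF h i(1) g that[folded i(3)] i(2)] unfolding i(5) that[symmetric] unit(1)[OF h] .
qed

lemma inv_inv: "g \<in> Mor X \<Longrightarrow> ginv X (ginv X g) = g"
  using inv_cancel_left(1)[of "ginv X g" g] unit(1)[of "ginv X (ginv X g)"] inv_in by simp

lemma inv_continuous: "continuous_map MT MT (ginv X)"
  using etale unfolding etale_proper_groupoid_def smooth_map_def by blast

lemma comp_continuous:
  "continuous_map (subtopology (prod_topology MT MT) {(g, h). src g = tgt h}) MT (\<lambda>(g, h). gcomp X g h)"
  using etale unfolding etale_proper_groupoid_def smooth_map_def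
  by (simp add: composable_def Let_def)

lemma src_smooth_at: "z \<in> Mor X \<Longrightarrow> smooth_at (gmor X) (gobj X) src z"
  and tgt_smooth_at: "z \<in> Mor X \<Longrightarrow> smooth_at (gmor X) (gobj X) tgt z"
  by (rule local_diffeomorphism_smooth_at[OF mor obj src_diffeo] local_diffeomorphism_smooth_at[OF mor obj tgt_diffeo]; assumption)+

lemma src_continuous: "continuous_map MT OT src" and tgt_continuous: "continuous_map MT OT tgt"
  using smooth_at_imp_continuous_map src_smooth_at tgt_smooth_at by blast+

lemma dsrc_bij: "z \<in> Mor X \<Longrightarrow> bij_betw (dsrc z) (T1 z) (T0 (src z))"
  and dtgt_bij: "z \<in> Mor X \<Longrightarrow> bij_betw (dtgt z) (T1 z) (T0 (tgt z))"
proof -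
  assume z: "z \<in> Mor X"
  show "bij_betw (dsrc z) (T1 z) (T0 (src z))"
    using local_diffeomorphism_inverse[OF mor obj src_diffeo z] differential_local_inverse(1)[OF mor obj]
    by metis
  show "bij_betw (dtgt z) (T1 z) (T0 (tgt z))"
    using local_diffeomorphism_inverse[OF mor obj tgt_diffeo z] differential_local_inverse(1)[OF mor obj]
    by metis
qed

abbreviation "dsrc_inv z \<equiv> inv_into (T1 z) (dsrc z)"
abbreviation "dtgt_inv z \<equiv> inv_into (T1 z) (dtgt z)"

lemma dsrc_inv:
  assumes "z \<in> Mor X" "\<eta> \<in> T0 (src z)"
  shows "dsrc_inv z \<eta> \<in> T1 z" "dsrc z (dsrc_inv z \<eta>) = \<eta>"
  using bij_betwE[OF bij_betw_inv_into[OF dsrc_bij[OF assms(1)]]] assms(2)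
    bij_betw_inv_into_right[OF dsrc_bij[OF assms(1)]] by blast+

lemma dtgt_inv:
  assumes "z \<in> Mor X" "\<eta> \<in> T0 (tgt z)"
  shows "dtgt_inv z \<eta> \<in> T1 z" "dtgt z (dtgt_inv z \<eta>) = \<eta>"
  using bij_betwE[OF bij_betw_inv_into[OF dtgt_bij[OF assms(1)]]] assms(2)
    bij_betw_inv_into_right[OF dtgt_bij[OF assms(1)]] by blast+

section \<open>Transport along morphisms\<close>

definition transport :: "'b \<Rightarrow> ('a, 'e) tvec \<Rightarrow> ('a, 'e) tvec" where
  "transport z \<eta> = dsrc z (dtgt_inv z \<eta>)"

lemma transport_in: "z \<in> Mor X \<Longrightarrow> \<eta> \<in> T0 (tgt z) \<Longrightarrow> transport z \<eta> \<in> T0 (src z)"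
  unfolding transport_def by (intro bspec[OF bij_betwE[OF dsrc_bij]] dtgt_inv)

lemma transport_dtgt: "z \<in> Mor X \<Longrightarrow> \<xi> \<in> T1 z \<Longrightarrow> transport z (dtgt z \<xi>) = dsrc z \<xi>"
  unfolding transport_def by (simp add: bij_betw_inv_into_left[OF dtgt_bij])

text \<open>The local section \<open>\<tau>\<close> of the target through \<open>z\<close> inverts
  it near \<open>z\<close>, so by the chain rule the differential of
  \<open>src \<circ> \<tau>\<close> is \<open>transport\<close> at every point of the branch, not
  just at \<open>z\<close>. The prescribed neighborhood \<open>G\<close> allows branches through
  different points to be chosen disjoint.\<close>

lemma tgt_branch:
  assumes z: "z \<in> Mor X" and G: "openin MT G" "z \<in> G"
  obtains U \<tau> where "openin MT U" "z \<in> U" "U \<subseteq> G" "openin OT (tgt ` U)"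
    "\<forall>q\<in>U. \<tau> (tgt q) = q" "continuous_map (subtopology OT (tgt ` U)) MT \<tau>"
    "\<forall>y\<in>tgt ` U. smooth_at (gobj X) (gobj X) (src \<circ> \<tau>) y"
    "\<forall>y\<in>tgt ` U. \<forall>\<eta>\<in>T0 y. differential (gobj X) (gobj X) (src \<circ> \<tau>) y \<eta> = transport (\<tau> y) \<eta>"
proof -
  obtain U where U: "openin MT U" "z \<in> U" "openin OT (tgt ` U)" "inj_on tgt U"
    "\<forall>q\<in>U. smooth_at (gmor X) (gobj X) tgt q" "\<forall>y\<in>tgt ` U. smooth_at (gobj X) (gmor X) (inv_into U tgt) y"
    "continuous_map (subtopology OT (tgt ` U)) MT (inv_into U tgt)"
    using local_diffeomorphism_inverse[OF mor obj tgt_diffeo z] .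
  let ?\<tau> = "inv_into U tgt" and ?V = "U \<inter> G"
  have \<tau>: "?\<tau> (tgt q) = q" if "q \<in> U" for q using inv_into_f_f[OF U(4) that] .
  have "tgt ` ?V = {y \<in> tgt ` U. ?\<tau> y \<in> G}" using \<tau> by auto
  then have oV: "openin OT (tgt ` ?V)" using openin_local_vimage[OF U(3,7) G(1)] by simp
  have V: "tgt ` ?V \<subseteq> tgt ` U" by blast
  show thesis
  proof (rule that[of ?V ?\<tau>])
    show "continuous_map (subtopology OT (tgt ` ?V)) MT ?\<tau>"
      by (rule continuous_map_from_subtopology_mono[OF U(7) V])
    have *: "smooth_at (gobj X) (gobj X) (src \<circ> ?\<tau>) y \<and>
        (\<forall>\<eta>\<in>T0 y. differential (gobj X) (gobj X) (src \<circ> ?\<tau>) y \<eta> = transport (?\<tau> y) \<eta>)"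
      if "y \<in> tgt ` ?V" for y
    proof -
      from that obtain q where q: "q \<in> U" "y = tgt q" by blast
      have qM: "q \<in> Mor X" using q U(1) openin_subset by blast
      have 1: "smooth_at (gobj X) (gmor X) ?\<tau> y" using U(6) q by blast
      have 2: "smooth_at (gmor X) (gobj X) src (?\<tau> y)" using src_smooth_at[OF qM] \<tau> q by simp
      have "differential (gobj X) (gobj X) (src \<circ> ?\<tau>) y \<eta> = transport (?\<tau> y) \<eta>" if "\<eta> \<in> T0 y" for \<eta>
        using differential_comp[OF obj mor obj 1 2 that]
          differential_local_inverse(2)[OF mor obj U(1,3,4,5,6) q(1)] q(2) \<tau>[OF q(1)] that
        by (simp add: transport_def)
      then show ?thesis using smooth_at_comp[OF obj mor obj 1 2] by blast
    qed
    show "\<forall>y\<in>tgt ` ?V. smooth_at (gobj X) (gobj X) (src \<circ> ?\<tau>) y" using * by blast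
    show "\<forall>y\<in>tgt ` ?V. \<forall>\<eta>\<in>T0 y. differential (gobj X) (gobj X) (src \<circ> ?\<tau>) y \<eta> = transport (?\<tau> y) \<eta>"
      using * by blast
  qed (use U G oV \<tau> in auto)
qed

text \<open>Linearity is not visible from the inverse function in \<open>transport\<close>; it is
  inherited from the differential of \<open>src \<circ> \<tau>\<close>.\<close>

lemma transport_lincomb:
  assumes z: "z \<in> Mor X" and "\<xi> \<in> T0 (tgt z)" "\<eta> \<in> T0 (tgt z)"
  shows "transport z (\<lambda>c. a *\<^sub>R \<xi> c + b *\<^sub>R \<eta> c) = (\<lambda>c. a *\<^sub>R transport z \<xi> c + b *\<^sub>R transport z \<eta> c)"
proof -
  obtain U \<tau> where U: "openin MT U" "z \<in> U" "U \<subseteq> Mor X" "openin OT (tgt ` U)"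
    "\<forall>q\<in>U. \<tau> (tgt q) = q" "continuous_map (subtopology OT (tgt ` U)) MT \<tau>"
    "\<forall>y\<in>tgt ` U. smooth_at (gobj X) (gobj X) (src \<circ> \<tau>) y"
    "\<forall>y\<in>tgt ` U. \<forall>\<eta>\<in>T0 y. differential (gobj X) (gobj X) (src \<circ> \<tau>) y \<eta> = transport (\<tau> y) \<eta>"
    using tgt_branch[OF z openin_topspace z] .
  have y: "tgt z \<in> tgt ` U" using U(2) by blast
  have D: "differential (gobj X) (gobj X) (src \<circ> \<tau>) (tgt z) \<zeta> = transport z \<zeta>" if "\<zeta> \<in> T0 (tgt z)" for \<zeta>
    using U(8) y that U(5) U(2) by simp
  have "smooth_at (gobj X) (gobj X) (src \<circ> \<tau>) (tgt z)" using U(7) y by blast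
  from differential_lincomb[OF obj obj this assms(2,3), of a b] show ?thesis
    by (simp add: D assms tangent_space_lincomb[OF obj tgt_in[OF z]])
qed

text \<open>The germ of \<open>s \<circ> t\<inverse>\<close> at a composite \<open>g \<circ> z\<close> is the composite of the germs at \<open>z\<close> and \<open>g\<close>;
  continuity of the composition suffices for this.\<close>

lemma transport_comp:
  assumes g: "g \<in> Mor X" and z: "z \<in> Mor X" and gz: "src g = tgt z" and \<eta>: "\<eta> \<in> T0 (tgt g)"
  shows "transport (gcomp X g z) \<eta> = transport z (transport g \<eta>)"
proof -
  note c = comp_in[OF g z gz]
  obtain U1 \<tau>1 where U1: "openin MT U1" "g \<in> U1" "U1 \<subseteq> Mor X" "openin OT (tgt ` U1)"
    "\<forall>q\<in>U1. \<tau>1 (tgt q) = q" "continuous_map (subtopology OT (tgt ` U1)) MT \<tau>1"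
    "\<forall>y\<in>tgt ` U1. smooth_at (gobj X) (gobj X) (src \<circ> \<tau>1) y"
    "\<forall>y\<in>tgt ` U1. \<forall>\<eta>\<in>T0 y. differential (gobj X) (gobj X) (src \<circ> \<tau>1) y \<eta> = transport (\<tau>1 y) \<eta>"
    using tgt_branch[OF g openin_topspace g] .
  obtain U2 \<tau>2 where U2: "openin MT U2" "z \<in> U2" "U2 \<subseteq> Mor X" "openin OT (tgt ` U2)"
    "\<forall>q\<in>U2. \<tau>2 (tgt q) = q" "continuous_map (subtopology OT (tgt ` U2)) MT \<tau>2"
    "\<forall>y\<in>tgt ` U2. smooth_at (gobj X) (gobj X) (src \<circ> \<tau>2) y"
    "\<forall>y\<in>tgt ` U2. \<forall>\<eta>\<in>T0 y. differential (gobj X) (gobj X) (src \<circ> \<tau>2) y \<eta> = transport (\<tau>2 y) \<eta>"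
    using tgt_branch[OF z openin_topspace z] .
  obtain U3 \<tau>3 where U3: "openin MT U3" "gcomp X g z \<in> U3" "U3 \<subseteq> Mor X" "openin OT (tgt ` U3)"
    "\<forall>q\<in>U3. \<tau>3 (tgt q) = q" "continuous_map (subtopology OT (tgt ` U3)) MT \<tau>3"
    "\<forall>y\<in>tgt ` U3. smooth_at (gobj X) (gobj X) (src \<circ> \<tau>3) y"
    "\<forall>y\<in>tgt ` U3. \<forall>\<eta>\<in>T0 y. differential (gobj X) (gobj X) (src \<circ> \<tau>3) y \<eta> = transport (\<tau>3 y) \<eta>"
    using tgt_branch[OF c(1) openin_topspace c(1)] .
  let ?y = "tgt g"
  \<comment> \<open>On \<open>?V\<close> the branch through \<open>g\<close> can be followed by the
    branch through \<open>z\<close>, and the two chosen morphisms are composable.\<close>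
  let ?V = "{y \<in> tgt ` U1. (src \<circ> \<tau>1) y \<in> tgt ` U2}"
  have c1: "continuous_map (subtopology OT (tgt ` U1)) OT (src \<circ> \<tau>1)"
    using continuous_map_compose[OF U1(6) src_continuous] .
  have oV: "openin OT ?V" by (rule openin_local_vimage[OF U1(4) c1 U2(4)])
  have yV: "?y \<in> ?V" using U1(2,5) U2(2) gz by auto
  have "?V \<subseteq> tgt ` U1" by blast
  note cV = continuous_map_from_subtopology_mono[OF c1 this]
    and c\<tau>1 = continuous_map_from_subtopology_mono[OF U1(6) this]
  have "continuous_map (subtopology OT ?V) (subtopology OT (tgt ` U2)) (src \<circ> \<tau>1)"
    using cV topspace_subtopology_openin[OF oV] by (auto simp: continuous_map_in_subtopology)
  from continuous_map_compose[OF this U2(6)]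
  have c\<tau>2: "continuous_map (subtopology OT ?V) MT (\<tau>2 \<circ> (src \<circ> \<tau>1))" .
  let ?pair = "\<lambda>y. (\<tau>1 y, \<tau>2 (src (\<tau>1 y)))"
  have comp: "\<tau>1 y \<in> Mor X" "\<tau>2 (src (\<tau>1 y)) \<in> Mor X" "src (\<tau>1 y) = tgt (\<tau>2 (src (\<tau>1 y)))" "tgt (\<tau>1 y) = y"
    if "y \<in> ?V" for y
    using that U1(3,5) U2(3,5) by auto
  have "continuous_map (subtopology OT ?V) (prod_topology MT MT) ?pair"
    using continuous_map_pairedI[OF c\<tau>1 c\<tau>2] by (simp add: comp_def)
  then have "continuous_map (subtopology OT ?V)
      (subtopology (prod_topology MT MT) {(g, h). src g = tgt h}) ?pair"
    using comp(3) topspace_subtopology_openin[OF oV] by (auto simp: continuous_map_in_subtopology)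
  from continuous_map_compose[OF this comp_continuous]
  have c3: "continuous_map (subtopology OT ?V) MT (\<lambda>y. gcomp X (\<tau>1 y) (\<tau>2 (src (\<tau>1 y))))"
    by (simp add: comp_def)
  \<comment> \<open>Here the composite of the two branches stays in \<open>U3\<close>. It has target
    \<open>y\<close>, and \<open>\<tau>3\<close> recovers any element of \<open>U3\<close> from its
    target, so the composite is \<open>\<tau>3 y\<close>; thus both germs agree on
    \<open>?W\<close>.\<close>
  let ?W = "{y \<in> ?V. gcomp X (\<tau>1 y) (\<tau>2 (src (\<tau>1 y))) \<in> U3}"
  have oW: "openin OT ?W" by (rule openin_local_vimage[OF oV c3 U3(1)])
  have yW: "?y \<in> ?W" using yV U1(2,5) U2(2,5) gz U3(2) by simp
  have eq: "((src \<circ> \<tau>2) \<circ> (src \<circ> \<tau>1)) y = (src \<circ> \<tau>3) y" if "y \<in> ?W" for y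
  proof -
    have y: "y \<in> ?V" using that by blast
    note cc = comp_in[OF comp(1-3)[OF y]]
    have "\<tau>3 y = gcomp X (\<tau>1 y) (\<tau>2 (src (\<tau>1 y)))"
      using U3(5) that cc(3) comp(4)[OF y] by force
    then show ?thesis using cc(2) by simp
  qed
  have s1: "smooth_at (gobj X) (gobj X) (src \<circ> \<tau>1) ?y" using U1 by blast
  have v1: "(src \<circ> \<tau>1) ?y = tgt z" using U1(2,5) gz by simp
  have s2: "smooth_at (gobj X) (gobj X) (src \<circ> \<tau>2) ((src \<circ> \<tau>1) ?y)" using U2(2,7) v1 by auto
  note s12 = smooth_at_comp[OF obj obj obj s1 s2]
  have d1: "differential (gobj X) (gobj X) (src \<circ> \<tau>1) ?y \<eta> = transport g \<eta>"
    using U1(8) \<eta> U1(2,5) by auto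
  have d2: "differential (gobj X) (gobj X) (src \<circ> \<tau>2) (tgt z) \<zeta> = transport z \<zeta>" if "\<zeta> \<in> T0 (tgt z)" for \<zeta>
    using U2(8) that U2(2,5) by auto
  have "?y \<in> tgt ` U3" using imageI[OF U3(2), of tgt] c(3) by simp
  moreover have "\<tau>3 ?y = gcomp X g z" using bspec[OF U3(5) U3(2)] c(3) by simp
  ultimately have d3: "differential (gobj X) (gobj X) (src \<circ> \<tau>3) ?y \<eta> = transport (gcomp X g z) \<eta>"
    using U3(8) \<eta> by auto
  have "differential (gobj X) (gobj X) (src \<circ> \<tau>3) ?y = differential (gobj X) (gobj X) ((src \<circ> \<tau>2) \<circ> (src \<circ> \<tau>1)) ?y"
    by (rule differential_cong[OF obj obj s12 oW yW eq])
  then have "transport (gcomp X g z) \<eta> =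
      differential (gobj X) (gobj X) (src \<circ> \<tau>2) (tgt z) (transport g \<eta>)"
    using d3 differential_comp[OF obj obj obj s1 s2 \<eta>] unfolding d1 v1 by (simp only:)
  also have "\<dots> = transport z (transport g \<eta>)"
    by (rule d2) (use transport_in[OF g \<eta>] gz in simp)
  finally show ?thesis .
qed

end

section \<open>Clean supports and push-forward\<close>

lemma Hausdorff_space_separate_finite:
  assumes "Hausdorff_space T" "finite F" "F \<subseteq> topspace T"
  obtains G where "\<forall>z\<in>F. openin T (G z) \<and> z \<in> G z" "\<forall>z\<in>F. \<forall>z'\<in>F. z \<noteq> z' \<longrightarrow> disjnt (G z) (G z')"
proof -
  have "\<forall>x. \<exists>P. fst x \<in> F \<and> snd x \<in> F \<and> fst x \<noteq> snd x \<longrightarrow> openin T (fst P) \<and> openin T (snd P) \<and>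
      fst x \<in> fst P \<and> snd x \<in> snd P \<and> disjnt (fst P) (snd P)"
  proof
    fix x
    have "\<exists>U V. openin T U \<and> openin T V \<and> fst x \<in> U \<and> snd x \<in> V \<and> disjnt U V"
      if "fst x \<in> F" "snd x \<in> F" "fst x \<noteq> snd x"
      using assms(1,3) that unfolding Hausdorff_space_def by blast
    then show "\<exists>P. fst x \<in> F \<and> snd x \<in> F \<and> fst x \<noteq> snd x \<longrightarrow> openin T (fst P) \<and> openin T (snd P) \<and>
        fst x \<in> fst P \<and> snd x \<in> snd P \<and> disjnt (fst P) (snd P)"
      by simp
  qed
  from choice[OF this] obtain P where P: "\<forall>x. fst x \<in> F \<and> snd x \<in> F \<and> fst x \<noteq> snd x \<longrightarrow>
      openin T (fst (P x)) \<and> openin T (snd (P x)) \<and> fst x \<in> fst (P x) \<and> snd x \<in> snd (P x) \<and>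
      disjnt (fst (P x)) (snd (P x))" ..
  define A where "A z z' = fst (P (z, z'))" for z z'
  define B where "B z z' = snd (P (z, z'))" for z z'
  have AB: "openin T (A z z') \<and> openin T (B z z') \<and> z \<in> A z z' \<and> z' \<in> B z z' \<and> disjnt (A z z') (B z z')"
    if "z \<in> F" "z' \<in> F" "z \<noteq> z'" for z z'
    using P[THEN spec, of "(z, z')"] that unfolding A_def B_def by simp
  \<comment> \<open>Separating neighborhoods are chosen per ordered pair, so \<open>G z\<close>
    intersects those in which \<open>z\<close> comes first with those in which it comes second.
    Intersecting with the whole space handles a singleton \<open>F\<close>, where no pair
    exists.\<close>
  define G where "G z = (\<Inter>z'\<in>F - {z}. A z z' \<inter> B z' z) \<inter> topspace T" for z
  show thesis
  proof (rule that[of G]; intro ballI impI conjI)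
    fix z assume z: "z \<in> F"
    show "openin T (G z)" unfolding G_def using AB z assms(2) by (intro openin_INT) auto
    show "z \<in> G z" unfolding G_def using AB z assms(3) by blast
    fix z' assume "z' \<in> F" "z \<noteq> z'"
    then have "G z \<subseteq> A z z'" "G z' \<subseteq> B z z'" "disjnt (A z z') (B z z')"
      using AB z unfolding G_def by blast+
    then show "disjnt (G z) (G z')" unfolding disjnt_def by blast
  qed
qed

lemma closedin_support: "closedin (mtop M) (support M \<omega>)"
  by (simp add: support_def)

lemma in_support: "p \<in> topspace (mtop M) \<Longrightarrow> \<omega> p \<noteq> (\<lambda>_. 0) \<Longrightarrow> p \<in> support M \<omega>"
  using closure_of_subset[of "{p \<in> topspace (mtop M). \<omega> p \<noteq> (\<lambda>_. 0)}" "mtop M"]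
  unfolding support_def by blast

lemma support_minimal:
  assumes "closedin (mtop M) C" "\<And>p. p \<in> topspace (mtop M) \<Longrightarrow> \<omega> p \<noteq> (\<lambda>_. 0) \<Longrightarrow> p \<in> C"
  shows "support M \<omega> \<subseteq> C"
  unfolding support_def by (rule closure_of_minimal) (use assms in auto)

context etale_groupoid
begin

section \<open>Clean sets and finiteness of fibers\<close>

text \<open>A proper map is a closed map with compact fibers. The fibers are rewritten as compact
  sets of \<open>MT\<close> itself, which removes the subtopology from the second condition.\<close>

lemma clean_obj_iff:
  "clean_obj X C \<longleftrightarrow> C \<subseteq> Obj X \<and>
     (\<forall>K. closedin (subtopology MT {z \<in> Mor X. src z \<in> C}) K \<longrightarrow> closedin OT (tgt ` K)) \<and>
     (\<forall>y\<in>Obj X. compactin MT {z \<in> Mor X. src z \<in> C \<and> tgt z = y})"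
proof -
  have "{z \<in> topspace (subtopology MT {z \<in> Mor X. src z \<in> C}). tgt z = y} =
      {z \<in> Mor X. src z \<in> C \<and> tgt z = y}" for y by auto
  then show ?thesis
    unfolding clean_obj_def proper_map_def closed_map_def compactin_subtopology by auto
qed

text \<open>Since \<open>D\<close> is closed, its source preimage is closed in \<open>MT\<close>.
  Relatively closed subsets of that preimage are therefore closed, and its target fibers are closed
  parts of compact ones.\<close>

lemma clean_obj_subset:
  assumes C: "clean_obj X C" and D: "D \<subseteq> C" "closedin OT D"
  shows "clean_obj X D"
  unfolding clean_obj_iff
proof (intro conjI allI impI ballI)
  have cl: "closedin MT {z \<in> Mor X. src z \<in> D}"
    by (rule closedin_continuous_map_preimage[OF src_continuous D(2)])
  show "D \<subseteq> Obj X" using closedin_subset[OF D(2)] .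
  fix K assume "closedin (subtopology MT {z \<in> Mor X. src z \<in> D}) K"
  then have "closedin MT K" "K \<subseteq> {z \<in> Mor X. src z \<in> D}"
    using cl closedin_closed_subtopology by blast+
  then have "closedin (subtopology MT {z \<in> Mor X. src z \<in> C}) K"
    using D(1) by (intro closedin_subset_topspace) auto
  then show "closedin OT (tgt ` K)" using C unfolding clean_obj_iff by blast
next
  fix y assume "y \<in> Obj X"
  then have "compactin MT {z \<in> Mor X. src z \<in> C \<and> tgt z = y}" using C unfolding clean_obj_iff by blast
  moreover have "closedin MT {z \<in> Mor X. src z \<in> D}"
    by (rule closedin_continuous_map_preimage[OF src_continuous D(2)])
  ultimately have "compactin MT ({z \<in> Mor X. src z \<in> D} \<inter> {z \<in> Mor X. src z \<in> C \<and> tgt z = y})"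
    by (intro closed_Int_compactin)
  moreover have "{z \<in> Mor X. src z \<in> D} \<inter> {z \<in> Mor X. src z \<in> C \<and> tgt z = y} =
      {z \<in> Mor X. src z \<in> D \<and> tgt z = y}" using D(1) by blast
  ultimately show "compactin MT {z \<in> Mor X. src z \<in> D \<and> tgt z = y}" by simp
qed

text \<open>The sets need not be closed, so \<open>K\<close> is split by intersecting it with the
  source preimages of \<open>C\<close> and \<open>D\<close>; each piece is relatively closed in its
  own preimage, and its target image is closed by cleanness of the respective set.\<close>

lemma clean_obj_Un:
  assumes C: "clean_obj X C" and D: "clean_obj X D"
  shows "clean_obj X (C \<union> D)"
  unfolding clean_obj_iff
proof (intro conjI allI impI ballI)
  show "C \<union> D \<subseteq> Obj X" using C D unfolding clean_obj_iff by blast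
  fix K assume K: "closedin (subtopology MT {z \<in> Mor X. src z \<in> C \<union> D}) K"
  have *: "closedin OT (tgt ` (K \<inter> {z \<in> Mor X. src z \<in> E}))" if "clean_obj X E" "E \<subseteq> C \<union> D" for E
  proof -
    obtain L where "closedin MT L" "K = L \<inter> {z \<in> Mor X. src z \<in> C \<union> D}"
      using K unfolding closedin_subtopology by blast
    then have "closedin (subtopology MT {z \<in> Mor X. src z \<in> E}) (K \<inter> {z \<in> Mor X. src z \<in> E})"
      using that(2) unfolding closedin_subtopology by (intro exI[of _ L]) auto
    then show ?thesis using that(1) unfolding clean_obj_iff by blast
  qed
  have "K \<subseteq> {z \<in> Mor X. src z \<in> C \<union> D}" using closedin_subset[OF K] by auto
  then have "tgt ` K = tgt ` (K \<inter> {z \<in> Mor X. src z \<in> C}) \<union> tgt ` (K \<inter> {z \<in> Mor X. src z \<in> D})" by blast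
  then show "closedin OT (tgt ` K)" using *[OF C] *[OF D] by auto
next
  fix y assume y: "y \<in> Obj X"
  have "{z \<in> Mor X. src z \<in> C \<union> D \<and> tgt z = y} =
      {z \<in> Mor X. src z \<in> C \<and> tgt z = y} \<union> {z \<in> Mor X. src z \<in> D \<and> tgt z = y}" by blast
  moreover have "compactin MT {z \<in> Mor X. src z \<in> C \<and> tgt z = y}"
    "compactin MT {z \<in> Mor X. src z \<in> D \<and> tgt z = y}"
    using C D y unfolding clean_obj_iff by blast+
  ultimately show "compactin MT {z \<in> Mor X. src z \<in> C \<union> D \<and> tgt z = y}"
    by (simp only: compactin_Un)
qed

lemma clean_obj_empty: "clean_obj X {}"
proof -
  have "K = {}" if "closedin (subtopology MT {}) K" for K using closedin_subset[OF that] by simp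
  then show ?thesis unfolding clean_obj_iff by auto
qed

lemma clean_obj_closed_tgt:
  assumes "clean_obj X C" "closedin MT K" "src ` K \<subseteq> C"
  shows "closedin OT (tgt ` K)"
proof -
  have "closedin (subtopology MT {z \<in> Mor X. src z \<in> C}) K"
    using assms(2,3) closedin_subset by (intro closedin_subset_topspace) blast+
  then show ?thesis using assms(1) unfolding clean_obj_iff by blast
qed

text \<open>Inversion exchanges source and target and carries closed sets to closed sets. This gives
  the part of the symmetry of cleanness that is needed below.\<close>

lemma clean_obj_closed_src:
  assumes "clean_obj X C" "closedin MT K" "tgt ` K \<subseteq> C"
  shows "closedin OT (src ` K)"
proof -
  have K: "K \<subseteq> Mor X" by (rule closedin_subset[OF assms(2)])
  let ?L = "{g \<in> Mor X. ginv X g \<in> K}"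
  have L: "?L = ginv X ` K"
  proof (intro equalityI subsetI)
    fix g assume "g \<in> ?L"
    then show "g \<in> ginv X ` K" using inv_inv[of g] by (metis (lifting) imageI mem_Collect_eq)
  qed (use K inv_inv inv_in(1) in auto)
  have "closedin MT ?L" by (rule closedin_continuous_map_preimage[OF inv_continuous assms(2)])
  moreover have "src ` ?L \<subseteq> C" unfolding L using K inv_in(2) assms(3) by auto
  moreover have "tgt ` ?L = src ` K" unfolding L image_image using K inv_in(3) by (intro image_cong) auto
  ultimately show ?thesis using clean_obj_closed_tgt[OF assms(1)] by metis
qed

text \<open>The fiber is compact and discrete: around each of its points the target map is injective
  on an open set, which can contain only one point of the fiber. Finitely many such sets cover
  it.\<close>

lemma clean_obj_finite_tgt_fiber:
  assumes C: "clean_obj X C"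
  shows "finite {z \<in> Mor X. tgt z = y \<and> src z \<in> C}"
proof (cases "y \<in> Obj X")
  case True
  let ?F = "{z \<in> Mor X. src z \<in> C \<and> tgt z = y}"
  have comp: "compactin MT ?F" using C True unfolding clean_obj_iff by blast
  have "\<forall>z\<in>?F. \<exists>U. openin MT U \<and> z \<in> U \<and> inj_on tgt U"
  proof
    fix z assume "z \<in> ?F"
    then have z: "z \<in> Mor X" by blast
    obtain U where "openin MT U" "z \<in> U" "openin OT (tgt ` U)" "inj_on tgt U"
      "\<forall>q\<in>U. smooth_at (gmor X) (gobj X) tgt q"
      "\<forall>y\<in>tgt ` U. smooth_at (gobj X) (gmor X) (inv_into U tgt) y"
      "continuous_map (subtopology OT (tgt ` U)) MT (inv_into U tgt)"
      using local_diffeomorphism_inverse[OF mor obj tgt_diffeo z] .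
    then show "\<exists>U. openin MT U \<and> z \<in> U \<and> inj_on tgt U" by (intro exI[of _ U] conjI)
  qed
  from bchoice[OF this] obtain U where "\<forall>z\<in>?F. openin MT (U z) \<and> z \<in> U z \<and> inj_on tgt (U z)" ..
  note U = bspec[OF this]
  have "\<exists>\<F>. finite \<F> \<and> \<F> \<subseteq> U ` ?F \<and> ?F \<subseteq> \<Union>\<F>"
    using comp U unfolding compactin_def by (elim conjE allE[of _ "U ` ?F"]) blast
  then obtain \<F> where F: "finite \<F>" "\<F> \<subseteq> U ` ?F" "?F \<subseteq> \<Union>\<F>" by blast
  have "finite (?F \<inter> V)" if "V \<in> \<F>" for V
  proof -
    obtain z where z: "z \<in> ?F" "V = U z" using F(2) \<open>V \<in> \<F>\<close> by blast
    have "?F \<inter> V \<subseteq> {z}"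
    proof
      fix w assume w: "w \<in> ?F \<inter> V"
      have "inj_on tgt V" "z \<in> V" using U[OF z(1)] z(2) by auto
      moreover have "tgt w = tgt z" "w \<in> V" using w z(1) by auto
      ultimately show "w \<in> {z}" using inj_onD[of tgt V w z] by simp
    qed
    then show ?thesis using finite_subset by blast
  qed
  then have "finite (\<Union>V\<in>\<F>. ?F \<inter> V)" using F(1) by blast
  moreover have "?F \<subseteq> (\<Union>V\<in>\<F>. ?F \<inter> V)" using F(3) by blast
  ultimately have "finite ?F" by (rule rev_finite_subset)
  then show ?thesis by (simp add: conj_commute)
next
  case False
  then have "{z \<in> Mor X. tgt z = y \<and> src z \<in> C} = {}" using tgt_in by auto
  then show ?thesis by (metis finite.emptyI)
qed

lemma clean_obj_finite_src_fiber:
  assumes C: "clean_obj X C"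
  shows "finite {z \<in> Mor X. src z = x \<and> tgt z \<in> C}"
proof (rule finite_subset)
  show "finite (ginv X ` {z \<in> Mor X. tgt z = x \<and> src z \<in> C})"
    using clean_obj_finite_tgt_fiber[OF C] by blast
  show "{z \<in> Mor X. src z = x \<and> tgt z \<in> C} \<subseteq> ginv X ` {z \<in> Mor X. tgt z = x \<and> src z \<in> C}"
  proof
    fix z assume z: "z \<in> {z \<in> Mor X. src z = x \<and> tgt z \<in> C}"
    then have "z = ginv X (ginv X z)" "ginv X z \<in> {z \<in> Mor X. tgt z = x \<and> src z \<in> C}"
      using inv_inv inv_in by auto
    then show "z \<in> ginv X ` {z \<in> Mor X. tgt z = x \<and> src z \<in> C}" by blast
  qed
qed

text \<open>Cleanness passes only to closed subsets, and the images of \<open>D\<close> are not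
  closed for free: the source image is closed because the targets lie in a clean set, and vice
  versa.\<close>

lemma clean_mor_subset:
  assumes C: "clean_mor X C" and D: "closedin MT D" "D \<subseteq> C"
  shows "clean_mor X D"
proof -
  have cC: "clean_obj X (src ` C)" "clean_obj X (tgt ` C)" using C unfolding clean_mor_def by blast+
  have "closedin OT (src ` D)" by (rule clean_obj_closed_src[OF cC(2) D(1)]) (use D(2) in blast)
  moreover have "closedin OT (tgt ` D)" by (rule clean_obj_closed_tgt[OF cC(1) D(1)]) (use D(2) in blast)
  ultimately show ?thesis
    unfolding clean_mor_def
    by (intro conjI D(1) clean_obj_subset[OF cC(1)] clean_obj_subset[OF cC(2)] image_mono D(2))
qed

lemma clean_mor_Un: "clean_mor X C \<Longrightarrow> clean_mor X D \<Longrightarrow> clean_mor X (C \<union> D)"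
  unfolding clean_mor_def image_Un by (intro conjI closedin_Un clean_obj_Un; blast)

lemma finite_src_fiber:
  assumes \<beta>: "\<beta> \<in> clean_forms_mor X"
  shows "finite {w \<in> Mor X. src w = x \<and> \<beta> w \<noteq> (\<lambda>_. 0)}"
proof (rule finite_subset)
  show "finite {w \<in> Mor X. src w = x \<and> tgt w \<in> tgt ` support (gmor X) \<beta>}"
    by (rule clean_obj_finite_src_fiber) (use \<beta> in \<open>auto simp: clean_forms_mor_def clean_mor_def\<close>)
  show "{w \<in> Mor X. src w = x \<and> \<beta> w \<noteq> (\<lambda>_. 0)} \<subseteq> {w \<in> Mor X. src w = x \<and> tgt w \<in> tgt ` support (gmor X) \<beta>}"
    using in_support[of _ "gmor X" \<beta>] by blast
qed

lemma finite_tgt_fiber: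
  assumes \<beta>: "\<beta> \<in> clean_forms_mor X"
  shows "finite {w \<in> Mor X. tgt w = x \<and> \<beta> w \<noteq> (\<lambda>_. 0)}"
proof (rule finite_subset)
  show "finite {w \<in> Mor X. tgt w = x \<and> src w \<in> src ` support (gmor X) \<beta>}"
    by (rule clean_obj_finite_tgt_fiber) (use \<beta> in \<open>auto simp: clean_forms_mor_def clean_mor_def\<close>)
  show "{w \<in> Mor X. tgt w = x \<and> \<beta> w \<noteq> (\<lambda>_. 0)} \<subseteq> {w \<in> Mor X. tgt w = x \<and> src w \<in> src ` support (gmor X) \<beta>}"
    using in_support[of _ "gmor X" \<beta>] by blast
qed

section \<open>Pulling back along the source and pushing forward along the target\<close>

lemma obj_form_outside: "\<alpha> \<in> forms (gobj X) \<Longrightarrow> p \<in> Obj X \<Longrightarrow> \<not> set \<xi>s \<subseteq> T0 p \<Longrightarrow> \<alpha> p \<xi>s = 0"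
  unfolding forms_iff[OF obj] alternating_on_def by blast

text \<open>The differential of the source map is bijective on tangent spaces, so every list of
  tangent vectors at \<open>src z\<close> is hit, and forms vanish on all other lists. The index set
  of the push-forward can hence be described by values of \<alpha>.\<close>

lemma src_pull_zero_iff:
  assumes \<alpha>: "\<alpha> \<in> forms (gobj X)" and z: "z \<in> Mor X"
  shows "src_pull X \<alpha> z = (\<lambda>_. 0) \<longleftrightarrow> \<alpha> (src z) = (\<lambda>_. 0)"
proof
  assume *: "src_pull X \<alpha> z = (\<lambda>_. 0)"
  show "\<alpha> (src z) = (\<lambda>_. 0)"
  proof
    fix \<eta>s
    show "\<alpha> (src z) \<eta>s = 0"
    proof (cases "set \<eta>s \<subseteq> T0 (src z)")
      case True
      let ?\<xi>s = "map (dsrc_inv z) \<eta>s"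
      have "set ?\<xi>s \<subseteq> T1 z" using dsrc_inv(1)[OF z] True by auto
      moreover have "map (dsrc z) ?\<xi>s = \<eta>s" using dsrc_inv(2)[OF z] True by (auto intro!: map_idI)
      ultimately show ?thesis using fun_cong[OF *, of ?\<xi>s] z unfolding pullback_def by simp
    next
      case False
      then show ?thesis using obj_form_outside[OF \<alpha> src_in[OF z]] by blast
    qed
  qed
qed (simp add: pullback_def fun_eq_iff)

lemma tgt_push_src_pull:
  assumes \<alpha>: "\<alpha> \<in> forms (gobj X)" and y: "y \<in> Obj X" and \<eta>s: "set \<eta>s \<subseteq> T0 y"
  shows "tgt_push X (src_pull X \<alpha>) y \<eta>s =
    (\<Sum>z | z \<in> Mor X \<and> tgt z = y \<and> \<alpha> (src z) \<noteq> (\<lambda>_. 0). \<alpha> (src z) (map (transport z) \<eta>s))"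
proof -
  have set_eq: "{z \<in> Mor X. tgt z = y \<and> src_pull X \<alpha> z \<noteq> (\<lambda>_. 0)} =
      {z. z \<in> Mor X \<and> tgt z = y \<and> \<alpha> (src z) \<noteq> (\<lambda>_. 0)}"
    using src_pull_zero_iff[OF \<alpha>] by blast
  have "src_pull X \<alpha> z (map (dtgt_inv z) \<eta>s) = \<alpha> (src z) (map (transport z) \<eta>s)"
    if "z \<in> Mor X" "tgt z = y" for z
  proof -
    have "set (map (dtgt_inv z) \<eta>s) \<subseteq> T1 z" using dtgt_inv(1)[OF that(1)] that(2) \<eta>s by auto
    then show ?thesis using that(1) by (simp add: pullback_def transport_def[abs_def] comp_def)
  qed
  then show ?thesis
    using y \<eta>s unfolding pushforward_def set_eq by (auto intro!: sum.cong)
qed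

text \<open>Extra indices contribute zero terms. The freedom in \<open>S\<close> lets sums for
  different forms, or over nearby points, share one index set.\<close>

lemma tgt_push_src_pull_finite:
  assumes \<alpha>: "\<alpha> \<in> forms (gobj X)" and y: "y \<in> Obj X" and \<eta>s: "set \<eta>s \<subseteq> T0 y"
    and S: "finite S" "S \<subseteq> {z \<in> Mor X. tgt z = y}" 
      "\<And>z. z \<in> Mor X \<Longrightarrow> tgt z = y \<Longrightarrow> \<alpha> (src z) \<noteq> (\<lambda>_. 0) \<Longrightarrow> z \<in> S"
  shows "tgt_push X (src_pull X \<alpha>) y \<eta>s = (\<Sum>z\<in>S. \<alpha> (src z) (map (transport z) \<eta>s))"
  unfolding tgt_push_src_pull[OF \<alpha> y \<eta>s]
  by (rule sum.mono_neutral_left) (use S in auto)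

text \<open>Local triviality of a proper local homeomorphism, for the target map on morphisms with
  source in \<open>C\<close>. Near \<open>y0\<close> the disjoint branches through the finite fiber
  exhaust these morphisms. Only an inclusion holds: along a branch the source may leave
  \<open>C\<close>, since \<open>C\<close> is not open in general.\<close>

lemma tgt_sheets:
  assumes C: "clean_obj X C" and y0: "y0 \<in> Obj X"
  obtains F :: "'b set" and V \<tau> where "finite F" "openin OT V" "y0 \<in> V"
    "\<forall>z\<in>F. \<forall>y\<in>V. \<tau> z y \<in> Mor X \<and> tgt (\<tau> z y) = y"
    "\<forall>y\<in>V. inj_on (\<lambda>z. \<tau> z y) F"
    "\<forall>y\<in>V. {z \<in> Mor X. tgt z = y \<and> src z \<in> C} \<subseteq> (\<lambda>z. \<tau> z y) ` F"
    "\<forall>z\<in>F. \<forall>y\<in>V. smooth_at (gobj X) (gobj X) (src \<circ> \<tau> z) y"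
    "\<forall>z\<in>F. \<forall>y\<in>V. \<forall>\<eta>\<in>T0 y. differential (gobj X) (gobj X) (src \<circ> \<tau> z) y \<eta> = transport (\<tau> z y) \<eta>"
proof -
  define F where "F = {z \<in> Mor X. tgt z = y0 \<and> src z \<in> C}"
  have F: "finite F" "F \<subseteq> Mor X" unfolding F_def using clean_obj_finite_tgt_fiber[OF C] by auto
  have H: "Hausdorff_space MT" using mor unfolding manifold_with_corners_def by blast
  obtain G where G: "\<forall>z\<in>F. openin MT (G z) \<and> z \<in> G z"
      "\<forall>z\<in>F. \<forall>z'\<in>F. z \<noteq> z' \<longrightarrow> disjnt (G z) (G z')"
    using Hausdorff_space_separate_finite[OF H F] .
  have "\<forall>z\<in>F. \<exists>U \<tau>. openin MT U \<and> z \<in> U \<and> U \<subseteq> G z \<and> openin OT (tgt ` U) \<and> (\<forall>q\<in>U. \<tau> (tgt q) = q) \<and>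
      (\<forall>y\<in>tgt ` U. smooth_at (gobj X) (gobj X) (src \<circ> \<tau>) y) \<and>
      (\<forall>y\<in>tgt ` U. \<forall>\<eta>\<in>T0 y. differential (gobj X) (gobj X) (src \<circ> \<tau>) y \<eta> = transport (\<tau> y) \<eta>)"
  proof
    fix z assume z: "z \<in> F"
    have zM: "z \<in> Mor X" using z F(2) by blast
    have zG: "openin MT (G z)" "z \<in> G z" using G(1) z by blast+
    obtain U \<tau> where "openin MT U" "z \<in> U" "U \<subseteq> G z" "openin OT (tgt ` U)"
      "\<forall>q\<in>U. \<tau> (tgt q) = q" "continuous_map (subtopology OT (tgt ` U)) MT \<tau>"
      "\<forall>y\<in>tgt ` U. smooth_at (gobj X) (gobj X) (src \<circ> \<tau>) y"
      "\<forall>y\<in>tgt ` U. \<forall>\<eta>\<in>T0 y. differential (gobj X) (gobj X) (src \<circ> \<tau>) y \<eta> = transport (\<tau> y) \<eta>"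
      using tgt_branch[OF zM zG] .
    then show "\<exists>U \<tau>. openin MT U \<and> z \<in> U \<and> U \<subseteq> G z \<and> openin OT (tgt ` U) \<and> (\<forall>q\<in>U. \<tau> (tgt q) = q) \<and>
      (\<forall>y\<in>tgt ` U. smooth_at (gobj X) (gobj X) (src \<circ> \<tau>) y) \<and>
      (\<forall>y\<in>tgt ` U. \<forall>\<eta>\<in>T0 y. differential (gobj X) (gobj X) (src \<circ> \<tau>) y \<eta> = transport (\<tau> y) \<eta>)"
      by (intro exI[of _ U] exI[of _ \<tau>] conjI)
  qed
  from bchoice[OF this] obtain U where "\<forall>z\<in>F. \<exists>\<tau>. openin MT (U z) \<and> z \<in> U z \<and> U z \<subseteq> G z \<and> openin OT (tgt ` U z) \<and> (\<forall>q\<in>U z. \<tau> (tgt q) = q) \<and>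
      (\<forall>y\<in>tgt ` U z. smooth_at (gobj X) (gobj X) (src \<circ> \<tau>) y) \<and>
      (\<forall>y\<in>tgt ` U z. \<forall>\<eta>\<in>T0 y. differential (gobj X) (gobj X) (src \<circ> \<tau>) y \<eta> = transport (\<tau> y) \<eta>)" ..
  from bchoice[OF this] obtain \<tau> where "\<forall>z\<in>F. openin MT (U z) \<and> z \<in> U z \<and> U z \<subseteq> G z \<and> openin OT (tgt ` U z) \<and> (\<forall>q\<in>U z. \<tau> z (tgt q) = q) \<and>
      (\<forall>y\<in>tgt ` U z. smooth_at (gobj X) (gobj X) (src \<circ> \<tau> z) y) \<and>
      (\<forall>y\<in>tgt ` U z. \<forall>\<eta>\<in>T0 y. differential (gobj X) (gobj X) (src \<circ> \<tau> z) y \<eta> = transport (\<tau> z y) \<eta>)" ..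
  note * = bspec[OF this]
  note U = *[THEN conjunct1] *[THEN conjunct2, THEN conjunct1] *[THEN conjunct2, THEN conjunct2, THEN conjunct1]
    *[THEN conjunct2, THEN conjunct2, THEN conjunct2, THEN conjunct1]
    *[THEN conjunct2, THEN conjunct2, THEN conjunct2, THEN conjunct2, THEN conjunct1, rule_format]
    *[THEN conjunct2, THEN conjunct2, THEN conjunct2, THEN conjunct2, THEN conjunct2, THEN conjunct1, rule_format]
    *[THEN conjunct2, THEN conjunct2, THEN conjunct2, THEN conjunct2, THEN conjunct2, THEN conjunct2, rule_format]
  let ?S = "{z \<in> Mor X. src z \<in> C}"
  \<comment> \<open>The morphisms over \<open>C\<close> missed by all branches form a relatively
    closed set, so their targets form a closed set. It avoids \<open>y0\<close>, because every
    morphism over \<open>C\<close> with target \<open>y0\<close> lies in \<open>F\<close> and hence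
    in its own branch; removing it yields \<open>V\<close>.\<close>
  let ?R = "?S - (\<Union>z\<in>F. U z)"
  have "openin MT (\<Union>z\<in>F. U z)" using U(1) by blast
  then have "closedin MT (Mor X - (\<Union>z\<in>F. U z))" by (intro closedin_diff closedin_topspace)
  moreover have "?R = (Mor X - (\<Union>z\<in>F. U z)) \<inter> ?S" by blast
  ultimately have "closedin (subtopology MT ?S) ?R" unfolding closedin_subtopology by blast
  then have R: "closedin OT (tgt ` ?R)" using C unfolding clean_obj_iff by blast
  \<comment> \<open>The factor \<open>Obj X\<close> in the first bracket keeps the intersection open
    in the empty case, where no branch passes over \<open>y0\<close>.\<close>
  define V where "V = ((\<Inter>z\<in>F. tgt ` U z) \<inter> Obj X) \<inter> (Obj X - tgt ` ?R)"
  have oV: "openin OT V" unfolding V_def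
    using R U(4) F(1) by (intro openin_Int openin_INT) (auto simp: closedin_def)
  have VU: "y \<in> tgt ` U z" if "y \<in> V" "z \<in> F" for y z using that unfolding V_def by blast
  have tgt_F: "tgt z = y0" if "z \<in> F" for z using that unfolding F_def by blast
  have yV: "y0 \<in> V"
  proof -
    have "y0 \<in> tgt ` U z" if "z \<in> F" for z using imageI[OF U(2)[OF that], of tgt] tgt_F[OF that] by simp
    moreover have "y0 \<notin> tgt ` ?R"
    proof
      assume "y0 \<in> tgt ` ?R"
      then obtain z where "z \<in> ?S" "z \<notin> (\<Union>z\<in>F. U z)" "tgt z = y0" by blast
      then show False using U(2) unfolding F_def by blast
    qed
    ultimately show ?thesis unfolding V_def using y0 by blast
  qed
  have \<tau>: "\<tau> z y \<in> U z \<and> tgt (\<tau> z y) = y" if "z \<in> F" "y \<in> V" for z y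
  proof -
    from VU[OF that(2,1)] obtain q where "q \<in> U z" "y = tgt q" by blast
    then show ?thesis using U(5)[OF that(1)] by simp
  qed
  show thesis
  proof (rule that[of F V \<tau>, OF F(1) oV yV]; intro ballI subsetI)
    fix z y assume "z \<in> F" "y \<in> V"
    then show "\<tau> z y \<in> Mor X \<and> tgt (\<tau> z y) = y" using \<tau> openin_subset[OF U(1)] by blast
  next
    fix y assume y: "y \<in> V"
    show "inj_on (\<lambda>z. \<tau> z y) F"
    proof (rule inj_onI, rule ccontr)
      fix z z' assume z: "z \<in> F" "z' \<in> F" "\<tau> z y = \<tau> z' y" "z \<noteq> z'"
      then have "\<tau> z y \<in> G z" "\<tau> z y \<in> G z'" using \<tau>[OF _ y] U(3) by (metis subsetD)+
      then show False using G(2) z unfolding disjnt_def by blast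
    qed
  next
    fix y z assume y: "y \<in> V" and z: "z \<in> {z \<in> Mor X. tgt z = y \<and> src z \<in> C}"
    then have "z \<notin> ?R" unfolding V_def by blast
    then obtain z' where "z' \<in> F" "z \<in> U z'" using z by blast
    moreover from this have "\<tau> z' y = z" using U(5) z by blast
    ultimately show "z \<in> (\<lambda>z. \<tau> z y) ` F" by blast
  next
    fix z y assume zy: "z \<in> F" "y \<in> V"
    show "smooth_at (gobj X) (gobj X) (src \<circ> \<tau> z) y" by (rule U(6)[OF zy(1) VU[OF zy(2,1)]])
    fix \<eta> assume "\<eta> \<in> T0 y"
    then show "differential (gobj X) (gobj X) (src \<circ> \<tau> z) y \<eta> = transport (\<tau> z y) \<eta>"
      by (rule U(7)[OF zy(1) VU[OF zy(2,1)]])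
  qed
qed

text \<open>Near any point the form is a finite sum of pullbacks of \<alpha> along the smooth maps
  \<open>src \<circ> \<tau> z\<close> given by the sheets over the clean support. At a single point
  it is a sum of alternating maps composed with \<open>transport\<close>.\<close>

lemma J_in_forms:
  assumes \<alpha>: "\<alpha> \<in> clean_forms_obj X"
  shows "tgt_push X (src_pull X \<alpha>) \<in> forms (gobj X)"
  unfolding forms_iff[OF obj]
proof (intro conjI ballI allI impI)
  let ?J = "tgt_push X (src_pull X \<alpha>)"
  have \<alpha>f: "\<alpha> \<in> forms (gobj X)" and C: "clean_obj X (support (gobj X) \<alpha>)"
    using \<alpha> unfolding clean_forms_obj_def by blast+
  {
    fix y assume y: "y \<in> Obj X"
    let ?S = "{z. z \<in> Mor X \<and> tgt z = y \<and> \<alpha> (src z) \<noteq> (\<lambda>_. 0)}"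
    have "?J y = (\<lambda>\<eta>s. \<Sum>z\<in>?S. if set \<eta>s \<subseteq> T0 y then \<alpha> (src z) (map (transport z) \<eta>s) else 0)"
    proof
      fix \<eta>s
      show "?J y \<eta>s = (\<Sum>z\<in>?S. if set \<eta>s \<subseteq> T0 y then \<alpha> (src z) (map (transport z) \<eta>s) else 0)"
        using tgt_push_src_pull[OF \<alpha>f y] by (cases "set \<eta>s \<subseteq> T0 y") (simp_all add: pushforward_def)
    qed
    moreover have "alternating_on (T0 y) \<dots>"
    proof (rule alternating_on_sum)
      fix z assume z: "z \<in> ?S"
      then have "alternating_on (T0 (src z)) (\<alpha> (src z))" using \<alpha>f src_in by (simp add: forms_iff[OF obj])
      then show "alternating_on (T0 y) (\<lambda>\<eta>s. if set \<eta>s \<subseteq> T0 y then \<alpha> (src z) (map (transport z) \<eta>s) else 0)"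
      proof (rule alternating_on_compose)
        show "transport z \<eta> \<in> T0 (src z)" if "\<eta> \<in> T0 y" for \<eta> using transport_in z that by blast
        fix \<xi> \<eta> a b assume t: "\<xi> \<in> T0 y" "\<eta> \<in> T0 y"
        show "(\<lambda>c. a *\<^sub>R \<xi> c + b *\<^sub>R \<eta> c) \<in> T0 y" by (rule tangent_space_lincomb[OF obj y t])
        show "transport z (\<lambda>c. a *\<^sub>R \<xi> c + b *\<^sub>R \<eta> c) = (\<lambda>c. a *\<^sub>R transport z \<xi> c + b *\<^sub>R transport z \<eta> c)"
          using transport_lincomb z t by blast
      qed
    qed
    ultimately show "alternating_on (T0 y) (?J y)" by simp
  }
  show "?J p = (\<lambda>_. 0)" if "p \<notin> Obj X" for p using that by (simp add: pushforward_def)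
  fix c y0 vs assume c: "c \<in> charts (gobj X)" and y0: "y0 \<in> fst c"
  then have cy: "c \<in> charts_at (gobj X) y0" by (simp add: charts_at_def)
  note oc = charts_atD(4)[OF obj cy]
  have yO: "y0 \<in> Obj X" using openin_subset[OF oc] y0 by blast
  obtain F :: "'b set" and V \<tau> where s: "finite F" "openin OT V" "y0 \<in> V"
    "\<forall>z\<in>F. \<forall>y\<in>V. \<tau> z y \<in> Mor X \<and> tgt (\<tau> z y) = y"
    "\<forall>y\<in>V. inj_on (\<lambda>z. \<tau> z y) F"
    "\<forall>y\<in>V. {z \<in> Mor X. tgt z = y \<and> src z \<in> support (gobj X) \<alpha>} \<subseteq> (\<lambda>z. \<tau> z y) ` F"
    "\<forall>z\<in>F. \<forall>y\<in>V. smooth_at (gobj X) (gobj X) (src \<circ> \<tau> z) y"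
    "\<forall>z\<in>F. \<forall>y\<in>V. \<forall>\<eta>\<in>T0 y. differential (gobj X) (gobj X) (src \<circ> \<tau> z) y \<eta> = transport (\<tau> z y) \<eta>"
    using tgt_sheets[OF C yO] .
  let ?A = "\<lambda>z y. \<alpha> ((src \<circ> \<tau> z) y) (map (differential (gobj X) (gobj X) (src \<circ> \<tau> z) y)
    (map (coord_tvec (gobj X) y c) vs))"
  have "smooth_near OT c y0 (\<lambda>y. \<Sum>z\<in>F. ?A z y)"
  proof (rule smooth_near_sum[OF charts_atD(1)[OF obj cy] y0])
    fix z assume z: "z \<in> F"
    show "smooth_near OT c y0 (?A z)"
      by (rule smooth_near_pullback[OF obj obj s(2,3) _ \<alpha>f cy]) (use s(7) z in blast)
  qed
  then show "smooth_near OT c y0 (\<lambda>y. ?J y (map (coord_tvec (gobj X) y c) vs))"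
  proof (rule smooth_near_cong)
    show "openin OT (V \<inter> fst c)" "y0 \<in> V \<inter> fst c" using s(2,3) oc y0 by auto
    fix y assume y: "y \<in> V \<inter> fst c"
    let ?\<eta>s = "map (coord_tvec (gobj X) y c) vs"
    have cy': "c \<in> charts_at (gobj X) y" using y c by (simp add: charts_at_def)
    have yO: "y \<in> Obj X" using openin_subset[OF oc] y by blast
    have \<eta>s: "set ?\<eta>s \<subseteq> T0 y" using coord_tvec_in_tangent_space[OF obj cy'] by auto
    let ?S = "(\<lambda>z. \<tau> z y) ` F"
    \<comment> \<open>All sheets enter the sum, including those whose source has left the support:
      the corresponding terms are zero. The index set \<open>F\<close> is thereby constant in
      \<open>y\<close>.\<close>
    have "?J y ?\<eta>s = (\<Sum>z\<in>?S. \<alpha> (src z) (map (transport z) ?\<eta>s))"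
    proof (rule tgt_push_src_pull_finite[OF \<alpha>f yO \<eta>s])
      show "finite ?S" using s(1) by blast
      show "?S \<subseteq> {z \<in> Mor X. tgt z = y}" using s(4) y by blast
      fix z assume z: "z \<in> Mor X" "tgt z = y" "\<alpha> (src z) \<noteq> (\<lambda>_. 0)"
      then have "src z \<in> support (gobj X) \<alpha>" using in_support[OF src_in] by blast
      then show "z \<in> ?S" using s(6) y z by blast
    qed
    also have "\<dots> = (\<Sum>z\<in>F. \<alpha> (src (\<tau> z y)) (map (transport (\<tau> z y)) ?\<eta>s))"
      using s(5) y by (subst sum.reindex) auto
    also have "\<dots> = (\<Sum>z\<in>F. ?A z y)"
    proof (rule sum.cong[OF refl])
      fix z assume z: "z \<in> F"
      have "map (transport (\<tau> z y)) ?\<eta>s = map (differential (gobj X) (gobj X) (src \<circ> \<tau> z) y) ?\<eta>s"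
        by (rule map_cong[OF refl]) (use s(8) z y \<eta>s in auto)
      then show "\<alpha> (src (\<tau> z y)) (map (transport (\<tau> z y)) ?\<eta>s) = ?A z y" by (simp only: comp_apply)
    qed
    finally show "(\<Sum>z\<in>F. ?A z y) = ?J y ?\<eta>s" by (rule sym)
  qed
qed

end

section \<open>The maps \<open>J\<close> and \<open>K\<close>\<close>

text \<open>The three sums run over different nonzero sets, possibly with cancellation on the left;
  all are extended to the union of the two nonzero sets on the right. Its finiteness matters, as a
  sum over an infinite set is 0 by convention.\<close>

lemma pushforward_lincomb:
  assumes "\<And>y. finite {z \<in> topspace (mtop M). f z = y \<and> \<beta> z \<noteq> (\<lambda>_. 0)}"
    and "\<And>y. finite {z \<in> topspace (mtop M). f z = y \<and> \<beta>' z \<noteq> (\<lambda>_. 0)}"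
  shows "pushforward M N f (\<lambda>p \<xi>s. a * \<beta> p \<xi>s + b * \<beta>' p \<xi>s) y \<eta>s =
    a * pushforward M N f \<beta> y \<eta>s + b * pushforward M N f \<beta>' y \<eta>s"
proof (cases "y \<in> topspace (mtop N) \<and> set \<eta>s \<subseteq> tangent_space N y")
  case True
  let ?Z = "\<lambda>\<gamma>. {z \<in> topspace (mtop M). f z = y \<and> \<gamma> z \<noteq> (\<lambda>_. 0)}"
  let ?S = "?Z \<beta> \<union> ?Z \<beta>'"
  let ?l = "\<lambda>z. map (inv_into (tangent_space M z) (differential M N f z)) \<eta>s"
  have fin: "finite ?S" using assms by blast
  have *: "pushforward M N f \<gamma> y \<eta>s = (\<Sum>z\<in>?S. \<gamma> z (?l z))" if "?Z \<gamma> \<subseteq> ?S" for \<gamma>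
  proof -
    have "(\<Sum>z\<in>?Z \<gamma>. \<gamma> z (?l z)) = (\<Sum>z\<in>?S. \<gamma> z (?l z))"
      by (rule sum.mono_neutral_left[OF fin that]) auto
    then show ?thesis using True unfolding pushforward_def by simp
  qed
  have "?Z (\<lambda>p \<xi>s. a * \<beta> p \<xi>s + b * \<beta>' p \<xi>s) \<subseteq> ?S" by auto
  from *[OF this] show ?thesis
    by (simp add: * sum.distrib sum_distrib_left)
qed (auto simp: pushforward_def)

lemma smooth_fun_compose:
  assumes M: "manifold_with_corners M" and N: "manifold_with_corners N"
    and f: "\<And>p. p \<in> topspace (mtop M) \<Longrightarrow> smooth_at M N f p" and h: "smooth_fun N h"
  shows "smooth_fun M (h \<circ> f)"
  unfolding smooth_fun_iff[OF M]
proof (intro ballI)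
  fix c p assume "c \<in> charts M" "p \<in> fst c"
  then have c: "c \<in> charts_at M p" by (simp add: charts_at_def)
  have "p \<in> topspace (mtop M)" using charts_atD(2,4)[OF M c] openin_subset by blast
  note fp = f[OF this]
  then have fpN: "f p \<in> topspace (mtop N)" unfolding smooth_at_def by blast
  obtain d where d: "d \<in> charts_at N (f p)" using charts_at_nonempty[OF N fpN] .
  obtain V where V: "openin (mtop M) V" "p \<in> V" "continuous_map (subtopology (mtop M) V) (mtop N) f"
    using fp unfolding smooth_at_def by blast
  have "smooth_near (mtop M) c p (snd d \<circ> f)" using fp c d unfolding smooth_at_def by blast
  moreover have "smooth_near (mtop N) d (f p) h"
    using h charts_atD(2,3)[OF N d] unfolding smooth_fun_iff[OF N] by blast
  ultimately show "smooth_near (mtop M) c p (h \<circ> f)"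
    by (rule smooth_near_compose[OF manifold_findim[OF M] _ _ V])
qed

context etale_groupoid
begin

section \<open>Invariance of \<open>J\<close> and its vanishing on boundaries\<close>

lemma clean_forms_objD:
  assumes "\<alpha> \<in> clean_forms_obj X"
  shows "\<alpha> \<in> forms (gobj X)" "clean_obj X (support (gobj X) \<alpha>)"
  using assms unfolding clean_forms_obj_def by blast+

lemma clean_forms_morD:
  assumes "\<beta> \<in> clean_forms_mor X"
  shows "\<beta> \<in> forms (gmor X)" "clean_mor X (support (gmor X) \<beta>)"
  using assms unfolding clean_forms_mor_def by blast+

abbreviation J :: "('a, 'e) form \<Rightarrow> ('a, 'e) form" where
  "J \<alpha> \<equiv> tgt_push X (src_pull X \<alpha>)"

text \<open>Composition with \<open>g\<close> on the left is a bijection from the target fiber over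
  \<open>src g\<close> to the one over \<open>tgt g\<close>, inverted by composition with
  \<open>ginv X g\<close>. It preserves sources, hence the values of \<alpha> involved, and
  functoriality of \<open>transport\<close> matches the arguments.\<close>

lemma J_in_groupoid_forms:
  assumes \<alpha>: "\<alpha> \<in> clean_forms_obj X"
  shows "J \<alpha> \<in> groupoid_forms X"
proof -
  note \<alpha>f = clean_forms_objD(1)[OF \<alpha>]
  have "src_pull X (J \<alpha>) g \<xi>s = tgt_pull X (J \<alpha>) g \<xi>s" for g \<xi>s
  proof (cases "g \<in> Mor X \<and> set \<xi>s \<subseteq> T1 g")
    case True
    then have g: "g \<in> Mor X" and \<xi>s: "set \<xi>s \<subseteq> T1 g" by auto
    let ?s = "map (dsrc g) \<xi>s" and ?t = "map (dtgt g) \<xi>s"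
    have s: "set ?s \<subseteq> T0 (src g)" and t: "set ?t \<subseteq> T0 (tgt g)"
      using bij_betwE[OF dsrc_bij[OF g]] bij_betwE[OF dtgt_bij[OF g]] \<xi>s by auto
    note i = inv_in[OF g]
    have "J \<alpha> (src g) ?s = J \<alpha> (tgt g) ?t"
      unfolding tgt_push_src_pull[OF \<alpha>f src_in[OF g] s] tgt_push_src_pull[OF \<alpha>f tgt_in[OF g] t]
    proof (rule sum.reindex_bij_witness[of _ "gcomp X (ginv X g)" "gcomp X g"]; clarify)
      fix z assume z: "z \<in> Mor X" "tgt z = src g" "\<alpha> (src z) \<noteq> (\<lambda>_. 0)"
      note c = comp_in[OF g z(1) z(2)[symmetric]]
      show "gcomp X (ginv X g) (gcomp X g z) = z" using inv_cancel_left(1)[OF g z(1)] z(2) by simp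
      show "gcomp X g z \<in> Mor X \<and> tgt (gcomp X g z) = tgt g \<and> \<alpha> (src (gcomp X g z)) \<noteq> (\<lambda>_. 0)"
        using c z(3) by simp
      have "map (transport (gcomp X g z)) ?t = map (transport z) ?s"
        unfolding map_map
      proof (rule map_cong[OF refl])
        fix \<xi> assume "\<xi> \<in> set \<xi>s"
        then have \<xi>: "\<xi> \<in> T1 g" using \<xi>s by blast
        have "dtgt g \<xi> \<in> T0 (tgt g)" using bij_betwE[OF dtgt_bij[OF g]] \<xi> by blast
        from transport_comp[OF g z(1) z(2)[symmetric] this] transport_dtgt[OF g \<xi>]
        show "(transport (gcomp X g z) \<circ> dtgt g) \<xi> = (transport z \<circ> dsrc g) \<xi>" by simp
      qed
      then show "\<alpha> (src (gcomp X g z)) (map (transport (gcomp X g z)) ?t) = \<alpha> (src z) (map (transport z) ?s)"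
        by (simp only: c(2))
    next
      fix z assume z: "z \<in> Mor X" "tgt z = tgt g" "\<alpha> (src z) \<noteq> (\<lambda>_. 0)"
      have iz: "src (ginv X g) = tgt z" using i z by simp
      show "gcomp X g (gcomp X (ginv X g) z) = z" using inv_cancel_left(2)[OF g z(1)] z(2) by simp
      show "gcomp X (ginv X g) z \<in> Mor X \<and> tgt (gcomp X (ginv X g) z) = src g \<and>
          \<alpha> (src (gcomp X (ginv X g) z)) \<noteq> (\<lambda>_. 0)"
        using comp_in[OF i(1) z(1) iz] i z by simp
    qed
    then show ?thesis using g \<xi>s by (simp add: pullback_def)
  qed (auto simp: pullback_def)
  then show ?thesis unfolding groupoid_forms_def using J_in_forms[OF \<alpha>] by blast
qed

text \<open>After the boundary relation is inserted termwise, both push-forwards of \<beta> become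
  double sums over pairs, and right composition reindexes one as the other. Working with \<alpha>
  and \<alpha>' directly avoids applying \<open>J\<close> to a difference.\<close>

lemma J_eq_of_boundary:
  assumes \<alpha>: "\<alpha> \<in> clean_forms_obj X" and \<alpha>': "\<alpha>' \<in> clean_forms_obj X" and \<beta>: "\<beta> \<in> clean_forms_mor X"
    and eq: "\<And>p \<xi>s. \<alpha> p \<xi>s - \<alpha>' p \<xi>s = src_push X \<beta> p \<xi>s - tgt_push X \<beta> p \<xi>s"
  shows "J \<alpha> = J \<alpha>'"
proof (intro ext)
  fix y \<eta>s
  show "J \<alpha> y \<eta>s = J \<alpha>' y \<eta>s"
  proof (cases "y \<in> Obj X \<and> set \<eta>s \<subseteq> T0 y")
    case True
    then have y: "y \<in> Obj X" and \<eta>s: "set \<eta>s \<subseteq> T0 y" by auto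
    note f = clean_forms_objD(1)[OF \<alpha>] clean_forms_objD(1)[OF \<alpha>']
    let ?B = "support (gmor X) \<beta>"
    \<comment> \<open>One clean set controlling all sums: the supports cover the terms of \<alpha>
      and \<alpha>', and both images of \<open>?B\<close> keep the reindexing inside
      \<open>S\<close>, because the source of \<open>gcomp X z w\<close> is \<open>src w\<close> and
      that of \<open>gcomp X z (ginv X w)\<close> is \<open>tgt w\<close>.\<close>
    let ?C = "(support (gobj X) \<alpha> \<union> support (gobj X) \<alpha>') \<union> (src ` ?B \<union> tgt ` ?B)"
    have "clean_obj X (src ` ?B)" "clean_obj X (tgt ` ?B)"
      using clean_forms_morD(2)[OF \<beta>] unfolding clean_mor_def by blast+
    then have C: "clean_obj X ?C"
      by (intro clean_obj_Un clean_forms_objD(2)[OF \<alpha>] clean_forms_objD(2)[OF \<alpha>'])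
    define S where "S = {z \<in> Mor X. tgt z = y \<and> src z \<in> ?C}"
    have S: "finite S" unfolding S_def by (rule clean_obj_finite_tgt_fiber[OF C])
    have S_sub: "S \<subseteq> {z \<in> Mor X. tgt z = y}" unfolding S_def by blast
    let ?\<zeta> = "\<lambda>z. map (transport z) \<eta>s"
    define P where "P z = {w \<in> Mor X. src w = src z \<and> \<beta> w \<noteq> (\<lambda>_. 0)}" for z
    define Q where "Q z = {w \<in> Mor X. tgt w = src z \<and> \<beta> w \<noteq> (\<lambda>_. 0)}" for z
    have \<beta>B: "w \<in> ?B" if "w \<in> Mor X" "\<beta> w \<noteq> (\<lambda>_. 0)" for w
      using that by (rule in_support)
    have J1: "J \<alpha> y \<eta>s = (\<Sum>z\<in>S. \<alpha> (src z) (?\<zeta> z))"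
      by (rule tgt_push_src_pull_finite[OF f(1) y \<eta>s S S_sub])
        (use in_support[OF src_in, of _ \<alpha>] in \<open>auto simp: S_def\<close>)
    have J2: "J \<alpha>' y \<eta>s = (\<Sum>z\<in>S. \<alpha>' (src z) (?\<zeta> z))"
      by (rule tgt_push_src_pull_finite[OF f(2) y \<eta>s S S_sub])
        (use in_support[OF src_in, of _ \<alpha>'] in \<open>auto simp: S_def\<close>)
    have zT: "src z \<in> Obj X" "set (?\<zeta> z) \<subseteq> T0 (src z)" if "z \<in> S" for z
      using that transport_in src_in \<eta>s unfolding S_def by auto
    have p1: "src_push X \<beta> (src z) (?\<zeta> z) = (\<Sum>w\<in>P z. \<beta> w (map (dsrc_inv w) (?\<zeta> z)))" if "z \<in> S" for z
      using zT[OF that] unfolding pushforward_def P_def by simp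
    have p2: "tgt_push X \<beta> (src z) (?\<zeta> z) = (\<Sum>w\<in>Q z. \<beta> w (map (dtgt_inv w) (?\<zeta> z)))" if "z \<in> S" for z
      using zT[OF that] unfolding pushforward_def Q_def by simp
    have fin: "\<forall>z\<in>S. finite (P z)" "\<forall>z\<in>S. finite (Q z)"
      unfolding P_def Q_def using finite_src_fiber[OF \<beta>] finite_tgt_fiber[OF \<beta>] by blast+
    have "(\<Sum>z\<in>S. \<Sum>w\<in>Q z. \<beta> w (map (dtgt_inv w) (?\<zeta> z))) =
        (\<Sum>z\<in>S. \<Sum>w\<in>P z. \<beta> w (map (dsrc_inv w) (?\<zeta> z)))"
      unfolding sum.Sigma[OF S fin(1)] sum.Sigma[OF S fin(2)]
    proof (rule sum.reindex_bij_witness[of _ "\<lambda>(z, w). (gcomp X z (ginv X w), w)" "\<lambda>(z, w). (gcomp X z w, w)"])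
      fix x assume "x \<in> Sigma S Q"
      then obtain z w where x: "x = (z, w)" and z: "z \<in> S" and w: "w \<in> Q z" by blast
      have zM: "z \<in> Mor X" "tgt z = y" using z unfolding S_def by blast+
      have wM: "w \<in> Mor X" "src z = tgt w" "\<beta> w \<noteq> (\<lambda>_. 0)" using w unfolding Q_def by auto
      note c = comp_in[OF zM(1) wM(1,2)]
      show "(case case x of (z, w) \<Rightarrow> (gcomp X z w, w) of (z, w) \<Rightarrow> (gcomp X z (ginv X w), w)) = x"
        using inv_cancel_right(1)[OF wM(1) zM(1) wM(2)] by (simp add: x)
      have "src w \<in> ?C" using \<beta>B[OF wM(1,3)] by blast
      then show "(case x of (z, w) \<Rightarrow> (gcomp X z w, w)) \<in> Sigma S P"
        using c zM wM by (simp add: x S_def P_def)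
      have "map (dsrc_inv w) (?\<zeta> (gcomp X z w)) = map (dtgt_inv w) (?\<zeta> z)"
        unfolding map_map
      proof (rule map_cong[OF refl])
        fix \<eta> assume "\<eta> \<in> set \<eta>s"
        then have \<eta>: "\<eta> \<in> T0 (tgt z)" using \<eta>s zM(2) by blast
        have \<zeta>: "transport z \<eta> \<in> T0 (tgt w)" using transport_in[OF zM(1) \<eta>] wM(2) by simp
        \<comment> \<open>Transport along the composite ends with \<open>transport w\<close>, which
          is \<open>dsrc w\<close> after \<open>dtgt_inv w\<close>; the outer inverse cancels
          \<open>dsrc w\<close>, leaving the term of the target push-forward.\<close>
        have "dsrc_inv w (transport (gcomp X z w) \<eta>) = dsrc_inv w (dsrc w (dtgt_inv w (transport z \<eta>)))"
          by (simp add: transport_comp[OF zM(1) wM(1,2) \<eta>] transport_def[of w])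
        also have "\<dots> = dtgt_inv w (transport z \<eta>)"
          by (rule bij_betw_inv_into_left[OF dsrc_bij[OF wM(1)] dtgt_inv(1)[OF wM(1) \<zeta>]])
        finally show "(dsrc_inv w \<circ> transport (gcomp X z w)) \<eta> = (dtgt_inv w \<circ> transport z) \<eta>" by simp
      qed
      then show "(case case x of (z, w) \<Rightarrow> (gcomp X z w, w) of (z, w) \<Rightarrow> \<beta> w (map (dsrc_inv w) (?\<zeta> z))) =
          (case x of (z, w) \<Rightarrow> \<beta> w (map (dtgt_inv w) (?\<zeta> z)))"
        by (simp only: x prod.case)
    next
      fix x assume "x \<in> Sigma S P"
      then obtain z w where x: "x = (z, w)" and z: "z \<in> S" and w: "w \<in> P z" by blast
      have zM: "z \<in> Mor X" "tgt z = y" using z unfolding S_def by blast+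
      have wM: "w \<in> Mor X" "src z = src w" "\<beta> w \<noteq> (\<lambda>_. 0)" using w unfolding P_def by auto
      note i = inv_in[OF wM(1)]
      have zi: "src z = tgt (ginv X w)" using i wM by simp
      note c = comp_in[OF zM(1) i(1) zi]
      show "(case case x of (z, w) \<Rightarrow> (gcomp X z (ginv X w), w) of (z, w) \<Rightarrow> (gcomp X z w, w)) = x"
        using inv_cancel_right(2)[OF wM(1) zM(1) wM(2)] by (simp add: x)
      have "tgt w \<in> ?C" using \<beta>B[OF wM(1,3)] by blast
      then show "(case x of (z, w) \<Rightarrow> (gcomp X z (ginv X w), w)) \<in> Sigma S Q"
        using c i zM wM by (simp add: x S_def Q_def)
    qed
    then have "(\<Sum>z\<in>S. src_push X \<beta> (src z) (?\<zeta> z) - tgt_push X \<beta> (src z) (?\<zeta> z)) = 0"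
      by (simp add: sum_subtractf p1 p2)
    then have "(\<Sum>z\<in>S. \<alpha> (src z) (?\<zeta> z) - \<alpha>' (src z) (?\<zeta> z)) = 0" by (simp only: eq)
    then show ?thesis unfolding J1 J2 by (simp add: sum_subtractf)
  qed (auto simp: pushforward_def)
qed

section \<open>Partitions of unity and the homotopy form\<close>

lemma support_fun_form:
  assumes "x \<in> Obj X" "\<rho> x \<noteq> 0"
  shows "x \<in> support (gobj X) (fun_form (gobj X) \<rho>)"
proof (rule in_support[OF assms(1)])
  show "fun_form (gobj X) \<rho> x \<noteq> (\<lambda>_. 0)"
    using assms by (auto simp: fun_form_def dest: fun_cong[of _ _ "[]"])
qed

text \<open>The degree-zero content of the defining identity, obtained by evaluating both sides on
  the empty list of tangent vectors.\<close>

lemma partition_sum_tgt: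
  assumes \<rho>: "partition_of_unity X \<rho>" and x: "x \<in> Obj X"
  shows "(\<Sum>z | z \<in> Mor X \<and> tgt z = x \<and> \<rho> (src z) \<noteq> 0. \<rho> (src z)) = 1"
proof -
  let ?r = "src_pull X (fun_form (gobj X) \<rho>)"
  have r: "?r z [] = \<rho> (src z)" if "z \<in> Mor X" for z
    using that src_in[OF that] by (simp add: pullback_def fun_form_def)
  have "?r z \<xi>s = 0" if "\<rho> (src z) = 0" for z \<xi>s
    using that by (simp add: pullback_def fun_form_def)
  then have "?r z = (\<lambda>_. 0) \<longleftrightarrow> \<rho> (src z) = 0" if "z \<in> Mor X" for z
    using r[OF that] by (auto simp: fun_eq_iff)
  then have "{z \<in> Mor X. tgt z = x \<and> ?r z \<noteq> (\<lambda>_. 0)} = {z. z \<in> Mor X \<and> tgt z = x \<and> \<rho> (src z) \<noteq> 0}"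
    by blast
  then have "tgt_push X ?r x [] = (\<Sum>z | z \<in> Mor X \<and> tgt z = x \<and> \<rho> (src z) \<noteq> 0. \<rho> (src z))"
    using x r by (simp add: pushforward_def)
  moreover have "tgt_push X ?r x [] = 1"
    using \<rho> x unfolding partition_of_unity_def by (simp add: fun_form_def)
  ultimately show ?thesis by simp
qed

text \<open>Inversion turns the target fiber into the source fiber. This version supplies the total
  weight when \<open>s_*\<close> is applied to the product of pullbacks below.\<close>

lemma partition_sum_src:
  assumes \<rho>: "partition_of_unity X \<rho>" and x: "x \<in> Obj X"
  shows "(\<Sum>w | w \<in> Mor X \<and> src w = x \<and> \<rho> (tgt w) \<noteq> 0. \<rho> (tgt w)) = 1"
  unfolding partition_sum_tgt[OF assms, symmetric]
  by (rule sum.reindex_bij_witness[of _ "ginv X" "ginv X"]) (auto simp: inv_inv inv_in)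

lemma partition_times_clean:
  assumes \<rho>: "partition_of_unity X \<rho>" and \<alpha>: "\<alpha> \<in> forms (gobj X)"
  shows "fun_times \<rho> \<alpha> \<in> clean_forms_obj X"
proof -
  have \<rho>s: "smooth_fun (gobj X) \<rho>" and C: "clean_obj X (support (gobj X) (fun_form (gobj X) \<rho>))"
    using \<rho> unfolding partition_of_unity_def by blast+
  have "support (gobj X) (fun_times \<rho> \<alpha>) \<subseteq> support (gobj X) (fun_form (gobj X) \<rho>)"
  proof (rule support_minimal[OF closedin_support])
    fix p assume p: "p \<in> Obj X" "fun_times \<rho> \<alpha> p \<noteq> (\<lambda>_. 0)"
    then have "\<rho> p \<noteq> 0" by (auto simp: fun_times_def)
    then show "p \<in> support (gobj X) (fun_form (gobj X) \<rho>)" by (rule support_fun_form[OF p(1)])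
  qed
  then show ?thesis
    unfolding clean_forms_obj_def
    using fun_times_in_forms[OF obj \<rho>s \<alpha>] clean_obj_subset[OF C _ closedin_support] by blast
qed

lemma J_partition_times:
  assumes \<rho>: "partition_of_unity X \<rho>" and \<alpha>: "\<alpha> \<in> groupoid_forms X"
  shows "J (fun_times \<rho> \<alpha>) = \<alpha>"
proof (intro ext)
  have \<alpha>f: "\<alpha> \<in> forms (gobj X)" and inv: "src_pull X \<alpha> = tgt_pull X \<alpha>"
    using \<alpha> unfolding groupoid_forms_def by blast+
  note \<rho>\<alpha> = clean_forms_objD(1)[OF partition_times_clean[OF \<rho> \<alpha>f]]
  fix y \<eta>s
  show "J (fun_times \<rho> \<alpha>) y \<eta>s = \<alpha> y \<eta>s"
  proof (cases "y \<in> Obj X \<and> set \<eta>s \<subseteq> T0 y")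
    case True
    then have y: "y \<in> Obj X" and \<eta>s: "set \<eta>s \<subseteq> T0 y" by auto
    let ?S = "{z. z \<in> Mor X \<and> tgt z = y \<and> \<rho> (src z) \<noteq> 0}"
    \<comment> \<open>Over an infinite index set the sum would be 0 by convention, contradicting
      that it equals 1.\<close>
    have fin: "finite ?S"
      using partition_sum_tgt[OF \<rho> y] by (rule contrapos_pp) (simp add: sum.infinite)
    have "\<alpha> (src z) (map (transport z) \<eta>s) = \<alpha> y \<eta>s" if "z \<in> ?S" for z
    proof -
      have z: "z \<in> Mor X" "tgt z = y" using that by blast+
      \<comment> \<open>Invariance of \<alpha> is evaluated on these lifts of \<open>\<eta>s\<close>
        through the target: the source side becomes \<alpha> on transported vectors and the target
        side \<alpha> on \<open>\<eta>s\<close>.\<close>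
      let ?\<xi>s = "map (dtgt_inv z) \<eta>s"
      have "set ?\<xi>s \<subseteq> T1 z" using dtgt_inv(1)[OF z(1)] z(2) \<eta>s by auto
      moreover have "map (dsrc z) ?\<xi>s = map (transport z) \<eta>s"
        by (simp add: transport_def[abs_def] comp_def)
      moreover have "map (dtgt z) ?\<xi>s = \<eta>s"
        using dtgt_inv(2)[OF z(1)] z(2) \<eta>s by (auto intro!: map_idI)
      moreover have "src_pull X \<alpha> z ?\<xi>s = tgt_pull X \<alpha> z ?\<xi>s" by (simp only: inv)
      ultimately show ?thesis using z by (simp add: pullback_def del: map_map)
    qed
    then have "(\<Sum>z\<in>?S. fun_times \<rho> \<alpha> (src z) (map (transport z) \<eta>s)) = (\<Sum>z\<in>?S. \<rho> (src z)) * \<alpha> y \<eta>s"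
      by (simp add: fun_times_def sum_distrib_right)
    moreover have "J (fun_times \<rho> \<alpha>) y \<eta>s = (\<Sum>z\<in>?S. fun_times \<rho> \<alpha> (src z) (map (transport z) \<eta>s))"
      by (rule tgt_push_src_pull_finite[OF \<rho>\<alpha> y \<eta>s fin]) (auto simp: fun_times_def)
    ultimately show ?thesis using partition_sum_tgt[OF \<rho> y] by simp
  next
    case False
    then have "J (fun_times \<rho> \<alpha>) y \<eta>s = 0" by (auto simp: pushforward_def)
    moreover have "\<alpha> y \<eta>s = 0"
    proof (cases "y \<in> Obj X")
      case True
      then show ?thesis using False obj_form_outside[OF \<alpha>f] by blast
    next
      case False
      then have "\<alpha> y = (\<lambda>_. 0)" using \<alpha>f unfolding forms_iff[OF obj] by blast
      then show ?thesis by simp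
    qed
    ultimately show ?thesis by simp
  qed
qed

lemma clean_relI:
  assumes "\<alpha> \<in> clean_forms_obj X" "\<alpha>' \<in> clean_forms_obj X" "\<beta> \<in> clean_forms_mor X"
    "\<And>p \<xi>s. \<alpha> p \<xi>s - \<alpha>' p \<xi>s = src_push X \<beta> p \<xi>s - tgt_push X \<beta> p \<xi>s"
  shows "(\<alpha>, \<alpha>') \<in> clean_rel X"
  unfolding clean_rel_def mem_Collect_eq prod.case
  by (intro conjI assms(1,2) bexI[OF _ assms(3)] allI assms(4))

lemma partition_times_J_rel:
  assumes \<rho>: "partition_of_unity X \<rho>" and \<alpha>: "\<alpha> \<in> clean_forms_obj X"
  shows "(\<alpha>, fun_times \<rho> (J \<alpha>)) \<in> clean_rel X"
proof -
  note \<alpha>f = clean_forms_objD(1)[OF \<alpha>] and \<alpha>c = clean_forms_objD(2)[OF \<alpha>]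
  have \<rho>s: "smooth_fun (gobj X) \<rho>" and C: "clean_obj X (support (gobj X) (fun_form (gobj X) \<rho>))"
    using \<rho> unfolding partition_of_unity_def by blast+
  define \<beta> where "\<beta> = fun_times (\<rho> \<circ> tgt) (src_pull X \<alpha>)"
  have \<beta>f: "\<beta> \<in> forms (gmor X)"
    unfolding \<beta>_def
    by (intro fun_times_in_forms[OF mor] smooth_fun_compose[OF mor obj tgt_smooth_at \<rho>s]
        pullback_in_forms[OF mor obj src_smooth_at \<alpha>f])
  have \<beta>0: "\<beta> w \<noteq> (\<lambda>_. 0) \<longleftrightarrow> \<rho> (tgt w) \<noteq> 0 \<and> \<alpha> (src w) \<noteq> (\<lambda>_. 0)" if "w \<in> Mor X" for w
    unfolding src_pull_zero_iff[OF \<alpha>f that, symmetric] by (auto simp: \<beta>_def fun_times_def fun_eq_iff)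
  let ?D = "support (gmor X) \<beta>" and ?R = "support (gobj X) (fun_form (gobj X) \<rho>)"
    and ?A = "support (gobj X) \<alpha>"
  have "?D \<subseteq> {w \<in> Mor X. tgt w \<in> ?R} \<inter> {w \<in> Mor X. src w \<in> ?A}"
  proof (rule support_minimal)
    show "closedin MT ({w \<in> Mor X. tgt w \<in> ?R} \<inter> {w \<in> Mor X. src w \<in> ?A})"
      by (intro closedin_Int closedin_continuous_map_preimage[OF tgt_continuous]
          closedin_continuous_map_preimage[OF src_continuous] closedin_support)
    fix w assume w: "w \<in> Mor X" "\<beta> w \<noteq> (\<lambda>_. 0)"
    then show "w \<in> {w \<in> Mor X. tgt w \<in> ?R} \<inter> {w \<in> Mor X. src w \<in> ?A}"
      using \<beta>0[OF w(1)] support_fun_form[OF tgt_in[OF w(1)]] in_support[OF src_in[OF w(1)]] by blast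
  qed
  then have sub: "tgt ` ?D \<subseteq> ?R" "src ` ?D \<subseteq> ?A" by auto
  \<comment> \<open>The targets lie in the clean support of \<rho> and the sources in that of
    \<alpha>. Closedness of the source image follows from the first inclusion and that of the target
    image from the second.\<close>
  have "clean_mor X ?D"
    unfolding clean_mor_def
    by (intro conjI closedin_support
        clean_obj_subset[OF \<alpha>c sub(2) clean_obj_closed_src[OF C closedin_support sub(1)]]
        clean_obj_subset[OF C sub(1) clean_obj_closed_tgt[OF \<alpha>c closedin_support sub(2)]])
  then have \<beta>: "\<beta> \<in> clean_forms_mor X" unfolding clean_forms_mor_def using \<beta>f by blast
  have \<rho>J: "fun_times \<rho> (J \<alpha>) \<in> clean_forms_obj X" by (rule partition_times_clean[OF \<rho> J_in_forms[OF \<alpha>]])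
  have "src_push X \<beta> p \<xi>s - tgt_push X \<beta> p \<xi>s = \<alpha> p \<xi>s - fun_times \<rho> (J \<alpha>) p \<xi>s" for p \<xi>s
  proof (cases "p \<in> Obj X \<and> set \<xi>s \<subseteq> T0 p")
    case True
    then have p: "p \<in> Obj X" and \<xi>s: "set \<xi>s \<subseteq> T0 p" by auto
    have "src_push X \<beta> p \<xi>s = \<alpha> p \<xi>s"
    proof -
      have t: "\<beta> w (map (dsrc_inv w) \<xi>s) = \<rho> (tgt w) * \<alpha> p \<xi>s" if w: "w \<in> Mor X" "src w = p" for w
      proof -
        have "set (map (dsrc_inv w) \<xi>s) \<subseteq> T1 w" using dsrc_inv(1)[OF w(1)] w(2) \<xi>s by auto
        moreover have "map (dsrc w) (map (dsrc_inv w) \<xi>s) = \<xi>s"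
          using dsrc_inv(2)[OF w(1)] w(2) \<xi>s by (auto intro!: map_idI)
        ultimately show ?thesis
          using w unfolding \<beta>_def fun_times_def pullback_def by simp
      qed
      have "src_push X \<beta> p \<xi>s = (\<Sum>w | w \<in> Mor X \<and> src w = p \<and> \<beta> w \<noteq> (\<lambda>_. 0). \<rho> (tgt w) * \<alpha> p \<xi>s)"
        using p \<xi>s t by (simp add: pushforward_def)
      also have "\<dots> = \<alpha> p \<xi>s"
      \<comment> \<open>The nonzero set of \<open>\<beta>\<close> on the source fiber is that of the
        weights only if \<alpha> does not vanish at \<open>p\<close>; if it does, every term and the
        claimed value are 0.\<close>
      proof (cases "\<alpha> p = (\<lambda>_. 0)")
        case False
        then have "{w. w \<in> Mor X \<and> src w = p \<and> \<beta> w \<noteq> (\<lambda>_. 0)} = {w. w \<in> Mor X \<and> src w = p \<and> \<rho> (tgt w) \<noteq> 0}"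
          using \<beta>0 by blast
        then show ?thesis using partition_sum_src[OF \<rho> p] by (simp flip: sum_distrib_right)
      qed simp
      finally show ?thesis .
    qed
    moreover have "tgt_push X \<beta> p \<xi>s = \<rho> p * J \<alpha> p \<xi>s"
    proof -
      have t: "\<beta> w (map (dtgt_inv w) \<xi>s) = \<rho> p * src_pull X \<alpha> w (map (dtgt_inv w) \<xi>s)"
        if w: "w \<in> Mor X" "tgt w = p" for w
        using w unfolding \<beta>_def fun_times_def by simp
      have "tgt_push X \<beta> p \<xi>s = (\<Sum>w | w \<in> Mor X \<and> tgt w = p \<and> \<beta> w \<noteq> (\<lambda>_. 0).
          \<rho> p * src_pull X \<alpha> w (map (dtgt_inv w) \<xi>s))"
        using p \<xi>s t by (simp add: pushforward_def)
      also have "\<dots> = \<rho> p * (\<Sum>w | w \<in> Mor X \<and> tgt w = p \<and> src_pull X \<alpha> w \<noteq> (\<lambda>_. 0).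
          src_pull X \<alpha> w (map (dtgt_inv w) \<xi>s))"
      \<comment> \<open>On the target fiber the weight is the constant \<open>\<rho> p\<close>. If
        it is 0, the index sets may differ but both sides vanish; otherwise they coincide.\<close>
      proof (cases "\<rho> p = 0")
        case False
        then have "{w. w \<in> Mor X \<and> tgt w = p \<and> \<beta> w \<noteq> (\<lambda>_. 0)} =
            {w. w \<in> Mor X \<and> tgt w = p \<and> src_pull X \<alpha> w \<noteq> (\<lambda>_. 0)}"
          using \<beta>0 src_pull_zero_iff[OF \<alpha>f] by blast
        then show ?thesis by (simp add: sum_distrib_left)
      qed simp
      also have "\<dots> = \<rho> p * J \<alpha> p \<xi>s" using p \<xi>s by (simp add: pushforward_def)
      finally show ?thesis .
    qed
    ultimately show ?thesis by (simp add: fun_times_def)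
  next
    case False
    have "\<alpha> p \<xi>s = 0"
    proof (cases "p \<in> Obj X")
      case True
      then show ?thesis using False obj_form_outside[OF \<alpha>f] by blast
    next
      case False
      then have "\<alpha> p = (\<lambda>_. 0)" using \<alpha>f unfolding forms_iff[OF obj] by blast
      then show ?thesis by simp
    qed
    then show ?thesis using False by (auto simp: pushforward_def fun_times_def)
  qed
  then show ?thesis by (intro clean_relI[OF \<alpha> \<rho>J \<beta>]) simp
qed

section \<open>Congruence classes and the inverse maps\<close>

lemma clean_rel_refl:
  assumes "\<alpha> \<in> clean_forms_obj X"
  shows "(\<alpha>, \<alpha>) \<in> clean_rel X"
proof -
  let ?z = "(\<lambda>_ _. 0) :: ('b, 'e) form"
  have "support (gmor X) ?z = {}" by (simp add: support_def)
  then have "?z \<in> clean_forms_mor X"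
    using zero_in_forms[OF mor] clean_obj_empty by (simp add: clean_forms_mor_def clean_mor_def)
  moreover have "src_push X ?z p \<xi>s = 0" "tgt_push X ?z p \<xi>s = 0" for p \<xi>s
    by (simp_all add: pushforward_def)
  ultimately show ?thesis by (intro clean_relI[of _ _ ?z] assms) simp_all
qed

lemma clean_forms_mor_lincomb:
  assumes \<beta>: "\<beta> \<in> clean_forms_mor X" and \<beta>': "\<beta>' \<in> clean_forms_mor X"
  shows "(\<lambda>p \<xi>s. a * \<beta> p \<xi>s + b * \<beta>' p \<xi>s) \<in> clean_forms_mor X"
proof -
  let ?\<gamma> = "\<lambda>p \<xi>s. a * \<beta> p \<xi>s + b * \<beta>' p \<xi>s"
  have "support (gmor X) ?\<gamma> \<subseteq> support (gmor X) \<beta> \<union> support (gmor X) \<beta>'"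
  proof (rule support_minimal)
    show "closedin MT (support (gmor X) \<beta> \<union> support (gmor X) \<beta>')"
      by (intro closedin_Un closedin_support)
    fix p assume p: "p \<in> Mor X" "?\<gamma> p \<noteq> (\<lambda>_. 0)"
    then have "\<beta> p \<noteq> (\<lambda>_. 0) \<or> \<beta>' p \<noteq> (\<lambda>_. 0)" by auto
    then show "p \<in> support (gmor X) \<beta> \<union> support (gmor X) \<beta>'" using in_support[OF p(1)] by blast
  qed
  from clean_mor_subset[OF clean_mor_Un[OF clean_forms_morD(2)[OF \<beta>] clean_forms_morD(2)[OF \<beta>']]
      closedin_support this]
  show ?thesis
    unfolding clean_forms_mor_def
    using lincomb_in_forms[OF mor clean_forms_morD(1)[OF \<beta>] clean_forms_morD(1)[OF \<beta>']] by simp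
qed

text \<open>Symmetry and transitivity at once: relations with a common left argument can be subtracted.\<close>

lemma clean_rel_euclidean:
  assumes "(\<alpha>, \<alpha>1) \<in> clean_rel X" "(\<alpha>, \<alpha>2) \<in> clean_rel X"
  shows "(\<alpha>1, \<alpha>2) \<in> clean_rel X"
proof -
  obtain \<beta>1 where 1: "\<beta>1 \<in> clean_forms_mor X" "\<alpha>1 \<in> clean_forms_obj X"
    "\<forall>p \<xi>s. \<alpha> p \<xi>s - \<alpha>1 p \<xi>s = src_push X \<beta>1 p \<xi>s - tgt_push X \<beta>1 p \<xi>s"
    using assms(1) unfolding clean_rel_def by blast
  obtain \<beta>2 where 2: "\<beta>2 \<in> clean_forms_mor X" "\<alpha>2 \<in> clean_forms_obj X"
    "\<forall>p \<xi>s. \<alpha> p \<xi>s - \<alpha>2 p \<xi>s = src_push X \<beta>2 p \<xi>s - tgt_push X \<beta>2 p \<xi>s"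
    using assms(2) unfolding clean_rel_def by blast
  \<comment> \<open>The coefficients reflect that \<open>\<alpha>1 - \<alpha>2\<close> is the
    difference of \<open>\<alpha> - \<alpha>2\<close> and \<open>\<alpha> - \<alpha>1\<close>; the
    explicit factor 1 fits the shape of the lemmas on linear combinations.\<close>
  let ?\<beta> = "\<lambda>p \<xi>s. 1 * \<beta>2 p \<xi>s + (- 1) * \<beta>1 p \<xi>s"
  have s: "src_push X ?\<beta> p \<xi>s = 1 * src_push X \<beta>2 p \<xi>s + (- 1) * src_push X \<beta>1 p \<xi>s"
    and t: "tgt_push X ?\<beta> p \<xi>s = 1 * tgt_push X \<beta>2 p \<xi>s + (- 1) * tgt_push X \<beta>1 p \<xi>s" for p \<xi>s
    by (rule pushforward_lincomb; rule finite_src_fiber finite_tgt_fiber; rule 1 2)+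
  have "\<alpha>1 p \<xi>s - \<alpha>2 p \<xi>s = src_push X ?\<beta> p \<xi>s - tgt_push X ?\<beta> p \<xi>s" for p \<xi>s
    unfolding s t using 1(3)[THEN spec, THEN spec, of p \<xi>s] 2(3)[THEN spec, THEN spec, of p \<xi>s] by linarith
  then show ?thesis by (rule clean_relI[OF 1(2) 2(2) clean_forms_mor_lincomb[OF 2(1) 1(1)]])
qed

text \<open>Symmetry results from the Euclidean property together with reflexivity, and the
  Euclidean property from either side then gives both inclusions.\<close>

lemma clean_class_eq:
  assumes "(\<alpha>, \<alpha>') \<in> clean_rel X"
  shows "clean_class X \<alpha> = clean_class X \<alpha>'"
proof -
  have "\<alpha> \<in> clean_forms_obj X" using assms unfolding clean_rel_def by blast
  then have sym: "(\<alpha>', \<alpha>) \<in> clean_rel X"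
    using clean_rel_euclidean[OF assms] clean_rel_refl by blast
  show ?thesis
    unfolding clean_class_def Image_singleton
    using clean_rel_euclidean[OF assms] clean_rel_euclidean[OF sym] by blast
qed

text \<open>The image of a class under \<open>J\<close> is a singleton: vanishing on boundaries
  bounds it from above, and reflexivity makes the class nonempty. Hence \<open>the_elem\<close>
  returns a meaningful value.\<close>

lemma J_map_clean_class:
  assumes \<alpha>: "\<alpha> \<in> clean_forms_obj X"
  shows "J_map X (clean_class X \<alpha>) = J \<alpha>"
proof -
  have "J \<alpha>' = J \<alpha>" if "\<alpha>' \<in> clean_class X \<alpha>" for \<alpha>'
  proof -
    from that obtain \<beta> where "\<beta> \<in> clean_forms_mor X" "\<alpha>' \<in> clean_forms_obj X"
      "\<forall>p \<xi>s. \<alpha> p \<xi>s - \<alpha>' p \<xi>s = src_push X \<beta> p \<xi>s - tgt_push X \<beta> p \<xi>s"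
      unfolding clean_class_def clean_rel_def by blast
    then show ?thesis using J_eq_of_boundary[OF \<alpha>] by metis
  qed
  moreover have "\<alpha> \<in> clean_class X \<alpha>" using clean_rel_refl[OF \<alpha>] unfolding clean_class_def by blast
  ultimately have "J ` clean_class X \<alpha> = {J \<alpha>}" by blast
  then show ?thesis unfolding J_map_def by simp
qed

lemma clean_class_in: "\<alpha> \<in> clean_forms_obj X \<Longrightarrow> clean_class X \<alpha> \<in> groupoid_clean_forms X"
  unfolding clean_class_def groupoid_clean_forms_def by (rule quotientI)

lemma groupoid_clean_formsE:
  assumes "A \<in> groupoid_clean_forms X"
  obtains \<alpha> where "\<alpha> \<in> clean_forms_obj X" "A = clean_class X \<alpha>"
  using assms unfolding clean_class_def groupoid_clean_forms_def by (rule quotientE)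

lemma K_map_in:
  assumes "partition_of_unity X \<rho>" "\<alpha> \<in> groupoid_forms X"
  shows "K_map X \<rho> \<alpha> \<in> groupoid_clean_forms X"
  unfolding K_map_def
  using assms by (intro clean_class_in partition_times_clean) (simp_all add: groupoid_forms_def)

lemma K_map_J_map:
  assumes \<rho>: "partition_of_unity X \<rho>" and A: "A \<in> groupoid_clean_forms X"
  shows "K_map X \<rho> (J_map X A) = A"
proof -
  obtain \<alpha> where \<alpha>: "\<alpha> \<in> clean_forms_obj X" "A = clean_class X \<alpha>"
    using A by (rule groupoid_clean_formsE)
  show ?thesis
    unfolding \<alpha>(2) J_map_clean_class[OF \<alpha>(1)] K_map_def
    by (rule clean_class_eq[OF partition_times_J_rel[OF \<rho> \<alpha>(1)], symmetric])
qed

lemma J_map_K_map: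
  assumes \<rho>: "partition_of_unity X \<rho>" and \<alpha>: "\<alpha> \<in> groupoid_forms X"
  shows "J_map X (K_map X \<rho> \<alpha>) = \<alpha>"
proof -
  have "\<alpha> \<in> forms (gobj X)" using \<alpha> unfolding groupoid_forms_def by blast
  then show ?thesis
    unfolding K_map_def
    by (simp add: J_map_clean_class partition_times_clean[OF \<rho>] J_partition_times[OF \<rho> \<alpha>])
qed

text \<open>Inserting \<open>J\<close> between the two maps gives the claim: \<open>K\<close> for
  \<rho> undoes \<open>J\<close> on the class produced by \<rho>', while \<open>J\<close> sends that
  class back to \<alpha>.\<close>

lemma K_map_independent:
  assumes \<rho>: "partition_of_unity X \<rho>" and \<rho>': "partition_of_unity X \<rho>'" and \<alpha>: "\<alpha> \<in> groupoid_forms X"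
  shows "K_map X \<rho>' \<alpha> = K_map X \<rho> \<alpha>"
  using K_map_J_map[OF \<rho> K_map_in[OF \<rho>' \<alpha>]] J_map_K_map[OF \<rho>' \<alpha>] by simp

end

theorem lemma4p12:
  fixes X :: "('a, 'b, 'e::real_inner) groupoid" and \<rho> :: "'a \<Rightarrow> real"
  assumes "etale_proper_groupoid X"
    and "partition_of_unity X \<rho>"
  shows "J_map X \<in> groupoid_clean_forms X \<rightarrow> groupoid_forms X \<and>
    (\<forall>\<alpha>\<in>clean_forms_obj X. J_map X (clean_class X \<alpha>) = tgt_push X (src_pull X \<alpha>)) \<and>
    K_map X \<rho> \<in> groupoid_forms X \<rightarrow> groupoid_clean_forms X \<and>
    (\<forall>A\<in>groupoid_clean_forms X. K_map X \<rho> (J_map X A) = A) \<and>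
    (\<forall>\<alpha>\<in>groupoid_forms X. J_map X (K_map X \<rho> \<alpha>) = \<alpha>) \<and>
    (\<forall>\<rho>'. partition_of_unity X \<rho>' \<longrightarrow>
       (\<forall>\<alpha>\<in>groupoid_forms X. K_map X \<rho>' \<alpha> = K_map X \<rho> \<alpha>))"
proof -
  interpret etale_groupoid X by (rule etale_groupoid.intro[OF assms(1)])
  have "J_map X A \<in> groupoid_forms X" if "A \<in> groupoid_clean_forms X" for A
    using that J_in_groupoid_forms J_map_clean_class by (elim groupoid_clean_formsE) simp
  then show ?thesis
    using J_map_clean_class K_map_in[OF assms(2)] K_map_J_map[OF assms(2)] J_map_K_map[OF assms(2)]
      K_map_independent[OF assms(2)] by blast
qed

end
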